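(* For any extended simple processes $A$ and $B$ (with ground frames of valid terms), we have $A\sqsubseteq_c B$ if and only if $A\sqsubseteq_r^s B$.
   Context: Terms and validity. Fix a signature $\Sigma$, names $\mathcal{N}$, disjoint sets $\mathcal{X}$ of first-order variables and $\mathcal{W}$ of handles, channels, and an equational theory $\mathsf{E}$. Recipes are terms of $\mathcal{T}(\Sigma,\mathcal{W})$. Fix a set $\mathcal{M}$ of ground terms containing a public constant; a ground term $u$ is valid if each of its syntactic subterms is $\mathsf{E}$-equal to an element of $\mathcal{M}$. Processes. Basic processes on channel $c$: $P::=0\mid\mathtt{if}\ u=v\ \mathtt{then}\ P\ \mathtt{else}\ P\mid\mathtt{in}(c,x).P\mid\mathtt{out}(c,u).P$. A simple process is a finite multiset of basic processes on pairwise distinct channels (null ones removed); a frame is a finite substitution $\{w\triangleright u,\dots\}$ from handles to terms; an extended simple process is $(\mathcal{P};\Phi)$. Concrete steps: input $\mathtt{in}(c,x).Q\xrightarrow{\mathtt{in}(c,M)}Q\{x\mapsto u\}$ if $M\in\mathcal{T}(\Sigma,\mathrm{dom}\Phi)$, $M\Phi=_\mathsf{E}u$, both valid; output $\mathtt{out}(c,u).Q\xrightarrow{\mathtt{out}(c,w)}Q$ adding $w\triangleright u$ to the frame ($w$ fresh, $u$ valid); a conditional reduces by $\tau$ to its then-branch if $u=_\mathsf{E}v$ with $u,v$ valid, else to its else-branch. Static equivalence $\Phi\sim\Phi'$: same domain, $\mathit{valid}(M\Phi)\Leftrightarrow\mathit{valid}(M\Phi')$ for every recipe $M$ over the domain,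 and $M\Phi=_\mathsf{E}N\Phi\Leftrightarrow M\Phi'=_\mathsf{E}N\Phi'$ whenever $M\Phi,N\Phi$ valid. Compressed semantics (concrete). On a basic process with frame, relations $\xrightarrow{\mathsf{tr}}_\ell$, $\ell\in\{i^*,i^+,o^*\}$, are least such that: [In] an input step followed by $\xrightarrow{\mathsf{tr}}_{i^*}$ gives $\xrightarrow{\mathtt{in}(c,M)\cdot\mathsf{tr}}_\ell$ for $\ell\in\{i^*,i^+\}$; [Out] an output step followed by $\xrightarrow{\mathsf{tr}}_{o^*}$ gives $\xrightarrow{\mathtt{out}(c,w)\cdot\mathsf{tr}}_\ell$ for $\ell\in\{i^*,o^*\}$; [Tau] a $\tau$ step followed by $\xrightarrow{\mathsf{tr}}_\ell$ gives $\xrightarrow{\mathsf{tr}}_\ell$; [Proper] $0$, $\mathtt{in}(c,x).Q$, and $\mathtt{out}(c,u).Q$ with $u$ not valid, each do $\xrightarrow{\epsilon}_{o^*}$ to themselves; [Improper] $0$ and $\mathtt{out}(c,u).Q$ with $u$ not valid do $\xrightarrow{\epsilon}_{i^*}$ to $\bot$. On simple processes, if $(Q;\Phi)\xrightarrow{\mathsf{tr}}_{i^+}(Q';\Phi')$ then $(\{Q\}\uplus\mathcal{P};\Phi)\xRightarrow{\mathsf{tr}}_c(\{Q'\}\uplus\mathcal{P};\Phi')$ if $Q'\neq\bot$ and $\xRightarrow{\mathsf{tr}}_c(\varnothing;\Phi')$ if $Q'=\bot$; steps compose by concatenation. $A\sqsubseteq_cB$ iff every $A\xRightarrow{\mathsf{tr}}_c(\mathcal{P};\Phi)$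 is matched by some $B\xRightarrow{\mathsf{tr}}_c(\mathcal{P}';\Phi')$ with $\Phi\sim\Phi'$. Symbolic setting. Second-order variables $\mathcal{X}^2$; a constraint system $(\Phi;\mathcal{S})$ has constraints $D\vdash^?X:x$ ($D\subseteq\mathcal{W}$), $u=^?v$, $u\neq^?v$; well-formed means each first- and second-order variable has a unique deduction constraint (write $D(X)$) and the dependency "$x$ depends on $y$ iff $y$ occurs in $\Phi(D)$ for the constraint $D\vdash^?X:x$" is acyclic. A solution $\theta$ maps each second-order $X$ to a recipe in $\mathcal{T}(\Sigma,D(X))$ such that some ground $\lambda$ on first-order variables satisfies: $(X\theta)(\Phi\lambda)=_\mathsf{E}x\lambda$ with both valid for each deduction constraint; $u\lambda=_\mathsf{E}v\lambda$ with both valid for each $u=^?v$; $u\lambda\neq_\mathsf{E}v\lambda$ or one not valid for each $u\neq^?v$; all of $\Phi\lambda$ valid. $\lambda$ (unique mod $\mathsf{E}$) is the substitution $\lambda_\theta$ associated to $\theta$; $\mathsf{Sol}$ denotes the set of solutions. A symbolic process $(\mathcal{P};\Phi;\mathcal{S})$ pairs a process with such a system. Symbolic steps: input $\mathtt{in}(c,y).P\xrightarrow{\mathtt{in}(c,X)}P\{y\mapsto x\}$ adding $\mathrm{dom}(\Phi)\vdash^?X:x$ ($X,x$ fresh); output $\mathtt{out}(c,u).P\xrightarrow{\mathtt{out}(c,w)}P$ adding $w\triangleright u$; conditionals reduce by $\tau$ to the then-branch adding $u=^?v$ or to the else-branch adding $u\neq^?v$. The compressed symbolic semantics $\xRightarrow{\mathsf{tr}}_c$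 uses the same rules as the concrete compressed one, except that in [Proper]/[Improper] for $\mathtt{out}(c,u).Q$ the condition "$u$ not valid" is replaced by adding $u\neq^?u$ to $\mathcal{S}$. Its traces are sequences of blocks $\mathtt{io}_c(\vec X,\vec w)=\mathtt{in}(c,X_1)\cdots\mathtt{in}(c,X_\ell)\cdot\mathtt{out}(c,w_1)\cdots\mathtt{out}(c,w_k)$ (vectors possibly empty). Dependency constraints. A dependency constraint is $\vec X\leadsto^?\vec w$ with $\vec X$ second-order variables and $\vec w$ handles. For a constraint system $(\Phi;\mathcal{S})$ and $\theta\in\mathsf{Sol}(\Phi;\mathcal{S})$, $\theta\models_{(\Phi;\mathcal{S})}\mathcal{S}_D$ iff for each $\vec X\leadsto^?\vec w$ in $\mathcal{S}_D$ there is $X_i\in\vec X$ such that every recipe $M\in\mathcal{T}(\Sigma,D(X_i))$ with $M(\Phi\lambda_\theta)=_\mathsf{E}(X_i\theta)(\Phi\lambda_\theta)$ and $M(\Phi\lambda_\theta)$ valid contains some handle of $\vec w$. Fix a total order $\prec$ on channels. For $\mathsf{tr}=\mathtt{io}_{c_1}(\vec X_1,\vec w_1)\cdots\mathtt{io}_{c_n}(\vec X_n,\vec w_n)$ and a channel $c$: if there is $k\le n$ with $c\prec c_k$ and $c_i\prec c$ for all $k<i\le n$, then $\mathrm{Dep}(\mathsf{tr},c)$ is the set of handles in $\vec w_k,\dots,\vec w_n$; otherwise it is empty. $\mathrm{AllDep}(\epsilon)=\emptyset$ and $\mathrm{AllDep}(\mathsf{tr}\cdot\mathtt{io}_c(\vec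 X,\vec w))=\mathrm{AllDep}(\mathsf{tr})\cup\{\vec X\leadsto^?\mathrm{Dep}(\mathsf{tr},c)\}$ if $\mathrm{Dep}(\mathsf{tr},c)\neq\emptyset$, and $=\mathrm{AllDep}(\mathsf{tr})$ otherwise. Reduced inclusion. For $A=(\mathcal{P};\Phi)$, $B=(\mathcal{Q};\Psi)$: $A\sqsubseteq_r^sB$ iff for every $\mathsf{tr}$ with $(\mathcal{P};\Phi;\emptyset)\xRightarrow{\mathsf{tr}}_c(\mathcal{P}';\Phi';\mathcal{S}_A)$ and every $\theta\in\mathsf{Sol}(\Phi';\mathcal{S}_A)$ with $\theta\models_{(\Phi';\mathcal{S}_A)}\mathrm{AllDep}(\mathsf{tr})$, there is $(\mathcal{Q};\Psi;\emptyset)\xRightarrow{\mathsf{tr}}_c(\mathcal{Q}';\Psi';\mathcal{S}_B)$ with $\theta\in\mathsf{Sol}(\Psi';\mathcal{S}_B)$, $\theta\models_{(\Psi';\mathcal{S}_B)}\mathrm{AllDep}(\mathsf{tr})$, and $\Phi'\lambda^A_\theta\sim\Psi'\lambda^B_\theta$. *)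

theory Defs
  imports "HOL-Library.Multiset"
begin

section \<open>Terms\<close>

text \<open>
  \<open>('f, 'n, 'v) trm\<close> has function symbols \<open>'f\<close>, names \<open>'n\<close> and variables \<open>'v\<close>. It is used with
  first-order variables \<open>'x\<close> for protocol terms and with handles \<open>'w\<close> for recipes; recipes
  contain no names. The signature is the type \<open>'f\<close> with an arity function.
\<close>

datatype ('f, names: 'n, vars: 'v) trm =
  Name 'n | Var 'v | App 'f "('f, 'n, 'v) trm list"

primrec wf_trm :: "('f \<Rightarrow> nat) \<Rightarrow> ('f, 'n, 'v) trm \<Rightarrow> bool" where
  "wf_trm ar (Name a) \<longleftrightarrow> True"
| "wf_trm ar (Var x) \<longleftrightarrow> True"
| "wf_trm ar (App f ts) \<longleftrightarrow> length ts = ar f \<and> list_all (wf_trm ar) ts"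

primrec subst :: "('v \<Rightarrow> ('f, 'n, 'u) trm) \<Rightarrow> ('f, 'n, 'v) trm \<Rightarrow> ('f, 'n, 'u) trm" where
  "subst \<sigma> (Name a) = Name a"
| "subst \<sigma> (Var x) = \<sigma> x"
| "subst \<sigma> (App f ts) = App f (map (subst \<sigma>) ts)"

primrec subterms :: "('f, 'n, 'v) trm \<Rightarrow> ('f, 'n, 'v) trm set" where
  "subterms (Name a) = {Name a}"
| "subterms (Var x) = {Var x}"
| "subterms (App f ts) = insert (App f ts) (\<Union> (set (map subterms ts)))"

definition ground :: "('f \<Rightarrow> nat) \<Rightarrow> ('f, 'n, 'v) trm \<Rightarrow> bool" where
  "ground ar t \<longleftrightarrow> wf_trm ar t \<and> vars t = {}"

definition recipes :: "('f \<Rightarrow> nat) \<Rightarrow> 'w set \<Rightarrow> ('f, 'n, 'w) trm set" where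
  "recipes ar D = {R. wf_trm ar R \<and> names R = {} \<and> vars R \<subseteq> D}"

type_synonym ('f, 'n, 'x, 'w) frame = "'w \<rightharpoonup> ('f, 'n, 'x) trm"

text \<open>Only meaningful when all handles of the recipe are in the domain of the frame.\<close>

definition app_frame :: "('f, 'n, 'x, 'w) frame \<Rightarrow> ('f, 'n, 'w) trm \<Rightarrow> ('f, 'n, 'x) trm" where
  "app_frame \<Phi> R = subst (\<lambda>w. the (\<Phi> w)) R"

definition inst_frame ::
  "('x \<Rightarrow> ('f, 'n, 'x) trm) \<Rightarrow> ('f, 'n, 'x, 'w) frame \<Rightarrow> ('f, 'n, 'x, 'w) frame" where
  "inst_frame \<rho> \<Phi> = (\<lambda>w. map_option (subst \<rho>) (\<Phi> w))"


section \<open>Processes\<close>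

datatype ('f, 'n, 'x, 'c) proc =
  Null
| Cond "('f, 'n, 'x) trm" "('f, 'n, 'x) trm" "('f, 'n, 'x, 'c) proc" "('f, 'n, 'x, 'c) proc"
| Inp 'c 'x "('f, 'n, 'x, 'c) proc"
| Outp 'c "('f, 'n, 'x) trm" "('f, 'n, 'x, 'c) proc"

primrec on_channel :: "'c \<Rightarrow> ('f, 'n, 'x, 'c) proc \<Rightarrow> bool" where
  "on_channel c Null \<longleftrightarrow> True"
| "on_channel c (Cond u v P Q) \<longleftrightarrow> on_channel c P \<and> on_channel c Q"
| "on_channel c (Inp d x P) \<longleftrightarrow> d = c \<and> on_channel c P"
| "on_channel c (Outp d u P) \<longleftrightarrow> d = c \<and> on_channel c P"

primrec wf_proc :: "('f \<Rightarrow> nat) \<Rightarrow> ('f, 'n, 'x, 'c) proc \<Rightarrow> bool" where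
  "wf_proc ar Null \<longleftrightarrow> True"
| "wf_proc ar (Cond u v P Q) \<longleftrightarrow> wf_trm ar u \<and> wf_trm ar v \<and> wf_proc ar P \<and> wf_proc ar Q"
| "wf_proc ar (Inp c x P) \<longleftrightarrow> wf_proc ar P"
| "wf_proc ar (Outp c u P) \<longleftrightarrow> wf_trm ar u \<and> wf_proc ar P"

primrec free_vars :: "('f, 'n, 'x, 'c) proc \<Rightarrow> 'x set" where
  "free_vars Null = {}"
| "free_vars (Cond u v P Q) = vars u \<union> vars v \<union> free_vars P \<union> free_vars Q"
| "free_vars (Inp c x P) = free_vars P - {x}"
| "free_vars (Outp c u P) = vars u \<union> free_vars P"

primrec all_vars :: "('f, 'n, 'x, 'c) proc \<Rightarrow> 'x set" where
  "all_vars Null = {}"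
| "all_vars (Cond u v P Q) = vars u \<union> vars v \<union> all_vars P \<union> all_vars Q"
| "all_vars (Inp c x P) = insert x (all_vars P)"
| "all_vars (Outp c u P) = vars u \<union> all_vars P"

text \<open>
  Capture is not prevented here: below, the substituted term is either ground (concrete
  semantics) or a variable occurring nowhere in the process (symbolic semantics).
\<close>

primrec subst_proc ::
  "'x \<Rightarrow> ('f, 'n, 'x) trm \<Rightarrow> ('f, 'n, 'x, 'c) proc \<Rightarrow> ('f, 'n, 'x, 'c) proc" where
  "subst_proc x t Null = Null"
| "subst_proc x t (Cond u v P Q) =
    Cond (subst (Var(x := t)) u) (subst (Var(x := t)) v) (subst_proc x t P) (subst_proc x t Q)"
| "subst_proc x t (Inp c y P) = (if y = x then Inp c y P else Inp c y (subst_proc x t P))"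
| "subst_proc x t (Outp c u P) = Outp c (subst (Var(x := t)) u) (subst_proc x t P)"

definition simple_proc :: "('f \<Rightarrow> nat) \<Rightarrow> ('f, 'n, 'x, 'c) proc multiset \<Rightarrow> bool" where
  "simple_proc ar \<P> \<longleftrightarrow>
    (\<forall>P \<in># \<P>. P \<noteq> Null \<and> wf_proc ar P \<and> free_vars P = {}) \<and>
    (\<exists>Ps cs. \<P> = mset Ps \<and> distinct cs \<and> list_all2 on_channel cs Ps)"

definition add_proc ::
  "('f, 'n, 'x, 'c) proc \<Rightarrow> ('f, 'n, 'x, 'c) proc multiset \<Rightarrow> ('f, 'n, 'x, 'c) proc multiset" where
  "add_proc Q \<P> = (if Q = Null then \<P> else add_mset Q \<P>)"

text \<open>Inputs are labelled by a recipe in concrete steps and by a second-order variable in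
  symbolic ones.\<close>

datatype ('c, 'r, 'w) action = AIn 'c 'r | AOut 'c 'w | ATau

datatype level = IStar | IPlus | OStar


section \<open>Constraint systems\<close>

datatype ('f, 'n, 'x, 'w, 'y) constr =
  Deduce "'w set" 'y 'x
| Eq "('f, 'n, 'x) trm" "('f, 'n, 'x) trm"
| Neq "('f, 'n, 'x) trm" "('f, 'n, 'x) trm"

primrec constr_vars :: "('f, 'n, 'x, 'w, 'y) constr \<Rightarrow> 'x set" where
  "constr_vars (Deduce D X x) = {x}"
| "constr_vars (Eq u v) = vars u \<union> vars v"
| "constr_vars (Neq u v) = vars u \<union> vars v"

text \<open>\<open>D(X)\<close>: well-defined because every second-order variable of a reachable system has exactly
  one deduction constraint.\<close>

definition ded_dom :: "('f, 'n, 'x, 'w, 'y) constr set \<Rightarrow> 'y \<Rightarrow> 'w set" where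
  "ded_dom S X = (THE D. \<exists>x. Deduce D X x \<in> S)"


section \<open>Blocks and dependencies\<close>

text \<open>
  A block \<open>(c, Xs, ws)\<close> stands for the sequence of actions \<open>io c Xs ws\<close>. In the compressed
  semantics only the last block of a trace can have no output, and every block has an input, so
  splitting a sequence of actions into blocks is unambiguous.
\<close>

type_synonym ('c, 'y, 'w) block = "'c \<times> 'y list \<times> 'w list"

definition io :: "'c \<Rightarrow> 'r list \<Rightarrow> 'w list \<Rightarrow> ('c, 'r, 'w) action list" where
  "io c Xs ws = map (AIn c) Xs @ map (AOut c) ws"

abbreviation chan :: "('c, 'y, 'w) block \<Rightarrow> 'c" where "chan b \<equiv> fst b"
abbreviation handles :: "('c, 'y, 'w) block \<Rightarrow> 'w list" where "handles b \<equiv> snd (snd b)"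

text \<open>There is at most one \<open>k\<close> as below.\<close>

definition Dep :: "('c::linorder, 'y, 'w) block list \<Rightarrow> 'c \<Rightarrow> 'w set" where
  "Dep bs c = {w. \<exists>k < length bs. c < chan (bs ! k) \<and>
                    (\<forall>i. k < i \<and> i < length bs \<longrightarrow> chan (bs ! i) < c) \<and>
                    (\<exists>b \<in> set (drop k bs). w \<in> set (handles b))}"

text \<open>A dependency constraint is a pair of the second-order variables and the handles. Traces grow
  at their end, hence the recursion on the reversed trace; see \<open>AllDep_snoc\<close>.\<close>

fun AllDep_rev :: "('c::linorder, 'y, 'w) block list \<Rightarrow> ('y list \<times> 'w set) set" where
  "AllDep_rev [] = {}"
| "AllDep_rev ((c, Xs, ws) # bs) =
    (if Dep (rev bs) c \<noteq> {} then AllDep_rev bs \<union> {(Xs, Dep (rev bs) c)} else AllDep_rev bs)"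

definition AllDep :: "('c::linorder, 'y, 'w) block list \<Rightarrow> ('y list \<times> 'w set) set" where
  "AllDep bs = AllDep_rev (rev bs)"

lemma AllDep_Nil: "AllDep [] = {}"
  by (simp add: AllDep_def)

lemma AllDep_snoc:
  "AllDep (bs @ [(c, Xs, ws)]) =
    (if Dep bs c \<noteq> {} then AllDep bs \<union> {(Xs, Dep bs c)} else AllDep bs)"
  by (simp only: AllDep_def rev_append rev.simps append_Nil append_Cons AllDep_rev.simps rev_rev_ident)


section \<open>Semantics\<close>

text \<open>
  \<open>E\<close> is the set of equations generating the equational theory (names are allowed in equations),
  and \<open>Msg\<close> is the set \<open>\<M>\<close> of ground terms from which validity is defined.
\<close>

locale term_model =
  fixes ar :: "'f \<Rightarrow> nat"
    and E :: "(('f, 'n, 'x) trm \<times> ('f, 'n, 'x) trm) set"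
    and Msg :: "('f, 'n, 'x) trm set"
  assumes E_wf: "(s, t) \<in> E \<Longrightarrow> wf_trm ar s \<and> wf_trm ar t"
    and Msg_ground: "m \<in> Msg \<Longrightarrow> ground ar m"
    and public_constant: "\<exists>f. ar f = 0 \<and> App f [] \<in> Msg"
begin

inductive eqE :: "('f, 'n, 'x) trm \<Rightarrow> ('f, 'n, 'x) trm \<Rightarrow> bool"  (infix \<open>=\<^sub>E\<close> 50) where
  eqE_ax: "(s, t) \<in> E \<Longrightarrow> \<forall>x. wf_trm ar (\<sigma> x) \<Longrightarrow> subst \<sigma> s =\<^sub>E subst \<sigma> t"
| eqE_refl: "wf_trm ar t \<Longrightarrow> t =\<^sub>E t"
| eqE_sym: "s =\<^sub>E t \<Longrightarrow> t =\<^sub>E s"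
| eqE_trans: "s =\<^sub>E t \<Longrightarrow> t =\<^sub>E u \<Longrightarrow> s =\<^sub>E u"
| eqE_app: "length ss = ar f \<Longrightarrow> list_all2 eqE ss ts \<Longrightarrow> App f ss =\<^sub>E App f ts"

definition valid :: "('f, 'n, 'x) trm \<Rightarrow> bool" where
  "valid u \<longleftrightarrow> ground ar u \<and> (\<forall>s \<in> subterms u. \<exists>m \<in> Msg. s =\<^sub>E m)"

definition static_equiv ::
  "('f, 'n, 'x, 'w) frame \<Rightarrow> ('f, 'n, 'x, 'w) frame \<Rightarrow> bool"  (infix \<open>\<sim>\<^sub>s\<close> 50) where
  "\<Phi> \<sim>\<^sub>s \<Psi> \<longleftrightarrow>
    dom \<Phi> = dom \<Psi> \<and>
    (\<forall>R \<in> recipes ar (dom \<Phi>). valid (app_frame \<Phi> R) \<longleftrightarrow> valid (app_frame \<Psi> R)) \<and>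
    (\<forall>R \<in> recipes ar (dom \<Phi>). \<forall>R' \<in> recipes ar (dom \<Phi>).
      valid (app_frame \<Phi> R) \<longrightarrow> valid (app_frame \<Phi> R') \<longrightarrow>
      (app_frame \<Phi> R =\<^sub>E app_frame \<Phi> R' \<longleftrightarrow> app_frame \<Psi> R =\<^sub>E app_frame \<Psi> R'))"

definition ext_simple ::
  "('f, 'n, 'x, 'c) proc multiset \<Rightarrow> ('f, 'n, 'x, 'w) frame \<Rightarrow> bool" where
  "ext_simple \<P> \<Phi> \<longleftrightarrow> simple_proc ar \<P> \<and> finite (dom \<Phi>) \<and> (\<forall>t \<in> ran \<Phi>. valid t)"


subsection \<open>Concrete semantics\<close>

inductive cstep ::
  "('f, 'n, 'x, 'c) proc \<Rightarrow> ('f, 'n, 'x, 'w) frame \<Rightarrow> ('c, ('f, 'n, 'w) trm, 'w) action \<Rightarrow>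
   ('f, 'n, 'x, 'c) proc \<Rightarrow> ('f, 'n, 'x, 'w) frame \<Rightarrow> bool" where
  c_in: "R \<in> recipes ar (dom \<Phi>) \<Longrightarrow> app_frame \<Phi> R =\<^sub>E u \<Longrightarrow> valid (app_frame \<Phi> R) \<Longrightarrow> valid u \<Longrightarrow>
    cstep (Inp c x Q) \<Phi> (AIn c R) (subst_proc x u Q) \<Phi>"
| c_out: "w \<notin> dom \<Phi> \<Longrightarrow> valid u \<Longrightarrow> cstep (Outp c u Q) \<Phi> (AOut c w) Q (\<Phi>(w \<mapsto> u))"
| c_then: "u =\<^sub>E v \<and> valid u \<and> valid v \<Longrightarrow> cstep (Cond u v P Q) \<Phi> ATau P \<Phi>"
| c_else: "\<not> (u =\<^sub>E v \<and> valid u \<and> valid v) \<Longrightarrow> cstep (Cond u v P Q) \<Phi> ATau Q \<Phi>"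

text \<open>The resulting process is \<open>None\<close> for \<open>\<bottom>\<close>.\<close>

inductive ccomp ::
  "level \<Rightarrow> ('f, 'n, 'x, 'c) proc \<Rightarrow> ('f, 'n, 'x, 'w) frame \<Rightarrow>
   ('c, ('f, 'n, 'w) trm, 'w) action list \<Rightarrow>
   ('f, 'n, 'x, 'c) proc option \<Rightarrow> ('f, 'n, 'x, 'w) frame \<Rightarrow> bool" where
  In: "cstep Q \<Phi> (AIn c R) Q' \<Phi>' \<Longrightarrow> ccomp IStar Q' \<Phi>' tr Q'' \<Phi>'' \<Longrightarrow> l \<in> {IStar, IPlus} \<Longrightarrow>
    ccomp l Q \<Phi> (AIn c R # tr) Q'' \<Phi>''"
| Out: "cstep Q \<Phi> (AOut c w) Q' \<Phi>' \<Longrightarrow> ccomp OStar Q' \<Phi>' tr Q'' \<Phi>'' \<Longrightarrow> l \<in> {IStar, OStar} \<Longrightarrow>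
    ccomp l Q \<Phi> (AOut c w # tr) Q'' \<Phi>''"
| Tau: "cstep Q \<Phi> ATau Q' \<Phi>' \<Longrightarrow> ccomp l Q' \<Phi>' tr Q'' \<Phi>'' \<Longrightarrow> ccomp l Q \<Phi> tr Q'' \<Phi>''"
| Proper_Null: "ccomp OStar Null \<Phi> [] (Some Null) \<Phi>"
| Proper_In: "ccomp OStar (Inp c x Q) \<Phi> [] (Some (Inp c x Q)) \<Phi>"
| Proper_Out: "\<not> valid u \<Longrightarrow> ccomp OStar (Outp c u Q) \<Phi> [] (Some (Outp c u Q)) \<Phi>"
| Improper_Null: "ccomp IStar Null \<Phi> [] None \<Phi>"
| Improper_Out: "\<not> valid u \<Longrightarrow> ccomp IStar (Outp c u Q) \<Phi> [] None \<Phi>"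

inductive ctrace ::
  "('f, 'n, 'x, 'c) proc multiset \<Rightarrow> ('f, 'n, 'x, 'w) frame \<Rightarrow>
   ('c, ('f, 'n, 'w) trm, 'w) action list \<Rightarrow>
   ('f, 'n, 'x, 'c) proc multiset \<Rightarrow> ('f, 'n, 'x, 'w) frame \<Rightarrow> bool" where
  Empty: "ctrace \<P> \<Phi> [] \<P> \<Phi>"
| Proper: "ccomp IPlus Q \<Phi> tr (Some Q') \<Phi>' \<Longrightarrow> ctrace (add_proc Q' \<P>) \<Phi>' tr' \<P>'' \<Phi>'' \<Longrightarrow>
    ctrace (add_mset Q \<P>) \<Phi> (tr @ tr') \<P>'' \<Phi>''"
| Improper: "ccomp IPlus Q \<Phi> tr None \<Phi>' \<Longrightarrow> ctrace {#} \<Phi>' tr' \<P>'' \<Phi>'' \<Longrightarrow>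
    ctrace (add_mset Q \<P>) \<Phi> (tr @ tr') \<P>'' \<Phi>''"

definition incl_c ::
  "('f, 'n, 'x, 'c) proc multiset \<times> ('f, 'n, 'x, 'w) frame \<Rightarrow>
   ('f, 'n, 'x, 'c) proc multiset \<times> ('f, 'n, 'x, 'w) frame \<Rightarrow> bool" where
  "incl_c A B \<longleftrightarrow>
    (\<forall>tr \<P>' \<Phi>'. ctrace (fst A) (snd A) tr \<P>' \<Phi>' \<longrightarrow>
      (\<exists>\<Q>' \<Psi>'. ctrace (fst B) (snd B) tr \<Q>' \<Psi>' \<and> \<Phi>' \<sim>\<^sub>s \<Psi>'))"


subsection \<open>Solutions of constraint systems\<close>

definition solves ::
  "('f, 'n, 'x, 'w) frame \<Rightarrow> ('f, 'n, 'x, 'w, 'y) constr set \<Rightarrow>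
   ('y \<Rightarrow> ('f, 'n, 'w) trm) \<Rightarrow> ('x \<Rightarrow> ('f, 'n, 'x) trm) \<Rightarrow> bool" where
  "solves \<Phi> S \<theta> \<rho> \<longleftrightarrow>
    (\<forall>x. ground ar (\<rho> x)) \<and>
    (\<forall>D X x. Deduce D X x \<in> S \<longrightarrow>
      app_frame (inst_frame \<rho> \<Phi>) (\<theta> X) =\<^sub>E \<rho> x \<and>
      valid (app_frame (inst_frame \<rho> \<Phi>) (\<theta> X)) \<and> valid (\<rho> x)) \<and>
    (\<forall>u v. Eq u v \<in> S \<longrightarrow>
      subst \<rho> u =\<^sub>E subst \<rho> v \<and> valid (subst \<rho> u) \<and> valid (subst \<rho> v)) \<and>
    (\<forall>u v. Neq u v \<in> S \<longrightarrow>
      \<not> subst \<rho> u =\<^sub>E subst \<rho> v \<or> \<not> valid (subst \<rho> u) \<or> \<not> valid (subst \<rho> v)) \<and>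
    (\<forall>t \<in> ran (inst_frame \<rho> \<Phi>). valid t)"

definition Sol ::
  "('f, 'n, 'x, 'w) frame \<Rightarrow> ('f, 'n, 'x, 'w, 'y) constr set \<Rightarrow> ('y \<Rightarrow> ('f, 'n, 'w) trm) set" where
  "Sol \<Phi> S = {\<theta>. (\<forall>D X x. Deduce D X x \<in> S \<longrightarrow> \<theta> X \<in> recipes ar D) \<and> (\<exists>\<rho>. solves \<Phi> S \<theta> \<rho>)}"

text \<open>The associated first-order substitution is unique only modulo the equational theory; an
  arbitrary representative is chosen.\<close>

definition assoc_subst ::
  "('f, 'n, 'x, 'w) frame \<Rightarrow> ('f, 'n, 'x, 'w, 'y) constr set \<Rightarrow>
   ('y \<Rightarrow> ('f, 'n, 'w) trm) \<Rightarrow> 'x \<Rightarrow> ('f, 'n, 'x) trm" where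
  "assoc_subst \<Phi> S \<theta> = (SOME \<rho>. solves \<Phi> S \<theta> \<rho>)"

definition sol_frame ::
  "('f, 'n, 'x, 'w) frame \<Rightarrow> ('f, 'n, 'x, 'w, 'y) constr set \<Rightarrow>
   ('y \<Rightarrow> ('f, 'n, 'w) trm) \<Rightarrow> ('f, 'n, 'x, 'w) frame" where
  "sol_frame \<Phi> S \<theta> = inst_frame (assoc_subst \<Phi> S \<theta>) \<Phi>"

definition sat_deps ::
  "('f, 'n, 'x, 'w) frame \<Rightarrow> ('f, 'n, 'x, 'w, 'y) constr set \<Rightarrow>
   ('y \<Rightarrow> ('f, 'n, 'w) trm) \<Rightarrow> ('y list \<times> 'w set) set \<Rightarrow> bool" where
  "sat_deps \<Phi> S \<theta> SD \<longleftrightarrow>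
    (\<forall>(Xs, W) \<in> SD. \<exists>X \<in> set Xs. \<forall>R \<in> recipes ar (ded_dom S X).
      app_frame (sol_frame \<Phi> S \<theta>) R =\<^sub>E app_frame (sol_frame \<Phi> S \<theta>) (\<theta> X) \<longrightarrow>
      valid (app_frame (sol_frame \<Phi> S \<theta>) R) \<longrightarrow>
      vars R \<inter> W \<noteq> {})"


subsection \<open>Symbolic semantics\<close>

text \<open>\<open>V\<close> is a set of first-order variables that are in use elsewhere, namely in the other basic
  processes running in parallel.\<close>

inductive sstep ::
  "'x set \<Rightarrow>
   ('f, 'n, 'x, 'c) proc \<Rightarrow> ('f, 'n, 'x, 'w) frame \<Rightarrow> ('f, 'n, 'x, 'w, 'y) constr set \<Rightarrow>
   ('c, 'y, 'w) action \<Rightarrow>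
   ('f, 'n, 'x, 'c) proc \<Rightarrow> ('f, 'n, 'x, 'w) frame \<Rightarrow> ('f, 'n, 'x, 'w, 'y) constr set \<Rightarrow> bool"
  for V where
  s_in: "x \<notin> V \<union> all_vars (Inp c y Q) \<union> \<Union> (vars ` ran \<Phi>) \<union> \<Union> (constr_vars ` S) \<Longrightarrow>
    \<forall>D z. Deduce D X z \<notin> S \<Longrightarrow>
    sstep V (Inp c y Q) \<Phi> S (AIn c X) (subst_proc y (Var x) Q) \<Phi> (insert (Deduce (dom \<Phi>) X x) S)"
| s_out: "w \<notin> dom \<Phi> \<Longrightarrow> sstep V (Outp c u Q) \<Phi> S (AOut c w) Q (\<Phi>(w \<mapsto> u)) S"
| s_then: "sstep V (Cond u v P Q) \<Phi> S ATau P \<Phi> (insert (Eq u v) S)"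
| s_else: "sstep V (Cond u v P Q) \<Phi> S ATau Q \<Phi> (insert (Neq u v) S)"

inductive scomp ::
  "'x set \<Rightarrow> level \<Rightarrow>
   ('f, 'n, 'x, 'c) proc \<Rightarrow> ('f, 'n, 'x, 'w) frame \<Rightarrow> ('f, 'n, 'x, 'w, 'y) constr set \<Rightarrow>
   ('c, 'y, 'w) action list \<Rightarrow>
   ('f, 'n, 'x, 'c) proc option \<Rightarrow> ('f, 'n, 'x, 'w) frame \<Rightarrow>
   ('f, 'n, 'x, 'w, 'y) constr set \<Rightarrow> bool"
  for V where
  In: "sstep V Q \<Phi> S (AIn c X) Q' \<Phi>' S' \<Longrightarrow> scomp V IStar Q' \<Phi>' S' tr Q'' \<Phi>'' S'' \<Longrightarrow>
    l \<in> {IStar, IPlus} \<Longrightarrow> scomp V l Q \<Phi> S (AIn c X # tr) Q'' \<Phi>'' S''"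
| Out: "sstep V Q \<Phi> S (AOut c w) Q' \<Phi>' S' \<Longrightarrow> scomp V OStar Q' \<Phi>' S' tr Q'' \<Phi>'' S'' \<Longrightarrow>
    l \<in> {IStar, OStar} \<Longrightarrow> scomp V l Q \<Phi> S (AOut c w # tr) Q'' \<Phi>'' S''"
| Tau: "sstep V Q \<Phi> S ATau Q' \<Phi>' S' \<Longrightarrow> scomp V l Q' \<Phi>' S' tr Q'' \<Phi>'' S'' \<Longrightarrow>
    scomp V l Q \<Phi> S tr Q'' \<Phi>'' S''"
| Proper_Null: "scomp V OStar Null \<Phi> S [] (Some Null) \<Phi> S"
| Proper_In: "scomp V OStar (Inp c x Q) \<Phi> S [] (Some (Inp c x Q)) \<Phi> S"
| Proper_Out: "scomp V OStar (Outp c u Q) \<Phi> S [] (Some (Outp c u Q)) \<Phi> (insert (Neq u u) S)"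
| Improper_Null: "scomp V IStar Null \<Phi> S [] None \<Phi> S"
| Improper_Out: "scomp V IStar (Outp c u Q) \<Phi> S [] None \<Phi> (insert (Neq u u) S)"

inductive strace ::
  "('f, 'n, 'x, 'c) proc multiset \<Rightarrow> ('f, 'n, 'x, 'w) frame \<Rightarrow>
   ('f, 'n, 'x, 'w, 'y) constr set \<Rightarrow> ('c, 'y, 'w) block list \<Rightarrow>
   ('f, 'n, 'x, 'c) proc multiset \<Rightarrow> ('f, 'n, 'x, 'w) frame \<Rightarrow>
   ('f, 'n, 'x, 'w, 'y) constr set \<Rightarrow> bool" where
  Empty: "strace \<P> \<Phi> S [] \<P> \<Phi> S"
| Proper: "scomp (\<Union> (all_vars ` set_mset \<P>)) IPlus Q \<Phi> S (io c Xs ws) (Some Q') \<Phi>' S' \<Longrightarrow>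
    strace (add_proc Q' \<P>) \<Phi>' S' bs \<P>'' \<Phi>'' S'' \<Longrightarrow>
    strace (add_mset Q \<P>) \<Phi> S ((c, Xs, ws) # bs) \<P>'' \<Phi>'' S''"
| Improper: "scomp (\<Union> (all_vars ` set_mset \<P>)) IPlus Q \<Phi> S (io c Xs ws) None \<Phi>' S' \<Longrightarrow>
    strace {#} \<Phi>' S' bs \<P>'' \<Phi>'' S'' \<Longrightarrow>
    strace (add_mset Q \<P>) \<Phi> S ((c, Xs, ws) # bs) \<P>'' \<Phi>'' S''"

text \<open>The type argument \<open>'y\<close> is the type of second-order variables.\<close>

definition incl_rs ::
  "'y itself \<Rightarrow>
   ('f, 'n, 'x, 'c::linorder) proc multiset \<times> ('f, 'n, 'x, 'w) frame \<Rightarrow>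
   ('f, 'n, 'x, 'c) proc multiset \<times> ('f, 'n, 'x, 'w) frame \<Rightarrow> bool" where
  "incl_rs _ A B \<longleftrightarrow>
    (\<forall>(tr :: ('c, 'y, 'w) block list) \<P>' \<Phi>' SA \<theta>.
      strace (fst A) (snd A) {} tr \<P>' \<Phi>' SA \<longrightarrow>
      \<theta> \<in> Sol \<Phi>' SA \<longrightarrow> sat_deps \<Phi>' SA \<theta> (AllDep tr) \<longrightarrow>
      (\<exists>\<Q>' \<Psi>' SB.
        strace (fst B) (snd B) {} tr \<Q>' \<Psi>' SB \<and>
        \<theta> \<in> Sol \<Psi>' SB \<and> sat_deps \<Psi>' SB \<theta> (AllDep tr) \<and>
        sol_frame \<Phi>' SA \<theta> \<sim>\<^sub>s sol_frame \<Psi>' SB \<theta>))"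

end

end

theory Submission
  imports Defs
begin

text \<open>
  Symbolic traces with solutions correspond to concrete compressed traces, so the point is that
  inclusion only has to be checked for traces in which every block satisfies its dependency
  constraint. If a block on channel \<open>c\<close> violates its constraint, its recipes can be replaced by
  equal ones that do not use the outputs of the blocks since the last one on a channel above \<open>c\<close>.
  The block is then independent of these blocks and can be moved before them, which decreases the
  sequence of channels lexicographically. By induction the new trace is matched by \<open>B\<close>; there the
  move is undone by independence and the replacement of recipes by static equivalence. Blocks
  without output kill the other processes and cannot be moved; for them one uses that the execution
  of a simple process along a given trace is deterministic modulo the equational theory.
\<close>

section \<open>Instantiation of terms, frames and processes\<close>

text \<open>The violating block is rewritten and moved in a run of \<open>A\<close>, but
  \<open>B\<close> has to follow the original trace. The change is undone in \<open>B\<close> in the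
  opposite order: the block goes back first, which is possible because the blocks in between were
  performed in \<open>A\<close> before its outputs existed; then the old recipes return, because old
  and new ones are valid and equal in the final frame of \<open>A\<close> and static equivalence
  carries this over to \<open>B\<close>. For a block without output, two shorter traces are matched,
  one without the block and one that ends with it at its early place: the first supplies the frame,
  the second the ability of \<open>B\<close> to perform the block.

  Two features of the semantics shape the rest. An input may receive any valid term equal to the
  value of its recipe, and the substitution of a solution is an arbitrary representative, so runs
  are comparable only up to replacing valid subterms by equal valid ones. And the domain of a
  second-order variable can be read off from the trace, so the dependency constraints mean the same
  for \<open>A\<close> and \<open>B\<close> once the final frames are statically equivalent.\<close>

lemma finite_vars: "finite (vars (t :: ('f, 'n, 'v) trm))"
  by (induction t) auto

lemma finite_all_vars: "finite (all_vars P)"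
  by (induction P) (auto simp: finite_vars)

lemma free_vars_subset_all_vars: "free_vars P \<subseteq> all_vars P"
  by (induction P) auto

lemma subst_cong_vars: "(\<And>x. x \<in> vars t \<Longrightarrow> \<sigma> x = \<tau> x) \<Longrightarrow> subst \<sigma> t = subst \<tau> t"
  by (induction t) auto

lemma subst_Var: "subst Var t = t"
  by (induction t) (auto simp: map_idI)

lemma subst_no_vars: "vars t = {} \<Longrightarrow> subst \<sigma> t = t"
  using subst_cong_vars[of t \<sigma> Var] by (simp add: subst_Var)

lemma subst_subst: "subst \<tau> (subst \<sigma> t) = subst (\<lambda>x. subst \<tau> (\<sigma> x)) t"
  by (induction t) auto

lemma app_frame_cong: "(\<And>w. w \<in> vars R \<Longrightarrow> \<Phi> w = \<Psi> w) \<Longrightarrow> app_frame \<Phi> R = app_frame \<Psi> R"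
  unfolding app_frame_def by (rule subst_cong_vars) simp

lemma recipes_mono: "R \<in> recipes ar D \<Longrightarrow> D \<subseteq> D' \<Longrightarrow> R \<in> recipes ar D'"
  by (auto simp: recipes_def)

lemma app_frame_upd: "R \<in> recipes ar (dom \<Phi>) \<Longrightarrow> w \<notin> dom \<Phi> \<Longrightarrow> app_frame (\<Phi>(w \<mapsto> u)) R = app_frame \<Phi> R"
  by (rule app_frame_cong) (auto simp: recipes_def)

lemma app_frame_map_le:
  assumes "R \<in> recipes ar (dom \<Phi>)" "\<Phi> \<subseteq>\<^sub>m \<Psi>"
  shows "app_frame \<Psi> R = app_frame \<Phi> R"
proof (rule app_frame_cong)
  fix w assume "w \<in> vars R"
  with assms(1) have "w \<in> dom \<Phi>" by (auto simp: recipes_def)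
  with assms(2) show "\<Psi> w = \<Phi> w" by (simp add: map_le_def)
qed

lemma dom_inst_frame [simp]: "dom (inst_frame \<rho> \<Phi>) = dom \<Phi>"
  by (auto simp: inst_frame_def dom_def)

lemma inst_frame_upd: "inst_frame \<rho> (\<Phi>(w \<mapsto> u)) = (inst_frame \<rho> \<Phi>)(w \<mapsto> subst \<rho> u)"
  by (auto simp: inst_frame_def)

lemma inst_frame_mono: "\<Phi> \<subseteq>\<^sub>m \<Psi> \<Longrightarrow> inst_frame \<rho> \<Phi> \<subseteq>\<^sub>m inst_frame \<rho> \<Psi>"
  by (auto simp: inst_frame_def map_le_def dom_def)

lemma inst_frame_cong:
  "(\<And>x. x \<in> \<Union> (vars ` ran \<Phi>) \<Longrightarrow> \<rho> x = \<rho>' x) \<Longrightarrow> inst_frame \<rho> \<Phi> = inst_frame \<rho>' \<Phi>"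
  unfolding inst_frame_def
  by (rule ext) (auto simp: ran_def intro!: option.map_cong subst_cong_vars)

lemma inst_frame_ground: "inst_frame \<rho> \<Phi> = \<Phi>" if "\<And>t. t \<in> ran \<Phi> \<Longrightarrow> vars t = {}"
  unfolding inst_frame_def
proof
  fix w
  show "map_option (subst \<rho>) (\<Phi> w) = \<Phi> w"
    using that by (cases "\<Phi> w") (auto simp: subst_no_vars ranI)
qed

text \<open>Simultaneous instantiation by the first-order part of a solution. The bound variable is
  reset at each input, so only free occurrences are replaced; the substitutions in use map a
  variable to itself or to a ground term, so nothing is captured.\<close>

primrec inst_proc ::
  "('x \<Rightarrow> ('f, 'n, 'x) trm) \<Rightarrow> ('f, 'n, 'x, 'c) proc \<Rightarrow> ('f, 'n, 'x, 'c) proc" where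
  "inst_proc \<rho> Null = Null"
| "inst_proc \<rho> (Cond u v P Q) = Cond (subst \<rho> u) (subst \<rho> v) (inst_proc \<rho> P) (inst_proc \<rho> Q)"
| "inst_proc \<rho> (Inp c y P) = Inp c y (inst_proc (\<rho>(y := Var y)) P)"
| "inst_proc \<rho> (Outp c u P) = Outp c (subst \<rho> u) (inst_proc \<rho> P)"

lemma inst_proc_cong:
  "(\<And>x. x \<in> free_vars P \<Longrightarrow> \<rho> x = \<rho>' x) \<Longrightarrow> inst_proc \<rho> P = inst_proc \<rho>' P"
proof (induction P arbitrary: \<rho> \<rho>')
  case (Cond u v P Q)
  have "inst_proc \<rho> P = inst_proc \<rho>' P" "inst_proc \<rho> Q = inst_proc \<rho>' Q"
    by (rule Cond.IH; use Cond.prems in simp)+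
  moreover have "subst \<rho> u = subst \<rho>' u" "subst \<rho> v = subst \<rho>' v"
    by (rule subst_cong_vars; use Cond.prems in simp)+
  ultimately show ?case by simp
next
  case (Inp c y P)
  have "inst_proc (\<rho>(y := Var y)) P = inst_proc (\<rho>'(y := Var y)) P"
    by (rule Inp.IH) (use Inp.prems in auto)
  then show ?case by simp
next
  case (Outp c u P)
  have "inst_proc \<rho> P = inst_proc \<rho>' P"
    by (rule Outp.IH) (use Outp.prems in simp)
  moreover have "subst \<rho> u = subst \<rho>' u"
    by (rule subst_cong_vars) (use Outp.prems in simp)
  ultimately show ?case by simp
qed simp

lemma inst_proc_Var: "inst_proc Var P = P"
  by (induction P) (auto simp: subst_Var)

lemma inst_proc_closed: "free_vars P = {} \<Longrightarrow> inst_proc \<rho> P = P"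
  using inst_proc_cong[of P \<rho> Var] by (simp add: inst_proc_Var)

lemma inst_proc_eq_Null [simp]: "inst_proc \<rho> P = Null \<longleftrightarrow> P = Null"
  by (cases P) auto

lemma on_channel_inst_proc [simp]: "on_channel c (inst_proc \<rho> P) = on_channel c P"
  by (induction P arbitrary: \<rho>) auto

lemma on_channel_subst_proc [simp]: "on_channel c (subst_proc x t P) = on_channel c P"
  by (induction P) auto

lemma subst_fresh_var:
  assumes "\<And>z. \<rho> z = Var z \<or> vars (\<rho> z) = {}"
  shows "subst \<rho> (subst (Var(y := Var x)) u) = subst (Var(y := \<rho> x)) (subst (\<rho>(y := Var y)) u)"
  unfolding subst_subst
proof (rule subst_cong_vars)
  fix z
  show "subst \<rho> ((Var(y := Var x)) z) = subst (Var(y := \<rho> x)) ((\<rho>(y := Var y)) z)"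
    using assms[of z] by (auto simp: subst_no_vars)
qed

text \<open>Relates the two input rules: a symbolic input renames \<open>y\<close> to a fresh
  \<open>x\<close> that the solution instantiates later, while a concrete input replaces
  \<open>y\<close> by the value at once. Each \<open>\<rho> z\<close> is assumed to be ground or
  \<open>Var z\<close>, because passing an input inside \<open>Q\<close> resets
  \<open>\<rho>\<close> to the identity there.\<close>

lemma inst_proc_subst_proc:
  assumes "x \<notin> all_vars Q" "x \<noteq> y" "vars (\<rho> x) = {}" "\<And>z. \<rho> z = Var z \<or> vars (\<rho> z) = {}"
  shows "inst_proc \<rho> (subst_proc y (Var x) Q) = subst_proc y (\<rho> x) (inst_proc (\<rho>(y := Var y)) Q)"
  using assms
proof (induction Q arbitrary: \<rho>)
  case (Inp c z Q)
  show ?case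
  proof (cases "z = y")
    case True
    then show ?thesis by (simp only: inst_proc.simps subst_proc.simps if_True simp_thms fun_upd_upd)
  next
    case False
    have "inst_proc (\<rho>(z := Var z)) (subst_proc y (Var x) Q)
      = subst_proc y ((\<rho>(z := Var z)) x) (inst_proc ((\<rho>(z := Var z))(y := Var y)) Q)"
      by (rule Inp.IH) (use Inp.prems in auto)
    moreover have "(\<rho>(z := Var z)) x = \<rho> x"
      using Inp.prems(1) by simp
    ultimately show ?thesis
      using False by (simp only: inst_proc.simps subst_proc.simps if_False fun_upd_twist[OF False])
  qed
qed (simp_all add: subst_fresh_var)

section \<open>Valid terms modulo the equational theory\<close>

lemma wf_trm_subst: "wf_trm ar t \<Longrightarrow> (\<And>x. x \<in> vars t \<Longrightarrow> wf_trm ar (\<sigma> x)) \<Longrightarrow> wf_trm ar (subst \<sigma> t)"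
  by (induction t) (auto simp: list_all_iff)

lemma self_in_subterms: "t \<in> subterms t"
  by (cases t) auto

context term_model
begin

lemma eqE_wf: "s =\<^sub>E t \<Longrightarrow> wf_trm ar s \<and> wf_trm ar t"
proof (induction rule: eqE.induct)
  case (eqE_ax s t \<sigma>)
  then show ?case using E_wf[of s t] by (auto intro: wf_trm_subst)
next
  case (eqE_app ss f ts)
  then show ?case
    by (auto simp: list_all_length list_all2_conv_all_nth)
qed auto

lemma valid_ground: "valid t \<Longrightarrow> ground ar t"
  by (simp add: valid_def)

lemma valid_no_vars: "valid t \<Longrightarrow> vars t = {}"
  by (simp add: valid_def ground_def)

lemma valid_wf: "valid t \<Longrightarrow> wf_trm ar t"
  by (simp add: valid_def ground_def)

lemma valid_AppD: "valid (App f ts) \<Longrightarrow> t \<in> set ts \<Longrightarrow> valid t"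
  unfolding valid_def ground_def by (auto simp: list_all_iff)

lemma valid_AppI:
  assumes "length ts = ar f" "\<And>t. t \<in> set ts \<Longrightarrow> valid t" "App f ts =\<^sub>E m" "m \<in> Msg"
  shows "valid (App f ts)"
  using assms unfolding valid_def ground_def by (auto simp: list_all_iff)

lemma valid_eq_Msg: "valid t \<Longrightarrow> \<exists>m \<in> Msg. t =\<^sub>E m"
  using self_in_subterms by (auto simp: valid_def)

text \<open>Validity is not closed under \<open>=\<^sub>E\<close>: an invalid term may equal a valid one. It is closed under
  the relation below, which replaces valid subterms by equal valid terms.\<close>

inductive veq :: "('f, 'n, 'x) trm \<Rightarrow> ('f, 'n, 'x) trm \<Rightarrow> bool" where
  veq_Name: "veq (Name a) (Name a)"
| veq_Var: "veq (Var x) (Var x)"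
| veq_App: "list_all2 veq ss ts \<Longrightarrow> veq (App f ss) (App f ts)"
| veq_valid: "valid s \<Longrightarrow> valid t \<Longrightarrow> s =\<^sub>E t \<Longrightarrow> veq s t"

lemma veq_refl: "veq t t"
  by (induction t) (auto intro!: veq.intros(1-3) simp: list_all2_same)

lemma veq_sym: "veq s t \<Longrightarrow> veq t s"
proof (induction rule: veq.induct)
  case (veq_App ss ts f)
  then have "list_all2 veq ts ss"
    by (auto simp: list_all2_conv_all_nth)
  then show ?case by (rule veq.veq_App)
next
  case (veq_valid s t)
  then show ?case by (simp add: veq.veq_valid eqE_sym)
qed (simp_all add: veq_Name veq_Var)

lemma veq_eqE: "veq s t \<Longrightarrow> wf_trm ar s \<Longrightarrow> s =\<^sub>E t"
proof (induction rule: veq.induct)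
  case (veq_App ss ts f)
  then have "list_all2 eqE ss ts"
    by (auto simp: list_all2_conv_all_nth list_all_length)
  with veq_App.prems show ?case by (simp add: eqE_app)
qed (simp_all add: eqE_refl)

text \<open>Since \<open>veq\<close> implies \<open>=\<^sub>E\<close> on well-formed terms, the
  message witnessing validity of the whole term also serves its counterpart. The arguments are valid
  by induction, and a replaced subterm is valid by the rule that replaced it.\<close>

lemma veq_imp_valid: "veq s t \<Longrightarrow> valid s \<Longrightarrow> valid t"
proof (induction rule: veq.induct)
  case (veq_App ss ts f)
  have eq: "App f ss =\<^sub>E App f ts"
    using veq_App by (intro veq_eqE veq.veq_App list_all2_mono[OF veq_App.IH] valid_wf) auto
  obtain m where "m \<in> Msg" "App f ss =\<^sub>E m"
    using veq_App.prems valid_eq_Msg by blast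
  with eq have "m \<in> Msg" "App f ts =\<^sub>E m"
    using eqE_sym eqE_trans by blast+
  moreover have "valid t" if "t \<in> set ts" for t
  proof -
    from that obtain i where i: "i < length ts" "t = ts ! i" by (auto simp: in_set_conv_nth)
    with veq_App.IH have "i < length ss" "valid (ss ! i) \<longrightarrow> valid t"
      by (auto simp: list_all2_conv_all_nth)
    with valid_AppD[OF veq_App.prems] show ?thesis by simp
  qed
  moreover have "length ts = ar f"
    using eqE_wf[OF eq] by simp
  ultimately show ?case
    by (intro valid_AppI)
qed auto

lemma veq_valid_iff: "veq s t \<Longrightarrow> valid s \<longleftrightarrow> valid t"
  using veq_imp_valid veq_sym by blast

lemma veq_eqE_iff:
  assumes "veq s s'" "veq t t'" "wf_trm ar s" "wf_trm ar t"
  shows "s =\<^sub>E t \<longleftrightarrow> s' =\<^sub>E t'"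
  using veq_eqE[OF assms(1,3)] veq_eqE[OF assms(2,4)] 
    eqE_sym eqE_trans by blast

text \<open>This is exactly the test of a conditional: processes that differ by \<open>veq\<close>
  take the same branches.\<close>

lemma veq_cond_iff:
  assumes "veq s s'" "veq t t'"
  shows "s =\<^sub>E t \<and> valid s \<and> valid t \<longleftrightarrow> s' =\<^sub>E t' \<and> valid s' \<and> valid t'"
  using veq_eqE_iff[OF assms] veq_valid_iff[OF assms(1)] veq_valid_iff[OF assms(2)] valid_wf by blast

text \<open>A pair related by \<open>veq_valid\<close> consists of ground terms, so both
  substitutions leave it unchanged.\<close>

lemma veq_subst: "veq s t \<Longrightarrow> (\<And>x. veq (\<sigma> x) (\<tau> x)) \<Longrightarrow> veq (subst \<sigma> s) (subst \<tau> t)"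
proof (induction rule: veq.induct)
  case (veq_App ss ts f)
  then have "list_all2 veq (map (subst \<sigma>) ss) (map (subst \<tau>) ts)"
    by (auto simp: list_all2_conv_all_nth)
  then show ?case by (simp add: veq.veq_App)
next
  case (veq_valid s t)
  then show ?case by (simp add: veq.veq_valid valid_no_vars subst_no_vars)
qed (simp_all add: veq_Name)

text \<open>The relation between frames that arise from one trace when inputs or solutions pick
  different representatives. Both entries have to be valid so that every recipe yields terms related
  by \<open>veq\<close>, which is more than \<open>=\<^sub>E\<close>.\<close>

definition feq :: "('f, 'n, 'x, 'w) frame \<Rightarrow> ('f, 'n, 'x, 'w) frame \<Rightarrow> bool" where
  "feq \<Phi> \<Psi> \<longleftrightarrow> (\<forall>w. rel_option (\<lambda>u v. u =\<^sub>E v \<and> valid u \<and> valid v) (\<Phi> w) (\<Psi> w))"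

lemma feq_dom: "feq \<Phi> \<Psi> \<Longrightarrow> dom \<Phi> = dom \<Psi>"
  unfolding feq_def option.rel_sel dom_def by simp

lemma feq_refl: "\<forall>t \<in> ran \<Phi>. valid t \<Longrightarrow> feq \<Phi> \<Phi>"
  unfolding feq_def by (simp add: option.rel_sel ranI eqE_refl valid_wf)

lemma feq_upd: "feq \<Phi> \<Psi> \<Longrightarrow> valid u \<Longrightarrow> valid v \<Longrightarrow> u =\<^sub>E v \<Longrightarrow> feq (\<Phi>(w \<mapsto> u)) (\<Psi>(w \<mapsto> v))"
  by (auto simp: feq_def)

lemma feq_app_frame:
  fixes \<Phi> \<Psi> :: "('f, 'n, 'x, 'b) frame"
  assumes "feq \<Phi> \<Psi>" "R \<in> recipes ar (dom \<Phi>)"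
  shows "veq (app_frame \<Phi> R) (app_frame \<Psi> R)" "wf_trm ar (app_frame \<Phi> R)"
proof -
  have *: "veq (the (\<Phi> w)) (the (\<Psi> w)) \<and> wf_trm ar (the (\<Phi> w))" if "w \<in> vars R" for w
  proof -
    have "w \<in> dom \<Phi>" using that assms(2) by (auto simp: recipes_def)
    with assms(1) obtain u v where "\<Phi> w = Some u" "\<Psi> w = Some v" "u =\<^sub>E v" "valid u" "valid v"
      unfolding feq_def by (auto simp: option_rel_Some1 dest!: spec[of _ w])
    then show ?thesis by (simp add: veq_valid valid_wf)
  qed
  from * show "wf_trm ar (app_frame \<Phi> R)"
    using assms(2) unfolding app_frame_def recipes_def by (auto intro: wf_trm_subst)
  have "veq (app_frame \<Phi> R) (app_frame \<Psi> R)"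
    if "\<And>w. w \<in> vars R \<Longrightarrow> veq (the (\<Phi> w)) (the (\<Psi> w))" for R :: "('f, 'n, 'b) trm"
    using that unfolding app_frame_def
  proof (induction R)
    case (App f Rs)
    have "veq (subst (\<lambda>w. the (\<Phi> w)) R) (subst (\<lambda>w. the (\<Psi> w)) R)" if "R \<in> set Rs" for R
      by (rule App.IH[OF that]) (use that App.prems in auto)
    then show ?case by (simp add: veq_App list_all2_map1 list_all2_map2 list_all2_same)
  qed (simp_all add: veq_Name)
  with * show "veq (app_frame \<Phi> R) (app_frame \<Psi> R)" by blast
qed

lemma feq_static_equiv:
  fixes \<Phi> \<Psi> :: "('f, 'n, 'x, 'b) frame"
  assumes "feq \<Phi> \<Psi>"
  shows "\<Phi> \<sim>\<^sub>s \<Psi>"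
  unfolding static_equiv_def
proof (intro conjI ballI impI)
  show "dom \<Phi> = dom \<Psi>" using assms by (rule feq_dom)
next
  fix R :: "('f, 'n, 'b) trm" assume "R \<in> recipes ar (dom \<Phi>)"
  from veq_valid_iff[OF feq_app_frame(1)[OF assms this]]
  show "valid (app_frame \<Phi> R) \<longleftrightarrow> valid (app_frame \<Psi> R)" .
next
  fix R R' :: "('f, 'n, 'b) trm" assume "R \<in> recipes ar (dom \<Phi>)" "R' \<in> recipes ar (dom \<Phi>)"
  note * = feq_app_frame[OF assms this(1)] feq_app_frame[OF assms this(2)]
  from veq_eqE_iff[OF *(1,3,2,4)]
  show "app_frame \<Phi> R =\<^sub>E app_frame \<Phi> R' \<longleftrightarrow> app_frame \<Psi> R =\<^sub>E app_frame \<Psi> R'" .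
qed

lemma static_equiv_dom: "\<Phi> \<sim>\<^sub>s \<Psi> \<Longrightarrow> dom \<Phi> = dom \<Psi>"
  by (simp add: static_equiv_def)

lemma static_equiv_sym: "\<Phi> \<sim>\<^sub>s \<Psi> \<Longrightarrow> \<Psi> \<sim>\<^sub>s \<Phi>"
  by (auto simp: static_equiv_def)

lemma static_equiv_trans: "\<Phi> \<sim>\<^sub>s \<Psi> \<Longrightarrow> \<Psi> \<sim>\<^sub>s \<Theta> \<Longrightarrow> \<Phi> \<sim>\<^sub>s \<Theta>"
  unfolding static_equiv_def by simp

lemma static_equiv_eqD:
  assumes "\<Phi> \<sim>\<^sub>s \<Psi>" "R \<in> recipes ar (dom \<Phi>)" "R' \<in> recipes ar (dom \<Phi>)"
    "valid (app_frame \<Phi> R)" "valid (app_frame \<Phi> R')" "app_frame \<Phi> R =\<^sub>E app_frame \<Phi> R'"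
  shows "valid (app_frame \<Psi> R)" "valid (app_frame \<Psi> R')" "app_frame \<Psi> R =\<^sub>E app_frame \<Psi> R'"
  using assms unfolding static_equiv_def by blast+

text \<open>The input rule admits every valid term equal to the value of the recipe, so one process
  has several successors for the same label. They are all related by \<open>peq\<close>.\<close>

inductive peq :: "('f, 'n, 'x, 'c) proc \<Rightarrow> ('f, 'n, 'x, 'c) proc \<Rightarrow> bool" where
  peq_Null: "peq Null Null"
| peq_Cond: "veq u u' \<Longrightarrow> veq v v' \<Longrightarrow> peq P P' \<Longrightarrow> peq Q Q' \<Longrightarrow> peq (Cond u v P Q) (Cond u' v' P' Q')"
| peq_Inp: "peq P P' \<Longrightarrow> peq (Inp c x P) (Inp c x P')"
| peq_Outp: "veq u u' \<Longrightarrow> peq P P' \<Longrightarrow> peq (Outp c u P) (Outp c u' P')"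

lemma peq_refl: "peq P P"
  by (induction P) (auto intro: peq.intros veq_refl)

lemma peq_subst_proc: "peq P P' \<Longrightarrow> veq u v \<Longrightarrow> peq (subst_proc x u P) (subst_proc x v P')"
  by (induction rule: peq.induct) (auto intro!: peq.intros veq_subst veq_refl)

end

section \<open>Concrete compressed steps\<close>

primrec pdepth :: "('f, 'n, 'x, 'c) proc \<Rightarrow> nat" where
  "pdepth Null = 0"
| "pdepth (Cond u v P Q) = Suc (pdepth P + pdepth Q)"
| "pdepth (Inp c x P) = Suc (pdepth P)"
| "pdepth (Outp c u P) = Suc (pdepth P)"

lemma pdepth_subst_proc [simp]: "pdepth (subst_proc x u P) = pdepth P"
  by (induction P) auto

text \<open>An input continues with an instance of its body, which is no structural subterm. As
  \<open>pdepth\<close> is invariant under substitution, the hypothesis is available for all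
  instances.\<close>

lemma proc_subst_induct [case_names Null Cond Inp Outp]:
  assumes "P Null"
    and "\<And>u v Q1 Q2. P Q1 \<Longrightarrow> P Q2 \<Longrightarrow> P (Cond u v Q1 Q2)"
    and "\<And>c x Q. (\<And>u. P (subst_proc x u Q)) \<Longrightarrow> P (Inp c x Q)"
    and "\<And>c u Q. P Q \<Longrightarrow> P (Outp c u Q)"
  shows "P Q"
proof (induction "pdepth Q" arbitrary: Q rule: less_induct)
  case less
  show ?case
    by (cases Q) (use assms less in auto)
qed

definition ins :: "('c, 'r, 'w) action list \<Rightarrow> 'r set" where
  "ins tr = {R. \<exists>c. AIn c R \<in> set tr}"

definition outs :: "('c, 'r, 'w) action list \<Rightarrow> 'w set" where
  "outs tr = {w. \<exists>c. AOut c w \<in> set tr}"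

lemma ins_simps [simp]:
  "ins [] = {}" "ins (AIn c R # tr) = insert R (ins tr)" "ins (AOut c w # tr) = ins tr"
  by (auto simp: ins_def)

lemma outs_simps [simp]:
  "outs [] = {}" "outs (AIn c R # tr) = outs tr" "outs (AOut c w # tr) = insert w (outs tr)"
  by (auto simp: outs_def)

lemma ins_io [simp]: "ins (io c Rs ws) = set Rs"
  by (auto simp: ins_def io_def)

lemma outs_io [simp]: "outs (io c Rs ws) = set ws"
  by (auto simp: outs_def io_def)

context term_model
begin

section \<open>Compressed steps by the shape of the process\<close>

lemma ccomp_Null:
  "ccomp l Null \<Phi> tr r \<Phi>' \<longleftrightarrow>
    tr = [] \<and> \<Phi>' = \<Phi> \<and> (l = OStar \<and> r = Some Null \<or> l = IStar \<and> r = None)"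
  by (subst ccomp.simps) (auto elim: cstep.cases)

lemma ccomp_Cond:
  "ccomp l (Cond u v P Q) \<Phi> tr r \<Phi>' \<longleftrightarrow>
    (u =\<^sub>E v \<and> valid u \<and> valid v) \<and> ccomp l P \<Phi> tr r \<Phi>' \<or>
    \<not> (u =\<^sub>E v \<and> valid u \<and> valid v) \<and> ccomp l Q \<Phi> tr r \<Phi>'"
  by (subst ccomp.simps) (auto simp: cstep.simps)

lemma ccomp_Inp:
  "ccomp l (Inp c x Q) \<Phi> tr r \<Phi>' \<longleftrightarrow>
    l = OStar \<and> tr = [] \<and> r = Some (Inp c x Q) \<and> \<Phi>' = \<Phi> \<or>
    l \<noteq> OStar \<and> (\<exists>R u tr'. tr = AIn c R # tr' \<and> R \<in> recipes ar (dom \<Phi>) \<and> app_frame \<Phi> R =\<^sub>E u \<and>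
      valid (app_frame \<Phi> R) \<and> valid u \<and> ccomp IStar (subst_proc x u Q) \<Phi> tr' r \<Phi>')"
  by (subst ccomp.simps, cases l) (simp_all add: cstep.simps, blast+)

lemma ccomp_Outp:
  "ccomp l (Outp c u Q) \<Phi> tr r \<Phi>' \<longleftrightarrow> l \<noteq> IPlus \<and>
    (if valid u then \<exists>w tr'. tr = AOut c w # tr' \<and> w \<notin> dom \<Phi> \<and> ccomp OStar Q (\<Phi>(w \<mapsto> u)) tr' r \<Phi>'
     else tr = [] \<and> \<Phi>' = \<Phi> \<and> (l = OStar \<and> r = Some (Outp c u Q) \<or> l = IStar \<and> r = None))"
  by (subst ccomp.simps, cases l) (auto simp: cstep.simps)

lemma ccomp_CondE:
  assumes "ccomp l (Cond u v P Q) \<Phi> tr r \<Phi>'"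
  obtains "u =\<^sub>E v \<and> valid u \<and> valid v" "ccomp l P \<Phi> tr r \<Phi>'"
  | "\<not> (u =\<^sub>E v \<and> valid u \<and> valid v)" "ccomp l Q \<Phi> tr r \<Phi>'"
  using assms unfolding ccomp_Cond by blast

lemma ccomp_frame:
  "ccomp l P \<Phi> tr r \<Phi>' \<Longrightarrow>
    \<Phi> \<subseteq>\<^sub>m \<Phi>' \<and> dom \<Phi>' = dom \<Phi> \<union> outs tr \<and> dom \<Phi> \<inter> outs tr = {}"
proof (induction P arbitrary: l \<Phi> tr r \<Phi>' rule: proc_subst_induct)
  case (Outp c u P)
  show ?case
  proof (cases "valid u")
    case True
    with Outp.prems obtain w tr' where tr: "tr = AOut c w # tr'" "w \<notin> dom \<Phi>"
      "ccomp OStar P (\<Phi>(w \<mapsto> u)) tr' r \<Phi>'" by (auto simp: ccomp_Outp)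
    have IH: "\<Phi>(w \<mapsto> u) \<subseteq>\<^sub>m \<Phi>' \<and> dom \<Phi>' = dom (\<Phi>(w \<mapsto> u)) \<union> outs tr' \<and> dom (\<Phi>(w \<mapsto> u)) \<inter> outs tr' = {}"
      by (rule Outp.IH[OF tr(3)])
    moreover from tr(2) have "\<Phi> \<subseteq>\<^sub>m \<Phi>(w \<mapsto> u)" by (auto simp: map_le_def)
    with IH have "\<Phi> \<subseteq>\<^sub>m \<Phi>'" by (blast intro: map_le_trans)
    ultimately show ?thesis using tr(1,2) by auto
  next
    case False
    with Outp.prems show ?thesis by (simp add: ccomp_Outp)
  qed
next
  case (Cond u v P Q)
  show ?case by (cases rule: ccomp_CondE[OF Cond.prems]) (rule Cond.IH, assumption)+
next
  case (Inp c x P)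
  show ?case
  proof (cases "l = OStar")
    case True
    with Inp.prems show ?thesis by (simp add: ccomp_Inp)
  next
    case False
    with Inp.prems obtain R u tr' where "tr = AIn c R # tr'"
      and tr': "ccomp IStar (subst_proc x u P) \<Phi> tr' r \<Phi>'" by (auto simp: ccomp_Inp)
    with Inp.IH[OF tr'] show ?thesis by simp
  qed
qed (simp add: ccomp_Null)

text \<open>The source of all independence between blocks: a basic process reads the frame only
  through the recipes of its inputs and writes only its own handles. The step can be replayed over
  any frame that agrees on what is read and avoids what is written; the result is that frame
  overlaid with the new entries of \<open>\<Phi>'\<close>.\<close>

lemma ccomp_change_frame:
  "ccomp l P \<Phi> tr r \<Phi>' \<Longrightarrow> \<forall>R \<in> ins tr. \<forall>w \<in> vars R. \<Psi> w = \<Phi> w \<Longrightarrow> dom \<Psi> \<inter> outs tr = {} \<Longrightarrow>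
    ccomp l P \<Psi> tr r (\<Psi> ++ \<Phi>' |` outs tr)"
proof (induction P arbitrary: l \<Phi> \<Psi> tr r \<Phi>' rule: proc_subst_induct)
  case (Cond u v P Q)
  show ?case
    by (cases rule: ccomp_CondE[OF Cond.prems(1)])
      (simp_all only: ccomp_Cond Cond.IH[OF _ Cond.prems(2,3)] simp_thms)
next
  case (Outp c u P)
  show ?case
  proof (cases "valid u")
    case True
    with Outp.prems obtain w tr' where tr: "tr = AOut c w # tr'" "w \<notin> dom \<Phi>" "l \<noteq> IPlus"
      "ccomp OStar P (\<Phi>(w \<mapsto> u)) tr' r \<Phi>'" by (auto simp: ccomp_Outp)
    have fr: "\<Phi>(w \<mapsto> u) \<subseteq>\<^sub>m \<Phi>'" "dom \<Phi>' = dom (\<Phi>(w \<mapsto> u)) \<union> outs tr'"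
      "dom (\<Phi>(w \<mapsto> u)) \<inter> outs tr' = {}"
      using ccomp_frame[OF tr(4)] by blast+
    have "ccomp OStar P (\<Psi>(w \<mapsto> u)) tr' r (\<Psi>(w \<mapsto> u) ++ \<Phi>' |` outs tr')"
    proof (rule Outp.IH[OF tr(4)])
      show "\<forall>R \<in> ins tr'. \<forall>v \<in> vars R. (\<Psi>(w \<mapsto> u)) v = (\<Phi>(w \<mapsto> u)) v"
        using Outp.prems(2) tr(1) by simp
      show "dom (\<Psi>(w \<mapsto> u)) \<inter> outs tr' = {}"
        using Outp.prems(3) tr(1) fr(3) by simp
    qed
    moreover have "\<Phi>' w = Some u"
      using fr by (auto simp: map_le_def dest: bspec[of _ _ w])
    then have "\<Psi>(w \<mapsto> u) ++ \<Phi>' |` outs tr' = \<Psi> ++ \<Phi>' |` outs tr"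
      by (auto simp: tr(1) map_add_def restrict_map_def fun_eq_iff split: option.split)
    ultimately show ?thesis
      using True tr(1,3) Outp.prems(3) by (auto simp: ccomp_Outp)
  next
    case False
    with Outp.prems show ?thesis by (simp add: ccomp_Outp)
  qed
next
  case (Inp c x P)
  show ?case
  proof (cases "l = OStar")
    case True
    with Inp.prems show ?thesis by (simp add: ccomp_Inp)
  next
    case False
    with Inp.prems obtain R u tr' where *: "tr = AIn c R # tr'" "R \<in> recipes ar (dom \<Phi>)"
      "app_frame \<Phi> R =\<^sub>E u" "valid (app_frame \<Phi> R)" "valid u"
      "ccomp IStar (subst_proc x u P) \<Phi> tr' r \<Phi>'" by (auto simp: ccomp_Inp)
    have "ccomp IStar (subst_proc x u P) \<Psi> tr' r (\<Psi> ++ \<Phi>' |` outs tr')"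
      by (rule Inp.IH[OF *(6)]) (use Inp.prems *(1) in auto)
    moreover have "app_frame \<Psi> R = app_frame \<Phi> R"
      by (rule app_frame_cong) (use Inp.prems *(1) in auto)
    moreover have "R \<in> recipes ar (dom \<Psi>)"
      using *(1,2) Inp.prems(2) by (fastforce simp: recipes_def dom_def)
    ultimately show ?thesis
      using *(1-5) False by (auto simp: ccomp_Inp)
  qed
qed (simp add: ccomp_Null)

text \<open>Not symmetric: \<open>R\<close> belongs to a given run and is valid there, so validity
  is demanded of the replacement \<open>R'\<close>.\<close>

definition recipe_eq ::
  "('f, 'n, 'x, 'w) frame \<Rightarrow> ('f, 'n, 'w) trm \<Rightarrow> ('f, 'n, 'w) trm \<Rightarrow> bool" where
  "recipe_eq \<Phi> R R' \<longleftrightarrow> R \<in> recipes ar (dom \<Phi>) \<and> R' \<in> recipes ar (dom \<Phi>) \<and>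
    valid (app_frame \<Phi> R') \<and> app_frame \<Phi> R' =\<^sub>E app_frame \<Phi> R"

text \<open>The term received by an input is tied to the recipe only modulo
  \<open>=\<^sub>E\<close>, so the new recipe can deliver the very same term and the run continues
  with identical result and frame. Equality is measured in an earlier frame \<open>\<Phi>0\<close>
  because the current frame grows along the induction.\<close>

lemma ccomp_change_recipes:
  "ccomp l P \<Phi> tr r \<Phi>' \<Longrightarrow> \<Phi>0 \<subseteq>\<^sub>m \<Phi> \<Longrightarrow> list_all2 (rel_action (=) (recipe_eq \<Phi>0) (=)) tr tr' \<Longrightarrow>
    ccomp l P \<Phi> tr' r \<Phi>'"
proof (induction P arbitrary: l \<Phi> tr tr' r \<Phi>' rule: proc_subst_induct)
  case (Cond u v P Q)
  show ?case
    by (cases rule: ccomp_CondE[OF Cond.prems(1)])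
      (simp_all only: ccomp_Cond Cond.IH[OF _ Cond.prems(2,3)] simp_thms)
next
  case (Outp c u P)
  show ?case
  proof (cases "valid u")
    case True
    with Outp.prems obtain w tr1 where tr: "tr = AOut c w # tr1" "w \<notin> dom \<Phi>" "l \<noteq> IPlus"
      "ccomp OStar P (\<Phi>(w \<mapsto> u)) tr1 r \<Phi>'" by (auto simp: ccomp_Outp)
    from Outp.prems(3) tr(1) obtain tr2 where tr2: "tr' = AOut c w # tr2"
      "list_all2 (rel_action (=) (recipe_eq \<Phi>0) (=)) tr1 tr2"
      by (auto simp: list_all2_Cons1 elim!: action.rel_cases)
    have "\<Phi>0 \<subseteq>\<^sub>m \<Phi>(w \<mapsto> u)"
      using Outp.prems(2) tr(2) by (auto simp: map_le_def dom_def)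
    have "ccomp OStar P (\<Phi>(w \<mapsto> u)) tr2 r \<Phi>'"
      by (rule Outp.IH[OF tr(4) \<open>\<Phi>0 \<subseteq>\<^sub>m \<Phi>(w \<mapsto> u)\<close> tr2(2)])
    then show ?thesis
      using tr tr2(1) True by (simp add: ccomp_Outp)
  next
    case False
    with Outp.prems show ?thesis by (simp add: ccomp_Outp)
  qed
next
  case (Inp c x P)
  show ?case
  proof (cases "l = OStar")
    case True
    with Inp.prems show ?thesis by (simp add: ccomp_Inp)
  next
    case False
    with Inp.prems obtain R u tr1 where *: "tr = AIn c R # tr1" "R \<in> recipes ar (dom \<Phi>)"
      "app_frame \<Phi> R =\<^sub>E u" "valid (app_frame \<Phi> R)" "valid u"
      "ccomp IStar (subst_proc x u P) \<Phi> tr1 r \<Phi>'" by (auto simp: ccomp_Inp)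
    from Inp.prems(3) *(1) obtain R' tr2 where tr2: "tr' = AIn c R' # tr2"  "recipe_eq \<Phi>0 R R'"
      "list_all2 (rel_action (=) (recipe_eq \<Phi>0) (=)) tr1 tr2"
      by (auto simp: list_all2_Cons1 elim!: action.rel_cases)
    from tr2(2) have R': "R \<in> recipes ar (dom \<Phi>0)" "R' \<in> recipes ar (dom \<Phi>0)"
      "valid (app_frame \<Phi>0 R')" "app_frame \<Phi>0 R' =\<^sub>E app_frame \<Phi>0 R"
      by (simp_all add: recipe_eq_def)
    note eq = app_frame_map_le[OF R'(1) Inp.prems(2)] app_frame_map_le[OF R'(2) Inp.prems(2)]
    have "R' \<in> recipes ar (dom \<Phi>)"
      using R'(2) Inp.prems(2) by (rule recipes_mono[OF _ map_le_implies_dom_le])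
    moreover have "app_frame \<Phi> R' =\<^sub>E u"
      using eqE_trans[OF R'(4)] *(3) by (simp add: eq)
    moreover have "valid (app_frame \<Phi> R')"
      using R'(3) by (simp add: eq)
    moreover note Inp.IH[OF *(6) Inp.prems(2) tr2(3)]
    ultimately show ?thesis
      using False *(5) tr2(1) by (auto simp: ccomp_Inp)
  qed
qed (simp add: ccomp_Null)

text \<open>\<open>None\<close> comes only from the improper rules, which live at level
  \<open>IStar\<close>, and the first output leads to \<open>OStar\<close> for good. An improper
  block can thus be recognised by its label: it has no handles.\<close>

lemma ccomp_ins_outs:
  "ccomp l P \<Phi> tr r \<Phi>' \<Longrightarrow>
    (l = OStar \<longrightarrow> r \<noteq> None \<and> ins tr = {}) \<and> (l \<noteq> OStar \<longrightarrow> (r = None \<longleftrightarrow> outs tr = {})) \<and>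
    (l = IPlus \<longrightarrow> ins tr \<noteq> {})"
proof (induction P arbitrary: l \<Phi> tr r \<Phi>' rule: proc_subst_induct)
  case (Cond u v P Q)
  show ?case by (cases rule: ccomp_CondE[OF Cond.prems]) (rule Cond.IH, assumption)+
next
  case (Outp c u P)
  then show ?case by (fastforce simp: ccomp_Outp split: if_splits)
next
  case (Inp c x P)
  then show ?case by (fastforce simp: ccomp_Inp)
qed (auto simp: ccomp_Null)

lemma ccomp_channel:
  "ccomp l P \<Phi> tr r \<Phi>' \<Longrightarrow> on_channel d P \<Longrightarrow>
    (\<exists>Rs ws. tr = io d Rs ws \<and> (l = OStar \<longrightarrow> Rs = [])) \<and> (\<forall>Q. r = Some Q \<longrightarrow> on_channel d Q)"
proof (induction P arbitrary: l \<Phi> tr r \<Phi>' rule: proc_subst_induct)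
  case (Cond u v P Q)
  from Cond.prems(2) have "on_channel d P" "on_channel d Q" by simp_all
  with Cond.IH show ?case by (cases rule: ccomp_CondE[OF Cond.prems(1)]) blast+
next
  case (Outp c u P)
  show ?case
  proof (cases "valid u")
    case True
    with Outp.prems obtain w tr1 where tr: "tr = AOut c w # tr1"
      "ccomp OStar P (\<Phi>(w \<mapsto> u)) tr1 r \<Phi>'" by (auto simp: ccomp_Outp)
    with Outp.IH[OF tr(2)] Outp.prems obtain ws where "tr1 = io d [] ws" "\<forall>Q. r = Some Q \<longrightarrow> on_channel d Q"
      by auto
    with tr(1) Outp.prems have "tr = io d [] (w # ws)" by (simp add: io_def)
    with \<open>\<forall>Q. r = Some Q \<longrightarrow> on_channel d Q\<close> show ?thesis by blast
  next
    case False
    with Outp.prems show ?thesis by (auto simp: ccomp_Outp io_def)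
  qed
next
  case (Inp c x P)
  show ?case
  proof (cases "l = OStar")
    case True
    with Inp.prems show ?thesis by (simp add: ccomp_Inp io_def)
  next
    case False
    with Inp.prems obtain R u tr1 where *: "tr = AIn c R # tr1"
      "ccomp IStar (subst_proc x u P) \<Phi> tr1 r \<Phi>'" by (auto simp: ccomp_Inp)
    with Inp.IH[OF *(2)] Inp.prems obtain Rs ws where "tr1 = io d Rs ws" "\<forall>Q. r = Some Q \<longrightarrow> on_channel d Q"
      by auto
    with *(1) Inp.prems have "tr = io d (R # Rs) ws" by (simp add: io_def)
    with \<open>\<forall>Q. r = Some Q \<longrightarrow> on_channel d Q\<close> False show ?thesis by blast
  qed
qed (auto simp: ccomp_Null io_def)

inductive_cases peq_NullE: "peq Null P'"
inductive_cases peq_CondE: "peq (Cond u v P Q) P'"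
inductive_cases peq_InpE: "peq (Inp c x P) P'"
inductive_cases peq_OutpE: "peq (Outp c u P) P'"

text \<open>Validity and equality tests have the same outcome on both sides, and \<open>P'\<close>
  can receive the same term \<open>u\<close>, as the two values of the recipe are related by
  \<open>veq\<close>.\<close>

lemma ccomp_simulate:
  "ccomp l P \<Phi> tr r \<Phi>' \<Longrightarrow> peq P P' \<Longrightarrow> feq \<Phi> \<Psi> \<Longrightarrow>
    \<exists>r' \<Psi>'. ccomp l P' \<Psi> tr r' \<Psi>' \<and> rel_option peq r r' \<and> feq \<Phi>' \<Psi>'"
proof (induction P arbitrary: P' l \<Phi> \<Psi> tr r \<Phi>' rule: proc_subst_induct)
  case Null
  then show ?case by (auto elim!: peq_NullE simp: ccomp_Null peq_Null)
next
  case (Cond u v P Q)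
  from Cond.prems(2) obtain u' v' P1 Q1 where P': "P' = Cond u' v' P1 Q1" "peq P P1" "peq Q Q1"
    and "veq u u'" "veq v v'" by (auto elim: peq_CondE)
  then have "u =\<^sub>E v \<and> valid u \<and> valid v \<longleftrightarrow> u' =\<^sub>E v' \<and> valid u' \<and> valid v'"
    by (intro veq_cond_iff)
  then show ?case
    using Cond.prems Cond.IH(1)[OF _ P'(2)] Cond.IH(2)[OF _ P'(3)]
    unfolding P'(1) ccomp_Cond by blast
next
  case (Outp c u P)
  from Outp.prems(2) obtain u' P1 where P': "P' = Outp c u' P1" "peq P P1" and u: "veq u u'"
    by (auto elim: peq_OutpE)
  show ?case
  proof (cases "valid u")
    case True
    with Outp.prems obtain w tr1 where tr: "tr = AOut c w # tr1" "w \<notin> dom \<Phi>" "l \<noteq> IPlus"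
      "ccomp OStar P (\<Phi>(w \<mapsto> u)) tr1 r \<Phi>'" by (auto simp: ccomp_Outp)
    from True have u': "valid u'" using u veq_imp_valid by blast
    have "feq (\<Phi>(w \<mapsto> u)) (\<Psi>(w \<mapsto> u'))"
      using Outp.prems(3) True u' veq_eqE[OF u valid_wf] by (intro feq_upd)
    from Outp.IH[OF tr(4) P'(2) this] obtain r' \<Psi>' where
      "ccomp OStar P1 (\<Psi>(w \<mapsto> u')) tr1 r' \<Psi>'" "rel_option peq r r'" "feq \<Phi>' \<Psi>'" by blast
    moreover have "w \<notin> dom \<Psi>"
      using tr(2) feq_dom[OF Outp.prems(3)] by simp
    ultimately show ?thesis
      using tr(1,3) P'(1) u' by (auto simp: ccomp_Outp)
  next
    case False
    moreover from this u have "\<not> valid u'" by (simp add: veq_valid_iff)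
    ultimately show ?thesis
      using Outp.prems P'(1) by (auto simp: ccomp_Outp)
  qed
next
  case (Inp c x P)
  from Inp.prems(2) obtain P1 where P': "P' = Inp c x P1" "peq P P1"
    by (auto elim: peq_InpE)
  show ?case
  proof (cases "l = OStar")
    case True
    with Inp.prems P' show ?thesis by (auto simp: ccomp_Inp)
  next
    case False
    with Inp.prems obtain R u tr1 where *: "tr = AIn c R # tr1" "R \<in> recipes ar (dom \<Phi>)"
      "app_frame \<Phi> R =\<^sub>E u" "valid (app_frame \<Phi> R)" "valid u"
      "ccomp IStar (subst_proc x u P) \<Phi> tr1 r \<Phi>'" by (auto simp: ccomp_Inp)
    note R = feq_app_frame[OF Inp.prems(3) *(2)]
    have "peq (subst_proc x u P) (subst_proc x u P1)"
      using P'(2) by (rule peq_subst_proc) (rule veq_refl)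
    from Inp.IH[OF *(6) this Inp.prems(3)] obtain r' \<Psi>' where
      "ccomp IStar (subst_proc x u P1) \<Psi> tr1 r' \<Psi>'" "rel_option peq r r'" "feq \<Phi>' \<Psi>'" by blast
    moreover have "app_frame \<Psi> R =\<^sub>E u"
      using veq_eqE[OF R] *(3) eqE_sym eqE_trans by blast
    moreover have "valid (app_frame \<Psi> R)"
      using R(1) *(4) by (rule veq_imp_valid)
    ultimately show ?thesis
      using False * P'(1) feq_dom[OF Inp.prems(3)] by (auto simp: ccomp_Inp)
  qed
qed

text \<open>Process, level and label leave no choice of rule, since every test is decided alike on
  both sides. The only freedom is the term received by an input, and both choices are valid and
  equal to values of the same recipe.\<close>

lemma ccomp_determ:
  "ccomp l P \<Phi> tr r \<Phi>' \<Longrightarrow> peq P P' \<Longrightarrow> feq \<Phi> \<Psi> \<Longrightarrow> ccomp l P' \<Psi> tr r' \<Psi>' \<Longrightarrow>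
    rel_option peq r r' \<and> feq \<Phi>' \<Psi>'"
proof (induction P arbitrary: P' l \<Phi> \<Psi> tr r \<Phi>' r' \<Psi>' rule: proc_subst_induct)
  case Null
  then show ?case by (auto elim!: peq_NullE simp: ccomp_Null peq_Null)
next
  case (Cond u v P Q)
  from Cond.prems(2) obtain u' v' P1 Q1 where P': "P' = Cond u' v' P1 Q1" "peq P P1" "peq Q Q1"
    and "veq u u'" "veq v v'" by (auto elim: peq_CondE)
  then have "u =\<^sub>E v \<and> valid u \<and> valid v \<longleftrightarrow> u' =\<^sub>E v' \<and> valid u' \<and> valid v'"
    by (intro veq_cond_iff)
  then show ?case
    using Cond.prems Cond.IH(1)[OF _ P'(2)] Cond.IH(2)[OF _ P'(3)]
    unfolding P'(1) ccomp_Cond by blast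
next
  case (Outp c u P)
  from Outp.prems(2) obtain u' P1 where P': "P' = Outp c u' P1" "peq P P1" and u: "veq u u'"
    by (auto elim: peq_OutpE)
  show ?case
  proof (cases "valid u")
    case True
    then have u': "valid u'" using u veq_imp_valid by blast
    from True Outp.prems obtain w tr1 where tr: "tr = AOut c w # tr1" "w \<notin> dom \<Phi>"
      "ccomp OStar P (\<Phi>(w \<mapsto> u)) tr1 r \<Phi>'" by (auto simp: ccomp_Outp)
    from u' tr(1) Outp.prems(4) have "ccomp OStar P1 (\<Psi>(w \<mapsto> u')) tr1 r' \<Psi>'"
      by (simp add: ccomp_Outp P'(1))
    moreover have "feq (\<Phi>(w \<mapsto> u)) (\<Psi>(w \<mapsto> u'))"
      using Outp.prems(3) True u' veq_eqE[OF u valid_wf] by (intro feq_upd)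
    ultimately show ?thesis
      using Outp.IH[OF tr(3) P'(2)] by blast
  next
    case False
    moreover from this u have "\<not> valid u'" by (simp add: veq_valid_iff)
    ultimately show ?thesis
      using Outp.prems P'(1) by (auto simp: ccomp_Outp)
  qed
next
  case (Inp c x P)
  from Inp.prems(2) obtain P1 where P': "P' = Inp c x P1" "peq P P1"
    by (auto elim: peq_InpE)
  show ?case
  proof (cases "l = OStar")
    case True
    with Inp.prems P' show ?thesis by (auto simp: ccomp_Inp)
  next
    case False
    with Inp.prems obtain R u tr1 where *: "tr = AIn c R # tr1" "R \<in> recipes ar (dom \<Phi>)"
      "app_frame \<Phi> R =\<^sub>E u" "valid u"
      "ccomp IStar (subst_proc x u P) \<Phi> tr1 r \<Phi>'" by (auto simp: ccomp_Inp)
    from False Inp.prems(4) obtain u' where u': "app_frame \<Psi> R =\<^sub>E u'" "valid u'"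
      "ccomp IStar (subst_proc x u' P1) \<Psi> tr1 r' \<Psi>'" by (auto simp: ccomp_Inp P'(1) *(1))
    have "u =\<^sub>E u'"
      using veq_eqE[OF feq_app_frame[OF Inp.prems(3) *(2)]] *(3) u'(1) eqE_sym eqE_trans by blast
    then have "peq (subst_proc x u P) (subst_proc x u' P1)"
      using P'(2) *(4) u'(2) by (intro peq_subst_proc veq_valid)
    from Inp.IH[OF *(5) this Inp.prems(3) u'(3)] show ?thesis .
  qed
qed

end

section \<open>Soundness and completeness of symbolic steps\<close>

text \<open>Forgets the first-order variable of each deduction constraint. What a run adds to this
  set depends only on its label and the initial domain, and the set determines
  \<open>ded_dom\<close>.\<close>

definition deds :: "('f, 'n, 'x, 'w, 'y) constr set \<Rightarrow> ('y \<times> 'w set) set" where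
  "deds S = {(X, D). \<exists>x. Deduce D X x \<in> S}"

lemma deds_simps [simp]:
  "deds {} = {}"
  "deds (insert (Deduce D X x) S) = insert (X, D) (deds S)"
  "deds (insert (Eq u v) S) = deds S"
  "deds (insert (Neq u v) S) = deds S"
  by (auto simp: deds_def)

lemma ded_dom_deds: "ded_dom S X = (THE D. (X, D) \<in> deds S)"
  by (simp add: ded_dom_def deds_def)

definition inl :: "('c, 'r, 'w) action list \<Rightarrow> 'r list" where
  "inl tr = concat (map (\<lambda>a. case a of AIn c R \<Rightarrow> [R] | _ \<Rightarrow> []) tr)"

lemma inl_simps [simp]:
  "inl [] = []" "inl (AIn c R # tr) = R # inl tr" "inl (AOut c w # tr) = inl tr"
  by (auto simp: inl_def)

lemma inl_io [simp]: "inl (io c Rs ws) = Rs"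
proof (induction Rs)
  case Nil
  then show ?case by (induction ws) (auto simp: io_def)
qed (auto simp: io_def)

abbreviation inst_acts :: "('y \<Rightarrow> 'r) \<Rightarrow> ('c, 'y, 'w) action list \<Rightarrow> ('c, 'r, 'w) action list" where
  "inst_acts \<theta> \<equiv> map (map_action (\<lambda>c. c) \<theta> (\<lambda>w. w))"

lemma inst_acts_io: "inst_acts \<theta> (io c Xs ws) = io c (map \<theta> Xs) ws"
  by (simp add: io_def)

context term_model
begin

section \<open>Symbolic steps by the shape of the process\<close>

lemma scomp_Null:
  "scomp V l Null \<Phi> S tr r \<Phi>' S' \<longleftrightarrow>
    tr = [] \<and> \<Phi>' = \<Phi> \<and> S' = S \<and> (l = OStar \<and> r = Some Null \<or> l = IStar \<and> r = None)"
  by (subst scomp.simps) (auto elim: sstep.cases)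

lemma scomp_Cond:
  "scomp V l (Cond u v P Q) \<Phi> S tr r \<Phi>' S' \<longleftrightarrow>
    scomp V l P \<Phi> (insert (Eq u v) S) tr r \<Phi>' S' \<or> scomp V l Q \<Phi> (insert (Neq u v) S) tr r \<Phi>' S'"
  by (subst scomp.simps) (auto simp: sstep.simps)

lemma scomp_Inp:
  "scomp V l (Inp c y Q) \<Phi> S tr r \<Phi>' S' \<longleftrightarrow>
    l = OStar \<and> tr = [] \<and> r = Some (Inp c y Q) \<and> \<Phi>' = \<Phi> \<and> S' = S \<or>
    l \<noteq> OStar \<and> (\<exists>X x tr'. tr = AIn c X # tr' \<and>
      x \<notin> V \<union> all_vars (Inp c y Q) \<union> \<Union> (vars ` ran \<Phi>) \<union> \<Union> (constr_vars ` S) \<and> X \<notin> fst ` deds S \<and>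
      scomp V IStar (subst_proc y (Var x) Q) \<Phi> (insert (Deduce (dom \<Phi>) X x) S) tr' r \<Phi>' S')"
proof -
  have X: "X \<notin> fst ` deds S \<longleftrightarrow> (\<forall>D z. Deduce D X z \<notin> S)" for X
    by (force simp: deds_def)
  show ?thesis
    unfolding X by (subst scomp.simps, cases l) (simp_all add: sstep.simps, blast+)
qed

lemma scomp_Outp:
  "scomp V l (Outp c u Q) \<Phi> S tr r \<Phi>' S' \<longleftrightarrow> l \<noteq> IPlus \<and>
    ((\<exists>w tr'. tr = AOut c w # tr' \<and> w \<notin> dom \<Phi> \<and> scomp V OStar Q (\<Phi>(w \<mapsto> u)) S tr' r \<Phi>' S') \<or>
     tr = [] \<and> \<Phi>' = \<Phi> \<and> S' = insert (Neq u u) S \<and>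
     (l = OStar \<and> r = Some (Outp c u Q) \<or> l = IStar \<and> r = None))"
  by (subst scomp.simps, cases l) (auto simp: sstep.simps)

text \<open>All variables of a block get the same domain \<open>dom \<Phi>\<close>, because its
  inputs precede its outputs; the clause for \<open>OStar\<close> carries this through the
  induction.\<close>

lemma scomp_invars:
  "scomp V l P \<Phi> S tr r \<Phi>' S' \<Longrightarrow>
    \<Phi> \<subseteq>\<^sub>m \<Phi>' \<and> S \<subseteq> S' \<and> dom \<Phi>' = dom \<Phi> \<union> outs tr \<and> (l = OStar \<longrightarrow> inl tr = []) \<and>
    deds S' = deds S \<union> set (inl tr) \<times> {dom \<Phi>} \<and> distinct (inl tr) \<and> set (inl tr) \<inter> fst ` deds S = {}"
proof (induction P arbitrary: l \<Phi> S tr r \<Phi>' S' rule: proc_subst_induct)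
  case Null
  then show ?case by (auto simp: scomp_Null)
next
  case (Cond u v P Q)
  from Cond.prems show ?case unfolding scomp_Cond
  proof
    assume "scomp V l P \<Phi> (insert (Eq u v) S) tr r \<Phi>' S'"
    from Cond.IH(1)[OF this] show ?case by simp
  next
    assume "scomp V l Q \<Phi> (insert (Neq u v) S) tr r \<Phi>' S'"
    from Cond.IH(2)[OF this] show ?case by simp
  qed
next
  case (Inp c y P)
  show ?case
  proof (cases "l = OStar")
    case True
    with Inp.prems show ?thesis by (simp add: scomp_Inp)
  next
    case False
    with Inp.prems obtain X x tr' where *: "tr = AIn c X # tr'" "X \<notin> fst ` deds S"
      "scomp V IStar (subst_proc y (Var x) P) \<Phi> (insert (Deduce (dom \<Phi>) X x) S) tr' r \<Phi>' S'"
      by (auto simp: scomp_Inp)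
    from Inp.IH[OF *(3)] show ?thesis
      using *(1,2) False by auto
  qed
next
  case (Outp c u P)
  show ?case
  proof (cases "tr = []")
    case True
    with Outp.prems show ?thesis by (auto simp: scomp_Outp)
  next
    case False
    with Outp.prems obtain w tr' where tr: "tr = AOut c w # tr'" "w \<notin> dom \<Phi>"
      "scomp V OStar P (\<Phi>(w \<mapsto> u)) S tr' r \<Phi>' S'" by (auto simp: scomp_Outp)
    have IH: "\<Phi>(w \<mapsto> u) \<subseteq>\<^sub>m \<Phi>'" "S \<subseteq> S'" "dom \<Phi>' = dom (\<Phi>(w \<mapsto> u)) \<union> outs tr'" "inl tr' = []"
      "deds S' = deds S \<union> set (inl tr') \<times> {dom (\<Phi>(w \<mapsto> u))}"
      using Outp.IH[OF tr(3)] by blast+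
    from tr(2) have "\<Phi> \<subseteq>\<^sub>m \<Phi>(w \<mapsto> u)" by (auto simp: map_le_def)
    with IH(1) have "\<Phi> \<subseteq>\<^sub>m \<Phi>'" by (blast intro: map_le_trans)
    with IH tr(1,2) show ?thesis by auto
  qed
qed

lemma scomp_mono:
  assumes "scomp V l P \<Phi> S tr r \<Phi>' S'"
  shows "\<Phi> \<subseteq>\<^sub>m \<Phi>'" "S \<subseteq> S'"
  using scomp_invars[OF assms] by simp_all

text \<open>The solution belongs to a final system, \<open>\<Phi>f\<close> with \<open>Sf\<close>,
  and stays fixed. Frames and constraint sets only grow towards it, so it satisfies every constraint
  met on the way.\<close>

lemma scomp_sound:
  assumes "solves \<Phi>f Sf \<theta> \<rho>" "\<And>D X x. Deduce D X x \<in> Sf \<Longrightarrow> \<theta> X \<in> recipes ar D"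
  shows "scomp V l P \<Phi> S tr r \<Phi>' S' \<Longrightarrow> \<Phi>' \<subseteq>\<^sub>m \<Phi>f \<Longrightarrow> S' \<subseteq> Sf \<Longrightarrow>
    ccomp l (inst_proc \<rho> P) (inst_frame \<rho> \<Phi>) (inst_acts \<theta> tr)
      (map_option (inst_proc \<rho>) r) (inst_frame \<rho> \<Phi>')"
proof (induction P arbitrary: l \<Phi> S tr r \<Phi>' S' rule: proc_subst_induct)
  case Null
  then show ?case by (auto simp: scomp_Null ccomp_Null)
next
  case (Cond u v P Q)
  from Cond.prems(1) show ?case unfolding scomp_Cond
  proof
    assume P: "scomp V l P \<Phi> (insert (Eq u v) S) tr r \<Phi>' S'"
    have "Eq u v \<in> Sf" using scomp_mono(2)[OF P] Cond.prems(3) by blast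
    then have "subst \<rho> u =\<^sub>E subst \<rho> v \<and> valid (subst \<rho> u) \<and> valid (subst \<rho> v)"
      using assms(1) by (simp add: solves_def)
    with Cond.IH(1)[OF P Cond.prems(2,3)] show ?case by (simp add: ccomp_Cond)
  next
    assume Q: "scomp V l Q \<Phi> (insert (Neq u v) S) tr r \<Phi>' S'"
    have "Neq u v \<in> Sf" using scomp_mono(2)[OF Q] Cond.prems(3) by blast
    then have "\<not> (subst \<rho> u =\<^sub>E subst \<rho> v \<and> valid (subst \<rho> u) \<and> valid (subst \<rho> v))"
      using assms(1) unfolding solves_def by blast
    with Cond.IH(2)[OF Q Cond.prems(2,3)] show ?case unfolding inst_proc.simps ccomp_Cond by blast
  qed
next
  case (Inp c y P)
  show ?case
  proof (cases "l = OStar")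
    case True
    with Inp.prems show ?thesis by (auto simp: scomp_Inp ccomp_Inp)
  next
    case False
    with Inp.prems obtain X x tr' where *: "tr = AIn c X # tr'" "x \<notin> all_vars (Inp c y P)"
      "scomp V IStar (subst_proc y (Var x) P) \<Phi> (insert (Deduce (dom \<Phi>) X x) S) tr' r \<Phi>' S'"
      by (auto simp: scomp_Inp)
    have D: "Deduce (dom \<Phi>) X x \<in> Sf" using scomp_mono(2)[OF *(3)] Inp.prems(3) by blast
    have le: "\<Phi> \<subseteq>\<^sub>m \<Phi>f" using scomp_mono(1)[OF *(3)] Inp.prems(2) by (rule map_le_trans)
    have gr: "vars (\<rho> z) = {}" for z using assms(1) by (simp add: solves_def ground_def)
    have R: "\<theta> X \<in> recipes ar (dom \<Phi>)" using D assms(2) by blast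
    \<comment> \<open>\<open>\<theta> X\<close> uses only handles that exist at the time of the
      input, so the final frame and the current one give it the same value.\<close>
    then have app: "app_frame (inst_frame \<rho> \<Phi>f) (\<theta> X) = app_frame (inst_frame \<rho> \<Phi>) (\<theta> X)"
      using le by (intro app_frame_map_le inst_frame_mono) simp_all
    have "app_frame (inst_frame \<rho> \<Phi>) (\<theta> X) =\<^sub>E \<rho> x" "valid (app_frame (inst_frame \<rho> \<Phi>) (\<theta> X))"
      "valid (\<rho> x)"
      using assms(1) D unfolding solves_def app[symmetric] by blast+
    moreover have "inst_proc \<rho> (subst_proc y (Var x) P)
      = subst_proc y (\<rho> x) (inst_proc (\<rho>(y := Var y)) P)"
      by (rule inst_proc_subst_proc) (use gr *(2) in auto)
    moreover note Inp.IH[OF *(3) Inp.prems(2,3)]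
    ultimately show ?thesis
      using False *(1) R by (auto simp: ccomp_Inp)
  qed
next
  case (Outp c u P)
  show ?case
  proof (cases "tr = []")
    case True
    with Outp.prems have "Neq u u \<in> Sf" by (auto simp: scomp_Outp)
    \<comment> \<open>\<open>=\<^sub>E\<close> is reflexive on valid terms, so
      \<open>Neq u u\<close> can hold only by invalidity.\<close>
    then have "\<not> valid (subst \<rho> u)"
      using assms(1) eqE_refl[OF valid_wf] unfolding solves_def by blast
    with Outp.prems True show ?thesis by (auto simp: scomp_Outp ccomp_Outp)
  next
    case False
    with Outp.prems obtain w tr' where tr: "tr = AOut c w # tr'" "w \<notin> dom \<Phi>" "l \<noteq> IPlus"
      "scomp V OStar P (\<Phi>(w \<mapsto> u)) S tr' r \<Phi>' S'" by (auto simp: scomp_Outp)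
    have "\<Phi>(w \<mapsto> u) \<subseteq>\<^sub>m \<Phi>f"
      using scomp_mono(1)[OF tr(4)] Outp.prems(2) by (rule map_le_trans)
    then have "\<Phi>f w = Some u" by (auto simp: map_le_def dest: bspec[of _ _ w])
    then have "subst \<rho> u \<in> ran (inst_frame \<rho> \<Phi>f)"
      by (auto simp: inst_frame_def ran_def intro!: exI[of _ w])
    then have "valid (subst \<rho> u)"
      using assms(1) unfolding solves_def by blast
    moreover have "ccomp OStar (inst_proc \<rho> P) ((inst_frame \<rho> \<Phi>)(w \<mapsto> subst \<rho> u))
      (inst_acts \<theta> tr') (map_option (inst_proc \<rho>) r) (inst_frame \<rho> \<Phi>')"
      using Outp.IH[OF tr(4) Outp.prems(2,3)] by (simp only: inst_frame_upd)
    ultimately show ?thesis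
      using tr(1-3) by (simp add: ccomp_Outp)
  qed
qed

text \<open>Unlike \<open>Sol\<close>, it exposes the first-order substitution, which the
  construction of a symbolic run extends input by input. The clause
  \<open>D \<subseteq> dom \<Phi>\<close> keeps the values of earlier recipes stable when an output
  extends the frame.\<close>

definition sol_on ::
  "('f, 'n, 'x, 'w) frame \<Rightarrow> ('f, 'n, 'x, 'w, 'y) constr set \<Rightarrow>
   ('y \<Rightarrow> ('f, 'n, 'w) trm) \<Rightarrow> ('x \<Rightarrow> ('f, 'n, 'x) trm) \<Rightarrow> bool" where
  "sol_on \<Phi> S \<theta> \<rho> \<longleftrightarrow> solves \<Phi> S \<theta> \<rho> \<and> (\<forall>(X, D) \<in> deds S. \<theta> X \<in> recipes ar D \<and> D \<subseteq> dom \<Phi>)"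

lemma sol_on_Eq:
  "sol_on \<Phi> (insert (Eq u v) S) \<theta> \<rho> \<longleftrightarrow>
    sol_on \<Phi> S \<theta> \<rho> \<and> subst \<rho> u =\<^sub>E subst \<rho> v \<and> valid (subst \<rho> u) \<and> valid (subst \<rho> v)"
  unfolding sol_on_def solves_def by auto

lemma sol_on_Neq:
  "sol_on \<Phi> (insert (Neq u v) S) \<theta> \<rho> \<longleftrightarrow>
    sol_on \<Phi> S \<theta> \<rho> \<and> \<not> (subst \<rho> u =\<^sub>E subst \<rho> v \<and> valid (subst \<rho> u) \<and> valid (subst \<rho> v))"
  unfolding sol_on_def solves_def by auto

lemma sol_on_upd:
  assumes "sol_on \<Phi> S \<theta> \<rho>" "w \<notin> dom \<Phi>" "valid (subst \<rho> u)"
  shows "sol_on (\<Phi>(w \<mapsto> u)) S \<theta> \<rho>"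
proof -
  have app: "app_frame (inst_frame \<rho> (\<Phi>(w \<mapsto> u))) (\<theta> X) = app_frame (inst_frame \<rho> \<Phi>) (\<theta> X)"
    if "Deduce D X x \<in> S" for D X x
  proof -
    from that assms(1) have "\<theta> X \<in> recipes ar D" "D \<subseteq> dom \<Phi>"
      by (auto simp: sol_on_def deds_def)
    then show ?thesis
      unfolding inst_frame_upd using assms(2)
      by (intro app_frame_upd) (auto intro: recipes_mono)
  qed
  have "\<forall>t \<in> ran (inst_frame \<rho> (\<Phi>(w \<mapsto> u))). valid t"
    using assms unfolding inst_frame_upd sol_on_def solves_def by (auto simp: ran_def)
  with assms(1) app have "solves (\<Phi>(w \<mapsto> u)) S \<theta> \<rho>"
    unfolding sol_on_def solves_def by (auto simp: deds_def)
  with assms(1) show ?thesis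
    unfolding sol_on_def by fastforce
qed

text \<open>As \<open>x\<close> occurs neither in the frame nor in \<open>S\<close>, redefining
  \<open>\<rho>\<close> at \<open>x\<close> affects no earlier constraint.\<close>

lemma sol_on_Deduce:
  assumes "sol_on \<Phi> S \<theta> \<rho>" "x \<notin> \<Union> (vars ` ran \<Phi>) \<union> \<Union> (constr_vars ` S)"
    and "\<theta> X \<in> recipes ar (dom \<Phi>)" "app_frame (inst_frame \<rho> \<Phi>) (\<theta> X) =\<^sub>E u"
    and "valid (app_frame (inst_frame \<rho> \<Phi>) (\<theta> X))" "valid u"
  shows "sol_on \<Phi> (insert (Deduce (dom \<Phi>) X x) S) \<theta> (\<rho>(x := u))"
proof -
  have frame: "inst_frame (\<rho>(x := u)) \<Phi> = inst_frame \<rho> \<Phi>"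
    by (rule inst_frame_cong) (use assms(2) in auto)
  have S: "subst (\<rho>(x := u)) s = subst \<rho> s"
    if "c \<in> S" "vars s \<subseteq> constr_vars c" for c s
    by (rule subst_cong_vars) (use that assms(2) in auto)
  have Deq: "z \<noteq> x" if "Deduce D Y z \<in> S" for D Y z
    using that assms(2) by force
  have *: "solves \<Phi> S \<theta> \<rho>" and **: "\<forall>(X, D) \<in> deds S. \<theta> X \<in> recipes ar D \<and> D \<subseteq> dom \<Phi>"
    using assms(1) by (simp_all add: sol_on_def)
  have "solves \<Phi> (insert (Deduce (dom \<Phi>) X x) S) \<theta> (\<rho>(x := u))"
    unfolding solves_def frame
  proof (intro conjI allI impI)
    fix z show "ground ar ((\<rho>(x := u)) z)"
      using * assms(6) by (simp add: solves_def valid_ground)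
  next
    fix D Y z assume "Deduce D Y z \<in> insert (Deduce (dom \<Phi>) X x) S"
    then consider "D = dom \<Phi>" "Y = X" "z = x" | "Deduce D Y z \<in> S" "z \<noteq> x" using Deq by auto
    then have "app_frame (inst_frame \<rho> \<Phi>) (\<theta> Y) =\<^sub>E (\<rho>(x := u)) z \<and>
      valid (app_frame (inst_frame \<rho> \<Phi>) (\<theta> Y)) \<and> valid ((\<rho>(x := u)) z)"
    proof cases
      case 2
      with * show ?thesis unfolding solves_def by simp
    qed (use assms(4-6) in simp)
    then show "app_frame (inst_frame \<rho> \<Phi>) (\<theta> Y) =\<^sub>E (\<rho>(x := u)) z"
      "valid (app_frame (inst_frame \<rho> \<Phi>) (\<theta> Y))" "valid ((\<rho>(x := u)) z)" by blast+
  next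
    fix s t assume "Eq s t \<in> insert (Deduce (dom \<Phi>) X x) S"
    then have "Eq s t \<in> S" by simp
    with * S[OF this, of s] S[OF this, of t]
    show "subst (\<rho>(x := u)) s =\<^sub>E subst (\<rho>(x := u)) t" "valid (subst (\<rho>(x := u)) s)"
      "valid (subst (\<rho>(x := u)) t)" unfolding solves_def by simp_all
  next
    fix s t assume "Neq s t \<in> insert (Deduce (dom \<Phi>) X x) S"
    then have "Neq s t \<in> S" by simp
    with * S[OF this, of s] S[OF this, of t]
    show "\<not> subst (\<rho>(x := u)) s =\<^sub>E subst (\<rho>(x := u)) t \<or> \<not> valid (subst (\<rho>(x := u)) s) \<or>
      \<not> valid (subst (\<rho>(x := u)) t)" unfolding solves_def by simp
  next
    show "\<forall>t \<in> ran (inst_frame \<rho> \<Phi>). valid t" using * unfolding solves_def by blast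
  qed
  with ** assms(3) show ?thesis by (auto simp: sol_on_def)
qed

lemma finite_used_vars:
  "finite (dom \<Phi>) \<Longrightarrow> finite S \<Longrightarrow> finite (\<Union> (vars ` ran \<Phi>) \<union> \<Union> (constr_vars ` S))"
proof -
  assume "finite (dom \<Phi>)" "finite S"
  moreover have "finite (constr_vars c)" if "c \<in> S" for c
    by (cases c) (auto simp: finite_vars)
  ultimately show ?thesis by (auto simp: finite_ran finite_vars)
qed

text \<open>Label and \<open>\<theta>\<close> are given, so only first-order variables remain to be
  chosen: each input takes one outside a finite set and maps it to the term received. Agreement of
  \<open>\<rho>'\<close> with \<open>\<rho>\<close> on \<open>V\<close> keeps the instances of the
  parallel processes intact.\<close>

lemma scomp_complete:
  assumes "infinite (UNIV :: 'x set)" "finite V"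
  shows "ccomp l (inst_proc \<rho> P) (inst_frame \<rho> \<Phi>) (inst_acts \<theta> tr) r' \<Psi> \<Longrightarrow>
    sol_on \<Phi> S \<theta> \<rho> \<Longrightarrow> finite (dom \<Phi>) \<Longrightarrow> finite S \<Longrightarrow>
    distinct (inl tr) \<Longrightarrow> set (inl tr) \<inter> fst ` deds S = {} \<Longrightarrow>
    \<exists>r \<Phi>' S' \<rho>'. scomp V l P \<Phi> S tr r \<Phi>' S' \<and> sol_on \<Phi>' S' \<theta> \<rho>' \<and> r' = map_option (inst_proc \<rho>') r \<and>
      \<Psi> = inst_frame \<rho>' \<Phi>' \<and> finite (dom \<Phi>') \<and> finite S' \<and> (\<forall>x \<in> V. \<rho>' x = \<rho> x)"
proof (induction P arbitrary: l \<rho> \<Phi> S tr r' rule: proc_subst_induct)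
  case Null
  then show ?case by (fastforce simp: scomp_Null ccomp_Null)
next
  case (Cond u v P Q)
  note prems = Cond.prems(2-)
  from Cond.prems(1) show ?case
    unfolding inst_proc.simps
  proof (cases rule: ccomp_CondE)
    case 1
    with prems(1) have "sol_on \<Phi> (insert (Eq u v) S) \<theta> \<rho>" by (simp add: sol_on_Eq)
    from Cond.IH(1)[OF 1(2) this] prems(2-) show ?thesis
      unfolding scomp_Cond by auto
  next
    case 2
    with prems(1) have "sol_on \<Phi> (insert (Neq u v) S) \<theta> \<rho>" by (simp add: sol_on_Neq)
    from Cond.IH(2)[OF 2(2) this] prems(2-) show ?thesis
      unfolding scomp_Cond by auto
  qed
next
  case (Outp c u P)
  show ?case
  proof (cases "valid (subst \<rho> u)")
    case True
    from Outp.prems(1) obtain w tr1 where tr1: "inst_acts \<theta> tr = AOut c w # tr1"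
      "w \<notin> dom \<Phi>" "l \<noteq> IPlus"
      "ccomp OStar (inst_proc \<rho> P) ((inst_frame \<rho> \<Phi>)(w \<mapsto> subst \<rho> u)) tr1 r' \<Psi>"
      unfolding inst_proc.simps ccomp_Outp dom_inst_frame if_P[OF True] by iprover
    from tr1(1) obtain a tr2 where a: "tr = a # tr2" "tr1 = inst_acts \<theta> tr2"
      "map_action (\<lambda>c. c) \<theta> (\<lambda>w. w) a = AOut c w" by auto
    from a(3) have tr: "tr = AOut c w # tr2" unfolding a(1) by (cases a) auto
    have "ccomp OStar (inst_proc \<rho> P) (inst_frame \<rho> (\<Phi>(w \<mapsto> u))) (inst_acts \<theta> tr2) r' \<Psi>"
      using tr1(4) by (simp only: a(2) inst_frame_upd)
    moreover have "sol_on (\<Phi>(w \<mapsto> u)) S \<theta> \<rho>"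
      using Outp.prems(2) tr1(2) True by (rule sol_on_upd)
    ultimately have "\<exists>r \<Phi>' S' \<rho>'. scomp V OStar P (\<Phi>(w \<mapsto> u)) S tr2 r \<Phi>' S' \<and> sol_on \<Phi>' S' \<theta> \<rho>' \<and>
      r' = map_option (inst_proc \<rho>') r \<and> \<Psi> = inst_frame \<rho>' \<Phi>' \<and> finite (dom \<Phi>') \<and> finite S' \<and>
      (\<forall>x \<in> V. \<rho>' x = \<rho> x)"
    proof (rule Outp.IH)
      show "finite (dom (\<Phi>(w \<mapsto> u)))" using Outp.prems(3) by simp
      show "distinct (inl tr2)" "set (inl tr2) \<inter> fst ` deds S = {}"
        using Outp.prems(5,6) tr by simp_all
    qed (rule Outp.prems(4))
    then show ?thesis
      using tr tr1(2,3) unfolding scomp_Outp by blast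
  next
    case False
    with Outp.prems have "sol_on \<Phi> (insert (Neq u u) S) \<theta> \<rho>" by (simp add: sol_on_Neq)
    with False Outp.prems show ?thesis
      unfolding scomp_Outp inst_proc.simps ccomp_Outp
      by (intro exI[of _ "if l = IStar then None else Some (Outp c u P)"] exI[of _ \<Phi>]
          exI[of _ "insert (Neq u u) S"] exI[of _ \<rho>]) auto
  qed
next
  case (Inp c y P)
  show ?case
  proof (cases "l = OStar")
    case True
    with Inp.prems show ?thesis
      unfolding scomp_Inp inst_proc.simps ccomp_Inp
      by (intro exI[of _ "Some (Inp c y P)"] exI[of _ \<Phi>] exI[of _ S] exI[of _ \<rho>]) auto
  next
    case False
    with Inp.prems(1) obtain R u tr1 where tr1: "inst_acts \<theta> tr = AIn c R # tr1"
      "R \<in> recipes ar (dom \<Phi>)" "app_frame (inst_frame \<rho> \<Phi>) R =\<^sub>E u"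
      "valid (app_frame (inst_frame \<rho> \<Phi>) R)" "valid u"
      "ccomp IStar (subst_proc y u (inst_proc (\<rho>(y := Var y)) P)) (inst_frame \<rho> \<Phi>) tr1 r' \<Psi>"
      unfolding inst_proc.simps ccomp_Inp dom_inst_frame by (elim disjE conjE exE) (simp, iprover)
    from tr1(1) obtain a tr2 where a: "tr = a # tr2" "tr1 = inst_acts \<theta> tr2"
      "map_action (\<lambda>c. c) \<theta> (\<lambda>w. w) a = AIn c R" by auto
    from a(3) obtain X where tr: "tr = AIn c X # tr2" and R: "R = \<theta> X"
      unfolding a(1) by (cases a) auto
    let ?U = "V \<union> all_vars (Inp c y P) \<union> \<Union> (vars ` ran \<Phi>) \<union> \<Union> (constr_vars ` S)"
    have "finite ?U"
      using assms(2) finite_used_vars[OF Inp.prems(3,4)] finite_all_vars[of "Inp c y P"] by simp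
    from ex_new_if_finite[OF assms(1) this] obtain x where x: "x \<notin> ?U" ..
    let ?\<rho> = "\<rho>(x := u)" and ?S = "insert (Deduce (dom \<Phi>) X x) S"
    have sol: "sol_on \<Phi> ?S \<theta> ?\<rho>"
      using Inp.prems(2) x tr1(2-5) unfolding R by (intro sol_on_Deduce) auto
    have frame: "inst_frame ?\<rho> \<Phi> = inst_frame \<rho> \<Phi>"
      by (rule inst_frame_cong) (use x in auto)
    have gr: "vars (?\<rho> z) = {}" for z
      using sol by (simp only: sol_on_def solves_def ground_def)
    have "inst_proc ?\<rho> (subst_proc y (Var x) P) = subst_proc y (?\<rho> x) (inst_proc (?\<rho>(y := Var y)) P)"
    proof (rule inst_proc_subst_proc)
      show "x \<notin> all_vars P" "x \<noteq> y" using x by simp_all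
    qed (rule gr, rule disjI2, rule gr)
    moreover have "inst_proc (?\<rho>(y := Var y)) P = inst_proc (\<rho>(y := Var y)) P"
      by (rule inst_proc_cong) (use x free_vars_subset_all_vars[of P] in auto)
    ultimately have "ccomp IStar (inst_proc ?\<rho> (subst_proc y (Var x) P)) (inst_frame ?\<rho> \<Phi>)
      (inst_acts \<theta> tr2) r' \<Psi>"
      using tr1(6) by (simp only: a(2) frame fun_upd_same)
    from Inp.IH[OF this sol] obtain r \<Phi>' S' \<rho>' where
      *: "scomp V IStar (subst_proc y (Var x) P) \<Phi> ?S tr2 r \<Phi>' S'" and **: "sol_on \<Phi>' S' \<theta> \<rho>'"
      "r' = map_option (inst_proc \<rho>') r" "\<Psi> = inst_frame \<rho>' \<Phi>'" "finite (dom \<Phi>')" "finite S'"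
      and V: "\<forall>z \<in> V. \<rho>' z = ?\<rho> z"
      using Inp.prems(3-6) tr by auto
    have "scomp V l (Inp c y P) \<Phi> S tr r \<Phi>' S'"
      unfolding scomp_Inp using False tr x * Inp.prems(6) by auto
    moreover have "\<forall>z \<in> V. \<rho>' z = \<rho> z"
      using V x by auto
    ultimately show ?thesis using ** by blast
  qed
qed

end

section \<open>Traces of blocks\<close>

text \<open>The empty multiset left by an improper block becomes the state that is
  \<open>Null\<close> on every channel.\<close>

definition next_state :: "('c \<Rightarrow> ('f, 'n, 'x, 'c) proc) \<Rightarrow> 'c \<Rightarrow> ('f, 'n, 'x, 'c) proc option \<Rightarrow>
    'c \<Rightarrow> ('f, 'n, 'x, 'c) proc" where
  "next_state f c r = (case r of Some Q \<Rightarrow> f(c := Q) | None \<Rightarrow> (\<lambda>_. Null))"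

lemma next_state_simps [simp]:
  "next_state f c (Some Q) = f(c := Q)" "next_state f c None = (\<lambda>_. Null)"
  by (simp_all add: next_state_def)

definition all_handles :: "('c, 'r, 'w) block list \<Rightarrow> 'w set" where
  "all_handles bs = (\<Union>b \<in> set bs. set (handles b))"

definition block_recipes :: "('c, 'r, 'w) block list \<Rightarrow> 'r list" where
  "block_recipes bs = concat (map (\<lambda>(c, Rs, ws). Rs) bs)"

definition flat :: "('c, 'r, 'w) block list \<Rightarrow> ('c, 'r, 'w) action list" where
  "flat bs = concat (map (\<lambda>(c, Rs, ws). io c Rs ws) bs)"

lemma all_handles_simps [simp]:
  "all_handles [] = {}"
  "all_handles (b # bs) = set (handles b) \<union> all_handles bs"
  "all_handles (as @ bs) = all_handles as \<union> all_handles bs"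
  by (auto simp: all_handles_def)

lemma block_recipes_simps [simp]:
  "block_recipes [] = []"
  "block_recipes ((c, Rs, ws) # bs) = Rs @ block_recipes bs"
  "block_recipes (as @ bs) = block_recipes as @ block_recipes bs"
  by (auto simp: block_recipes_def)

lemma flat_simps [simp]: "flat [] = []" "flat ((c, Rs, ws) # bs) = io c Rs ws @ flat bs"
  by (auto simp: flat_def)

section \<open>Unique parsing of action sequences into blocks\<close>

fun good :: "('c, 'r, 'w) block list \<Rightarrow> bool" where
  "good [] \<longleftrightarrow> True"
| "good ((c, Rs, ws) # bs) \<longleftrightarrow> Rs \<noteq> [] \<and> (ws = [] \<longrightarrow> bs = []) \<and> good bs"

fun is_AIn :: "('c, 'r, 'w) action \<Rightarrow> bool" where
  "is_AIn (AIn c R) = True"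
| "is_AIn _ = False"

lemma takeWhile_ins:
  assumes "xs = [] \<or> \<not> is_AIn (hd xs)"
  shows "takeWhile is_AIn (map (AIn c) Rs @ xs) = map (AIn c) Rs"
  using assms by (cases xs) (auto simp: takeWhile_append)

lemma takeWhile_outs:
  assumes "xs = [] \<or> is_AIn (hd xs)"
  shows "takeWhile (\<lambda>a. \<not> is_AIn a) (map (AOut c) ws @ xs) = map (AOut c) ws"
  using assms by (cases xs) (auto simp: takeWhile_append)

lemma good_flat_hd: "good bs \<Longrightarrow> flat bs = [] \<or> is_AIn (hd (flat bs))"
  by (cases bs rule: good.cases) (auto simp: io_def hd_append hd_map)

text \<open>The first block consists of the maximal prefix of inputs and the maximal run of outputs
  after it: its outputs separate it from a next block, and its nonempty input list reveals the
  channel.\<close>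

lemma flat_inject: "good bs \<Longrightarrow> good bs' \<Longrightarrow> flat bs = flat bs' \<Longrightarrow> bs = bs'"
proof (induction bs arbitrary: bs' rule: good.induct)
  case 1
  then show ?case by (cases bs' rule: good.cases) (auto simp: io_def)
next
  case (2 c Rs ws bs)
  then obtain c' Rs' ws' bs1 where bs': "bs' = (c', Rs', ws') # bs1"
    by (cases bs' rule: good.cases) (auto simp: io_def)
  note good1 = 2(2)
  note good2 = 2(3)[unfolded bs']
  have eq: "map (AIn c) Rs @ (map (AOut c) ws @ flat bs)
      = map (AIn c') Rs' @ (map (AOut c') ws' @ flat bs1)"
    using 2(4) by (simp add: bs' io_def)
  have outs1: "map (AOut c) ws @ flat bs = [] \<or> \<not> is_AIn (hd (map (AOut c) ws @ flat bs))"
    using good1 by (cases ws) auto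
  have outs2: "map (AOut c') ws' @ flat bs1 = [] \<or> \<not> is_AIn (hd (map (AOut c') ws' @ flat bs1))"
    using good2 by (cases ws') auto
  have ins: "map (AIn c) Rs = (map (AIn c') Rs' :: ('a, 'b, 'c) action list)"
    using arg_cong[OF eq, of "takeWhile is_AIn"]
    by (simp only: takeWhile_ins[OF outs1] takeWhile_ins[OF outs2])
  with good1 good2 have c: "c' = c" by (cases Rs; cases Rs') auto
  with ins have Rs: "Rs' = Rs" by (auto dest: map_injective simp: inj_def)
  from eq have eq2: "map (AOut c) ws @ flat bs = map (AOut c) ws' @ flat bs1"
    by (simp add: c Rs)
  have "map (AOut c) ws = (map (AOut c) ws' :: ('a, 'b, 'c) action list)"
    using arg_cong[OF eq2, of "takeWhile (\<lambda>a. \<not> is_AIn a)"] good1 good2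
    by (simp add: takeWhile_outs good_flat_hd)
  then have ws: "ws' = ws" by (auto dest: map_injective simp: inj_def)
  with eq2 have "flat bs = flat bs1" by simp
  with 2(1)[of bs1] good1 good2 show ?case by (simp add: bs' c Rs ws)
qed

text \<open>Storing processes in a function on channels turns commutation of steps on different
  channels into commutation of function updates. Absent channels carry \<open>Null\<close>, which
  the multiset omits.\<close>

definition rep :: "('f, 'n, 'x, 'c) proc multiset \<Rightarrow> ('c \<Rightarrow> ('f, 'n, 'x, 'c) proc) \<Rightarrow> bool" where
  "rep \<P> f \<longleftrightarrow> finite {c. f c \<noteq> Null} \<and> \<P> = image_mset f (mset_set {c. f c \<noteq> Null}) \<and>
    (\<forall>c. on_channel c (f c))"

lemma rep_on_channel: "rep \<P> f \<Longrightarrow> on_channel c (f c)"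
  by (simp add: rep_def)

lemma rep_empty: "rep {#} (\<lambda>_. Null)"
  by (simp add: rep_def)

lemma rep_upd:
  fixes f :: "'c \<Rightarrow> ('f, 'n, 'x, 'c) proc"
  assumes "rep \<P> f" "f d \<noteq> Null"
  obtains \<P>0 where "\<P> = add_mset (f d) \<P>0" "set_mset \<P>0 = f ` ({c. f c \<noteq> Null} - {d})"
    "\<And>Q. on_channel d Q \<Longrightarrow> rep (add_proc Q \<P>0) (f(d := Q))"
proof
  let ?A = "{c. f c \<noteq> Null} - {d}"
  let ?\<P>0 = "image_mset f (mset_set ?A)"
  have fin: "finite {c. f c \<noteq> Null}" using assms(1) by (simp add: rep_def)
  have A: "{c. f c \<noteq> Null} = insert d ?A" using assms(2) by auto
  have "mset_set {c. f c \<noteq> Null} = add_mset d (mset_set ?A)"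
    using fin by (subst A, subst mset_set.insert) auto
  then show "\<P> = add_mset (f d) ?\<P>0" using assms(1) by (simp add: rep_def)
  show "set_mset ?\<P>0 = f ` ?A" using fin by simp
  fix Q :: "('f, 'n, 'x, 'c) proc" assume Q: "on_channel d Q"
  have img: "image_mset (f(d := Q)) (mset_set ?A) = ?\<P>0"
    by (rule image_mset_cong) (use fin in auto)
  show "rep (add_proc Q ?\<P>0) (f(d := Q))"
  proof (cases "Q = Null")
    case True
    then have "{c. (f(d := Q)) c \<noteq> Null} = ?A" by auto
    with True Q assms(1) fin img show ?thesis by (auto simp: rep_def add_proc_def)
  next
    case False
    then have B: "{c. (f(d := Q)) c \<noteq> Null} = insert d ?A" by auto
    have "mset_set (insert d ?A) = add_mset d (mset_set ?A)"
      using fin by (subst mset_set.insert) auto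
    with B False Q assms(1) fin img show ?thesis unfolding rep_def add_proc_def B by auto
  qed
qed

lemma rep_pick:
  assumes "rep (add_mset Q \<P>) f"
  obtains d where "f d = Q" "Q \<noteq> Null" "set_mset \<P> = f ` ({c. f c \<noteq> Null} - {d})"
    "\<And>Q'. on_channel d Q' \<Longrightarrow> rep (add_proc Q' \<P>) (f(d := Q'))"
proof -
  have "Q \<in># image_mset f (mset_set {c. f c \<noteq> Null})"
    using assms unfolding rep_def by (metis union_single_eq_member)
  then obtain d where d: "f d = Q" "Q \<noteq> Null"
    using assms by (auto simp: rep_def)
  with rep_upd[OF assms, of d] obtain \<P>0 where "add_mset Q \<P> = add_mset Q \<P>0"
    "set_mset \<P>0 = f ` ({c. f c \<noteq> Null} - {d})"
    "\<And>Q. on_channel d Q \<Longrightarrow> rep (add_proc Q \<P>0) (f(d := Q))" by metis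
  with d that show ?thesis by simp
qed

lemma rep_exists:
  assumes "simple_proc ar \<P>"
  obtains f where "rep \<P> f" "\<And>c. free_vars (f c) = {}"
proof -
  from assms obtain Ps cs where Ps: "\<P> = mset Ps" "distinct cs" "list_all2 on_channel cs Ps"
    and proc: "\<forall>P \<in> set Ps. P \<noteq> Null \<and> free_vars P = {}"
    by (auto simp: simple_proc_def)
  define f where "f c = (case map_of (zip cs Ps) c of None \<Rightarrow> Null | Some P \<Rightarrow> P)" for c
  have len: "length cs = length Ps" using Ps(3) by (rule list_all2_lengthD)
  have f: "f (cs ! i) = Ps ! i" if "i < length cs" for i
    using map_of_zip_nth[OF len Ps(2)] that len by (simp add: f_def)
  have notin: "f c = Null" if "c \<notin> set cs" for c
    using that map_of_zip_is_None[OF len, of c] by (simp add: f_def)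
  have inn: "f c \<noteq> Null \<and> on_channel c (f c) \<and> free_vars (f c) = {}" if "c \<in> set cs" for c
  proof -
    from that obtain i where i: "i < length cs" "c = cs ! i" by (auto simp: in_set_conv_nth)
    with len have "Ps ! i \<in> set Ps" by simp
    with i f proc Ps(3) show ?thesis by (simp add: list_all2_conv_all_nth)
  qed
  have supp: "{c. f c \<noteq> Null} = set cs" using notin inn by blast
  have "map f cs = Ps"
    using f len by (auto intro: nth_equalityI)
  then have "image_mset f (mset_set (set cs)) = mset Ps"
    using Ps(2) by (simp add: mset_set_set flip: mset_map)
  moreover have "on_channel c (f c)" "free_vars (f c) = {}" for c
    using notin[of c] inn[of c] by (cases "c \<in> set cs"; simp)+
  ultimately show ?thesis
    using supp Ps(1) by (intro that[of f]) (simp_all add: rep_def)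
qed

context term_model
begin

lemma ccomp_ins_recipes:
  "ccomp l P \<Phi> tr r \<Phi>' \<Longrightarrow> R \<in> ins tr \<Longrightarrow> R \<in> recipes ar (dom \<Phi>) \<and> valid (app_frame \<Phi> R)"
proof (induction P arbitrary: l \<Phi> tr r \<Phi>' rule: proc_subst_induct)
  case Null
  then show ?case by (simp add: ccomp_Null)
next
  case (Cond u v P Q)
  show ?case
    by (cases rule: ccomp_CondE[OF Cond.prems(1)]) (rule Cond.IH[OF _ Cond.prems(2)], assumption)+
next
  case (Inp c x P)
  from Inp.prems(2) have "tr \<noteq> []" by auto
  with Inp.prems(1) obtain R' u tr' where *: "tr = AIn c R' # tr'" "R' \<in> recipes ar (dom \<Phi>)" "valid (app_frame \<Phi> R')"
    "ccomp IStar (subst_proc x u P) \<Phi> tr' r \<Phi>'" by (auto simp: ccomp_Inp)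
  with Inp.IH[OF *(4)] Inp.prems(2) show ?case by auto
next
  case (Outp c u P)
  from Outp.prems(2) have "tr \<noteq> []" by auto
  with Outp.prems(1) obtain w tr' where *: "tr = AOut c w # tr'"
    "ccomp OStar P (\<Phi>(w \<mapsto> u)) tr' r \<Phi>'" by (auto simp: ccomp_Outp split: if_splits)
  with ccomp_ins_outs[OF *(2)] Outp.prems(2) show ?case by simp
qed

lemma not_ccomp_IPlus_Null: "\<not> ccomp IPlus Null \<Phi> tr r \<Phi>'"
  by (simp add: ccomp_Null)

lemma ccomp_block:
  assumes "ccomp IPlus P \<Phi> (io c Rs ws) r \<Phi>'"
  shows "Rs \<noteq> []" "r = None \<longleftrightarrow> ws = []" "\<Phi> \<subseteq>\<^sub>m \<Phi>'" "dom \<Phi>' = dom \<Phi> \<union> set ws" "dom \<Phi> \<inter> set ws = {}"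
    "\<forall>R \<in> set Rs. R \<in> recipes ar (dom \<Phi>)" "\<forall>R \<in> set Rs. valid (app_frame \<Phi> R)"
  using ccomp_ins_outs[OF assms] ccomp_frame[OF assms] ccomp_ins_recipes[OF assms] by simp_all

text \<open>\<open>on_channel\<close> alone does not determine the channel: a conditional with null
  branches lies on all of them. The first input of the block does.\<close>

lemma ccomp_block_channel:
  assumes "ccomp IPlus P \<Phi> (io c Rs ws) r \<Phi>'" "on_channel d P"
  shows "c = d" "\<And>Q. r = Some Q \<Longrightarrow> on_channel d Q"
proof -
  from ccomp_channel[OF assms] obtain Rs' ws' where eq: "io c Rs ws = io d Rs' ws'" by blast
  have "Rs' = Rs" using arg_cong[OF eq, of inl] by simp
  with ccomp_block(1)[OF assms(1)] eq show "c = d" by (cases Rs) (auto simp: io_def)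
  show "on_channel d Q" if "r = Some Q" for Q
    using ccomp_channel[OF assms] that by blast
qed

text \<open>Compressed runs on channel-indexed states. The channel of a block selects the process
  that moves, so the label determines the step up to \<open>peq\<close> and
  \<open>feq\<close>.\<close>

fun btrace ::
  "('c \<Rightarrow> ('f, 'n, 'x, 'c) proc) \<Rightarrow> ('f, 'n, 'x, 'w) frame \<Rightarrow>
   ('c, ('f, 'n, 'w) trm, 'w) block list \<Rightarrow>
   ('c \<Rightarrow> ('f, 'n, 'x, 'c) proc) \<Rightarrow> ('f, 'n, 'x, 'w) frame \<Rightarrow> bool" where
  "btrace f \<Phi> [] f' \<Phi>' \<longleftrightarrow> f' = f \<and> \<Phi>' = \<Phi>"
| "btrace f \<Phi> ((c, Rs, ws) # bs) f' \<Phi>' \<longleftrightarrow>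
    (\<exists>r \<Phi>1. ccomp IPlus (f c) \<Phi> (io c Rs ws) r \<Phi>1 \<and> btrace (next_state f c r) \<Phi>1 bs f' \<Phi>')"

lemma btrace_append:
  "btrace f \<Phi> (as @ bs) f' \<Phi>' \<longleftrightarrow> (\<exists>g \<Psi>. btrace f \<Phi> as g \<Psi> \<and> btrace g \<Psi> bs f' \<Phi>')"
  by (induction f \<Phi> as f' \<Phi>' rule: btrace.induct) (simp, simp only: append_Cons btrace.simps, blast)

lemma btrace_Null: "btrace (\<lambda>_. Null) \<Phi> bs f' \<Phi>' \<Longrightarrow> bs = [] \<and> f' = (\<lambda>_. Null) \<and> \<Phi>' = \<Phi>"
  by (cases bs) (auto simp: not_ccomp_IPlus_Null)

lemma btrace_good: "btrace f \<Phi> bs f' \<Phi>' \<Longrightarrow> good bs"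
proof (induction f \<Phi> bs f' \<Phi>' rule: btrace.induct)
  case (2 f \<Phi> c Rs ws bs f' \<Phi>')
  then obtain r \<Phi>1 where *: "ccomp IPlus (f c) \<Phi> (io c Rs ws) r \<Phi>1"
    "btrace (next_state f c r) \<Phi>1 bs f' \<Phi>'" by auto
  with 2(1) have "good bs" by blast
  moreover have "bs = []" if "ws = []"
    using ccomp_block(2)[OF *(1)] *(2) that by (auto dest: btrace_Null)
  ultimately show ?case using ccomp_block(1)[OF *(1)] by simp
qed simp

lemma btrace_frame:
  "btrace f \<Phi> bs f' \<Phi>' \<Longrightarrow>
    \<Phi> \<subseteq>\<^sub>m \<Phi>' \<and> dom \<Phi>' = dom \<Phi> \<union> all_handles bs \<and> dom \<Phi> \<inter> all_handles bs = {}"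
proof (induction f \<Phi> bs f' \<Phi>' rule: btrace.induct)
  case (2 f \<Phi> c Rs ws bs f' \<Phi>')
  then obtain r \<Phi>1 where *: "ccomp IPlus (f c) \<Phi> (io c Rs ws) r \<Phi>1"
    "btrace (next_state f c r) \<Phi>1 bs f' \<Phi>'" by auto
  note IH = 2(1)[OF *(2)] and b = ccomp_block(3-5)[OF *(1)]
  from IH b(1) have "\<Phi> \<subseteq>\<^sub>m \<Phi>'" by (blast intro: map_le_trans)
  with IH b(2,3) show ?case by auto
qed simp

text \<open>Validity is stated in the final frame, where dependency constraints are evaluated; it
  agrees there with the frame at the time of the input.\<close>

lemma btrace_recipes:
  assumes "btrace f \<Phi> (as @ (c, Rs, ws) # bs) f' \<Phi>'" "R \<in> set Rs"
  shows "R \<in> recipes ar (dom \<Phi> \<union> all_handles as)" "valid (app_frame \<Phi>' R)"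
proof -
  from assms(1) obtain g \<Psi> r \<Psi>1 where *: "btrace f \<Phi> as g \<Psi>" "ccomp IPlus (g c) \<Psi> (io c Rs ws) r \<Psi>1"
    "btrace (next_state g c r) \<Psi>1 bs f' \<Phi>'" by (auto simp: btrace_append)
  have dom: "dom \<Psi> = dom \<Phi> \<union> all_handles as" using btrace_frame[OF *(1)] by blast
  have le: "\<Psi> \<subseteq>\<^sub>m \<Phi>'"
    using ccomp_block(3)[OF *(2)] btrace_frame[OF *(3)] by (blast intro: map_le_trans)
  have R: "R \<in> recipes ar (dom \<Psi>)" "valid (app_frame \<Psi> R)"
    using ccomp_block(6,7)[OF *(2)] assms(2) by simp_all
  then show "R \<in> recipes ar (dom \<Phi> \<union> all_handles as)" "valid (app_frame \<Phi>' R)"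
    by (simp_all add: app_frame_map_le[OF R(1) le] dom)
qed

text \<open>Blocks with an output are proper and change only their own channel; an improper one
  would reset all channels.\<close>

lemma btrace_other_channel:
  "btrace f \<Phi> bs f' \<Phi>' \<Longrightarrow> c \<notin> chan ` set bs \<Longrightarrow> \<forall>b \<in> set bs. handles b \<noteq> [] \<Longrightarrow> f' c = f c"
proof (induction f \<Phi> bs f' \<Phi>' rule: btrace.induct)
  case (2 f \<Phi> d Rs ws bs f' \<Phi>')
  then obtain r \<Phi>1 where *: "ccomp IPlus (f d) \<Phi> (io d Rs ws) r \<Phi>1"
    "btrace (next_state f d r) \<Phi>1 bs f' \<Phi>'" by auto
  from ccomp_block(2)[OF *(1)] 2(4) obtain Q where "r = Some Q" by auto
  with 2(1)[OF *(2)] 2(3,4) show ?case by simp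
qed simp

lemma btrace_determ:
  "btrace f \<Phi> bs f' \<Phi>' \<Longrightarrow> \<forall>c. peq (f c) (g c) \<Longrightarrow> feq \<Phi> \<Psi> \<Longrightarrow> btrace g \<Psi> bs g' \<Psi>' \<Longrightarrow>
    (\<forall>c. peq (f' c) (g' c)) \<and> feq \<Phi>' \<Psi>'"
proof (induction f \<Phi> bs f' \<Phi>' arbitrary: g \<Psi> rule: btrace.induct)
  case (2 f \<Phi> c Rs ws bs f' \<Phi>')
  from 2(2) obtain r \<Phi>1 where *: "ccomp IPlus (f c) \<Phi> (io c Rs ws) r \<Phi>1"
    "btrace (next_state f c r) \<Phi>1 bs f' \<Phi>'" by auto
  from 2(5) obtain s \<Psi>1 where **: "ccomp IPlus (g c) \<Psi> (io c Rs ws) s \<Psi>1"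
    "btrace (next_state g c s) \<Psi>1 bs g' \<Psi>'" by auto
  have rs: "rel_option peq r s" and "feq \<Phi>1 \<Psi>1"
    using ccomp_determ[OF *(1) _ 2(4) **(1)] 2(3) by blast+
  moreover have "\<forall>d. peq (next_state f c r d) (next_state g c s d)"
    using rs 2(3) by (cases rule: option.rel_cases) (auto simp: peq_Null)
  ultimately show ?case
    using 2(1)[OF *(2) _ _ **(2)] by blast
qed simp

text \<open>By hypothesis the later block does not read what the earlier one writes, and the earlier
  one cannot read \<open>ws'\<close>, which is still fresh after it. The later block needs an
  output, as otherwise it would kill the process on \<open>c\<close>; the earlier block has one
  because it is not the last.\<close>

lemma btrace_swap:
  assumes tr: "btrace f \<Phi> ((c, Rs, ws) # (d, Rs', ws') # bs) f' \<Phi>'"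
    and "c \<noteq> d" "ws' \<noteq> []" "\<forall>R \<in> set Rs'. vars R \<inter> set ws = {}"
  shows "btrace f \<Phi> ((d, Rs', ws') # (c, Rs, ws) # bs) f' \<Phi>'"
proof -
  from tr have "ws \<noteq> []" using btrace_good[OF tr] by simp
  from tr obtain r \<Phi>1 r' \<Phi>2 where *: "ccomp IPlus (f c) \<Phi> (io c Rs ws) r \<Phi>1"
    "ccomp IPlus (next_state f c r d) \<Phi>1 (io d Rs' ws') r' \<Phi>2"
    "btrace (next_state (next_state f c r) d r') \<Phi>2 bs f' \<Phi>'" by auto
  note b1 = ccomp_block[OF *(1)] and b2 = ccomp_block[OF *(2)]
  from b1(2) b2(2) \<open>ws \<noteq> []\<close> \<open>ws' \<noteq> []\<close> obtain Q Q' where r: "r = Some Q" "r' = Some Q'" by auto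
  \<comment> \<open>The frame after the second block when it goes first: \<open>\<Phi>\<close> with
    the entries for \<open>ws'\<close> taken from \<open>\<Phi>2\<close>.\<close>
  let ?\<Psi> = "\<Phi> ++ \<Phi>2 |` set ws'"
  have "\<Phi> w = \<Phi>1 w" if "w \<notin> set ws" for w
  proof (cases "w \<in> dom \<Phi>")
    case True
    with b1(3) show ?thesis by (simp add: map_le_def)
  next
    case False
    with b1(4) that show ?thesis by (metis UnE domIff)
  qed
  then have "ccomp IPlus (f d) \<Phi> (io d Rs' ws') r' ?\<Psi>"
    using ccomp_change_frame[OF *(2), of \<Phi>] assms(2,4) b1(4) b2(5) r(1) by (auto simp: disjoint_iff)
  moreover have "ccomp IPlus (f c) ?\<Psi> (io c Rs ws) r (?\<Psi> ++ \<Phi>1 |` set ws)"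
  proof -
    have "?\<Psi> w = \<Phi> w" if "R \<in> set Rs" "w \<in> vars R" for R w
    proof -
      have "w \<in> dom \<Phi>" using b1(6) that by (auto simp: recipes_def)
      then have "w \<notin> set ws'" using b1(4) b2(5) by blast
      then show ?thesis by (simp add: map_add_def restrict_map_def)
    qed
    moreover have "dom ?\<Psi> \<inter> set ws = {}"
      using b1(4,5) b2(5) by auto
    ultimately show ?thesis
      using ccomp_change_frame[OF *(1), of ?\<Psi>] by auto
  qed
  moreover have "?\<Psi> ++ \<Phi>1 |` set ws = \<Phi>2"
  proof
    fix w
    consider "w \<in> set ws" | "w \<in> set ws'" "w \<notin> set ws" | "w \<in> dom \<Phi>" "w \<notin> set ws" "w \<notin> set ws'"
      | "w \<notin> dom \<Phi> \<union> set ws \<union> set ws'" by blast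
    then show "(?\<Psi> ++ \<Phi>1 |` set ws) w = \<Phi>2 w"
    proof cases
      case 1
      then have w: "w \<in> dom \<Phi>1" using b1(4) by blast
      then have "\<Phi>1 w = \<Phi>2 w" using b2(3) by (simp add: map_le_def)
      with 1 w show ?thesis by (auto simp: map_add_def restrict_map_def split: option.split)
    next
      case 2
      then have "w \<in> dom \<Phi>2" using b2(4) by blast
      with 2 show ?thesis by (auto simp: map_add_def restrict_map_def split: option.split)
    next
      case 3
      then have "\<Phi> w = \<Phi>1 w" "\<Phi>1 w = \<Phi>2 w" using b1(3,4) b2(3) by (auto simp: map_le_def)
      with 3 show ?thesis by (simp add: map_add_def restrict_map_def)
    next
      case 4
      then have "w \<notin> dom \<Phi>2" using b1(4) b2(4) by blast
      with 4 show ?thesis by (auto simp: map_add_def restrict_map_def domIff)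
    qed
  qed
  ultimately have "ccomp IPlus (f d) \<Phi> (io d Rs' ws') (Some Q') ?\<Psi>"
    "ccomp IPlus (next_state f d (Some Q') c) ?\<Psi> (io c Rs ws) (Some Q) \<Phi>2"
    using assms(2) r by simp_all
  moreover have "btrace (next_state (next_state f d (Some Q')) c (Some Q)) \<Phi>2 bs f' \<Phi>'"
    using *(3) unfolding r next_state_simps fun_upd_twist[OF assms(2)] .
  ultimately show ?thesis unfolding btrace.simps by blast
qed

text \<open>Only the moved block can depend on those it crosses, since they were performed before
  \<open>ws\<close> existed.\<close>

lemma btrace_move_front:
  "btrace f \<Phi> (as @ (d, Rs, ws) # bs) f' \<Phi>' \<Longrightarrow> d \<notin> chan ` set as \<Longrightarrow> ws \<noteq> [] \<Longrightarrow>
    \<forall>R \<in> set Rs. vars R \<inter> all_handles as = {} \<Longrightarrow> btrace f \<Phi> ((d, Rs, ws) # as @ bs) f' \<Phi>'"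
proof (induction as arbitrary: f \<Phi>)
  case (Cons a as)
  obtain c Rs' ws' where a: "a = (c, Rs', ws')" by (cases a)
  from Cons.prems(1) obtain r \<Phi>1 where *: "ccomp IPlus (f c) \<Phi> (io c Rs' ws') r \<Phi>1"
    "btrace (next_state f c r) \<Phi>1 (as @ (d, Rs, ws) # bs) f' \<Phi>'" by (auto simp: a)
  have "\<forall>R \<in> set Rs. vars R \<inter> all_handles as = {}"
    using Cons.prems(4) by auto
  with *(2) Cons have "btrace (next_state f c r) \<Phi>1 ((d, Rs, ws) # as @ bs) f' \<Phi>'" by simp
  with *(1) have "btrace f \<Phi> ((c, Rs', ws') # (d, Rs, ws) # as @ bs) f' \<Phi>'"
    by (simp only: btrace.simps(2)[of f \<Phi> c]) blast
  then have "btrace f \<Phi> ((d, Rs, ws) # (c, Rs', ws') # as @ bs) f' \<Phi>'"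
    by (rule btrace_swap) (use Cons.prems in \<open>auto simp: a\<close>)
  then show ?case by (simp add: a)
qed simp

text \<open>Here the dependency runs the other way: the crossed blocks come after \<open>ws\<close>
  and might read it. Each of them needs an output, being the block that moves forward in
  \<open>btrace_swap\<close>.\<close>

lemma btrace_move_back:
  "btrace f \<Phi> ((d, Rs, ws) # as @ bs) f' \<Phi>' \<Longrightarrow> d \<notin> chan ` set as \<Longrightarrow> \<forall>a \<in> set as. handles a \<noteq> [] \<Longrightarrow>
    \<forall>R \<in> set (block_recipes as). vars R \<inter> set ws = {} \<Longrightarrow> btrace f \<Phi> (as @ (d, Rs, ws) # bs) f' \<Phi>'"
proof (induction as arbitrary: f \<Phi>)
  case (Cons a as)
  obtain c Rs' ws' where a: "a = (c, Rs', ws')" by (cases a)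
  have "btrace f \<Phi> ((c, Rs', ws') # (d, Rs, ws) # as @ bs) f' \<Phi>'"
    using Cons.prems(1) unfolding a append_Cons
    by (rule btrace_swap) (use Cons.prems in \<open>auto simp: a\<close>)
  then obtain r \<Phi>1 where *: "ccomp IPlus (f c) \<Phi> (io c Rs' ws') r \<Phi>1"
    "btrace (next_state f c r) \<Phi>1 ((d, Rs, ws) # as @ bs) f' \<Phi>'"
    by (simp only: btrace.simps(2)[of f \<Phi> c]) blast
  have "btrace (next_state f c r) \<Phi>1 (as @ (d, Rs, ws) # bs) f' \<Phi>'"
    using *(2) by (rule Cons.IH) (use Cons.prems in \<open>auto simp: a\<close>)
  with *(1) show ?case by (auto simp: a)
qed simp

text \<open>The final frame extends the frame before the block, so both evaluate recipes over
  \<open>dom \<Phi> \<union> all_handles as\<close> alike. This allows equality to be tested in the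
  final frame, and the rest of the run stays as it is.\<close>

lemma btrace_change_recipes:
  assumes "btrace f \<Phi> (as @ (c, Rs, ws) # bs) f' \<Phi>'"
    and "list_all2 (\<lambda>R R'. R' \<in> recipes ar (dom \<Phi> \<union> all_handles as) \<and> valid (app_frame \<Phi>' R') \<and>
      app_frame \<Phi>' R' =\<^sub>E app_frame \<Phi>' R) Rs Rs'"
  shows "btrace f \<Phi> (as @ (c, Rs', ws) # bs) f' \<Phi>'"
proof -
  from assms(1) obtain g \<Psi> r \<Psi>1 where *: "btrace f \<Phi> as g \<Psi>" "ccomp IPlus (g c) \<Psi> (io c Rs ws) r \<Psi>1"
    "btrace (next_state g c r) \<Psi>1 bs f' \<Phi>'" by (auto simp: btrace_append)
  have dom: "dom \<Psi> = dom \<Phi> \<union> all_handles as" using btrace_frame[OF *(1)] by blast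
  have le: "\<Psi> \<subseteq>\<^sub>m \<Phi>'"
    using ccomp_block(3)[OF *(2)] btrace_frame[OF *(3)] by (blast intro: map_le_trans)
  have rec: "recipe_eq \<Psi> R R'" if "R \<in> set Rs" "R' \<in> recipes ar (dom \<Phi> \<union> all_handles as)"
    "valid (app_frame \<Phi>' R')" "app_frame \<Phi>' R' =\<^sub>E app_frame \<Phi>' R" for R R'
  proof -
    have "R \<in> recipes ar (dom \<Psi>)" "R' \<in> recipes ar (dom \<Psi>)"
      using ccomp_block(6)[OF *(2)] that(1,2) dom by simp_all
    with that(3,4) show ?thesis
      using app_frame_map_le[OF _ le, of R] app_frame_map_le[OF _ le, of R'] by (simp add: recipe_eq_def)
  qed
  have "list_all2 (recipe_eq \<Psi>) Rs Rs'"
    using assms(2) by (rule list.rel_mono_strong) (use rec in blast)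
  then have "list_all2 (rel_action (=) (recipe_eq \<Psi>) (=)) (io c Rs ws) (io c Rs' ws)"
    unfolding io_def by (auto intro!: list_all2_appendI simp: list.rel_map list_all2_same)
  from ccomp_change_recipes[OF *(2) map_le_refl this] *(1,3) show ?thesis
    by (auto simp: btrace_append)
qed

section \<open>Agreement of multiset and channel-indexed runs\<close>

lemma ctrace_btrace:
  "ctrace \<P> \<Phi> tr \<P>' \<Phi>' \<Longrightarrow> rep \<P> f \<Longrightarrow> \<exists>bs f'. btrace f \<Phi> bs f' \<Phi>' \<and> tr = flat bs"
proof (induction arbitrary: f rule: ctrace.induct)
  case (Empty \<P> \<Phi>)
  show ?case by (intro exI[of _ "[]"]) simp
next
  case (Proper Q \<Phi> tr Q' \<Phi>' \<P> tr' \<P>'' \<Phi>'')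
  from Proper.prems obtain d where d: "f d = Q"
    "\<And>Q'. on_channel d Q' \<Longrightarrow> rep (add_proc Q' \<P>) (f(d := Q'))" by (rule rep_pick) blast
  from ccomp_channel[OF Proper.hyps(1)] rep_on_channel[OF Proper.prems, of d] d(1)
  obtain Rs ws where tr: "tr = io d Rs ws" "on_channel d Q'" by blast
  from Proper.IH[OF d(2)[OF tr(2)]] obtain bs f' where
    "btrace (f(d := Q')) \<Phi>' bs f' \<Phi>''" "tr' = flat bs" by blast
  with Proper.hyps(1) d(1) tr(1) show ?case
    by (intro exI[of _ "(d, Rs, ws) # bs"] exI[of _ f']) (auto intro!: exI[of _ "Some Q'"])
next
  case (Improper Q \<Phi> tr \<Phi>' tr' \<P>'' \<Phi>'' \<P>)
  from Improper.prems obtain d where d: "f d = Q" by (rule rep_pick) blast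
  from ccomp_channel[OF Improper.hyps(1)] rep_on_channel[OF Improper.prems, of d] d(1)
  obtain Rs ws where tr: "tr = io d Rs ws" by blast
  from Improper.IH[OF rep_empty] obtain bs f' where
    "btrace (\<lambda>_. Null) \<Phi>' bs f' \<Phi>''" "tr' = flat bs" by blast
  with Improper.hyps(1) d(1) tr(1) show ?case
    by (intro exI[of _ "(d, Rs, ws) # bs"] exI[of _ f']) (auto intro!: exI[of _ None])
qed

lemma btrace_ctrace:
  "btrace f \<Phi> bs f' \<Phi>' \<Longrightarrow> rep \<P> f \<Longrightarrow> \<exists>\<P>'. ctrace \<P> \<Phi> (flat bs) \<P>' \<Phi>'"
proof (induction f \<Phi> bs f' \<Phi>' arbitrary: \<P> rule: btrace.induct)
  case (1 f \<Phi> f' \<Phi>')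
  then show ?case by (auto intro: ctrace.Empty)
next
  case (2 f \<Phi> c Rs ws bs f' \<Phi>')
  from 2(2) obtain r \<Phi>1 where *: "ccomp IPlus (f c) \<Phi> (io c Rs ws) r \<Phi>1"
    "btrace (next_state f c r) \<Phi>1 bs f' \<Phi>'" by auto
  then have "f c \<noteq> Null" using not_ccomp_IPlus_Null by metis
  with 2(3) obtain \<P>0 where P: "\<P> = add_mset (f c) \<P>0"
    "\<And>Q. on_channel c Q \<Longrightarrow> rep (add_proc Q \<P>0) (f(c := Q))" by (rule rep_upd) blast
  show ?case
  proof (cases r)
    case None
    with 2(1)[OF *(2)] rep_empty obtain \<P>' where "ctrace {#} \<Phi>1 (flat bs) \<P>' \<Phi>'" by auto
    with *(1) None show ?thesis unfolding P(1) flat_simps by (blast intro: ctrace.Improper)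
  next
    case (Some Q)
    with ccomp_channel[OF *(1) rep_on_channel[OF 2(3)]] have "on_channel c Q" by blast
    with P(2) Some have "rep (add_proc Q \<P>0) (next_state f c r)" by simp
    from 2(1)[OF *(2) this] obtain \<P>' where "ctrace (add_proc Q \<P>0) \<Phi>1 (flat bs) \<P>' \<Phi>'" ..
    with *(1) Some show ?thesis unfolding P(1) flat_simps by (blast intro: ctrace.Proper)
  qed
qed

end

section \<open>Reduced traces suffice\<close>

lemma good_handles: "good (as @ b # bs) \<Longrightarrow> a \<in> set as \<Longrightarrow> handles a \<noteq> []"
  by (induction as rule: good.induct) auto

lemma good_last: "good (as @ (c, Rs, []) # bs) \<Longrightarrow> bs = []"
  by (induction as rule: good.induct) auto

lemma lenlex_first_diff:
  "(x, y) \<in> r \<Longrightarrow> length xs = length ys \<Longrightarrow> (p @ x # xs, p @ y # ys) \<in> lenlex r"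
  by (induction p) (auto simp: lenlex_conv)

text \<open>A nonempty dependency set means that the block on \<open>c\<close> could stand in front
  of \<open>q0\<close>, the last block on a larger channel. All blocks crossed are on channels other
  than \<open>c\<close>, so the move is possible once the recipes avoid
  \<open>Dep as c\<close>.\<close>

lemma Dep_nonempty:
  assumes "Dep as c \<noteq> {}"
  obtains p q0 q where "as = p @ q0 # q" "c < chan q0" "\<forall>b \<in> set q. chan b < c"
    "all_handles (q0 # q) \<subseteq> Dep as c"
proof -
  from assms obtain k where k: "k < length as" "c < chan (as ! k)"
    "\<forall>i. k < i \<and> i < length as \<longrightarrow> chan (as ! i) < c" by (auto simp: Dep_def)
  have drop: "drop k as = as ! k # drop (Suc k) as" using k(1) by (simp add: Cons_nth_drop_Suc)
  show ?thesis
  proof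
    show "as = take k as @ as ! k # drop (Suc k) as"
      using k(1) by (rule id_take_nth_drop)
    show "\<forall>b \<in> set (drop (Suc k) as). chan b < c"
    proof
      fix b assume "b \<in> set (drop (Suc k) as)"
      then obtain i where "i < length as - Suc k" "b = as ! (Suc k + i)"
        by (auto simp: in_set_conv_nth)
      with k(3)[rule_format, of "Suc k + i"] show "chan b < c" by simp
    qed
    show "all_handles (as ! k # drop (Suc k) as) \<subseteq> Dep as c"
      using k unfolding drop[symmetric] all_handles_def Dep_def by blast
  qed (rule k(2))
qed

context term_model
begin

text \<open>The dependency constraints of a trace, stated for its recipes and the final frame
  without a constraint system; \<open>D \<union> all_handles as\<close> takes the place of
  \<open>ded_dom\<close>. In this form they can be compared between \<open>A\<close> and
  \<open>B\<close>.\<close>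

definition reduced ::
  "'w set \<Rightarrow> ('f, 'n, 'x, 'w) frame \<Rightarrow> ('c::linorder, ('f, 'n, 'w) trm, 'w) block list \<Rightarrow> bool" where
  "reduced D \<Phi> bs \<longleftrightarrow> (\<forall>as c Rs ws cs. bs = as @ (c, Rs, ws) # cs \<longrightarrow> Dep as c \<noteq> {} \<longrightarrow>
    (\<exists>R \<in> set Rs. \<forall>R' \<in> recipes ar (D \<union> all_handles as).
      app_frame \<Phi> R' =\<^sub>E app_frame \<Phi> R \<longrightarrow> valid (app_frame \<Phi> R') \<longrightarrow> vars R' \<inter> Dep as c \<noteq> {}))"

text \<open>The condition speaks only of validity and equality of recipes. Static equivalence
  preserves equality between recipes that are valid, and validity of \<open>R\<close> comes from the
  run.\<close>

lemma reduced_static_equiv: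
  assumes red: "reduced D \<Phi>' bs" and "btrace f \<Phi> bs f' \<Phi>'" "dom \<Phi> = D" and eq: "\<Phi>' \<sim>\<^sub>s \<Psi>"
  shows "reduced D \<Psi> bs"
  unfolding reduced_def
proof (intro allI impI)
  fix as c Rs ws cs
  assume bs: "bs = as @ (c, Rs, ws) # cs" and ne: "Dep as c \<noteq> {}"
  with red obtain R where R: "R \<in> set Rs" and *: "\<forall>R' \<in> recipes ar (D \<union> all_handles as).
      app_frame \<Phi>' R' =\<^sub>E app_frame \<Phi>' R \<longrightarrow> valid (app_frame \<Phi>' R') \<longrightarrow> vars R' \<inter> Dep as c \<noteq> {}"
    unfolding reduced_def by blast
  have dom: "D \<union> all_handles as \<subseteq> dom \<Phi>'"
    using btrace_frame[OF assms(2)] assms(3) by (auto simp: bs)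
  note Rr = btrace_recipes[OF assms(2)[unfolded bs] R]
  have R_dom: "R \<in> recipes ar (dom \<Phi>')"
    using Rr(1) dom by (auto simp: assms(3) intro: recipes_mono)
  then have R_valid: "valid (app_frame \<Psi> R)"
    using Rr(2) eq by (simp add: static_equiv_def)
  show "\<exists>R \<in> set Rs. \<forall>R' \<in> recipes ar (D \<union> all_handles as).
      app_frame \<Psi> R' =\<^sub>E app_frame \<Psi> R \<longrightarrow> valid (app_frame \<Psi> R') \<longrightarrow> vars R' \<inter> Dep as c \<noteq> {}"
  proof (intro bexI[OF _ R] ballI impI)
    fix R' assume R': "R' \<in> recipes ar (D \<union> all_handles as)"
      and "app_frame \<Psi> R' =\<^sub>E app_frame \<Psi> R" "valid (app_frame \<Psi> R')"
    moreover have "R' \<in> recipes ar (dom \<Phi>')" using R' dom by (rule recipes_mono)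
    ultimately have "app_frame \<Phi>' R' =\<^sub>E app_frame \<Phi>' R" "valid (app_frame \<Phi>' R')"
      using static_equiv_eqD[OF static_equiv_sym[OF eq], of R' R] R_dom R_valid static_equiv_dom[OF eq]
      by simp_all
    with * R' show "vars R' \<inter> Dep as c \<noteq> {}" by blast
  qed
qed

text \<open>A block without outputs kills all other processes, so it cannot be moved forward. The run
  of the other blocks and the run in which it comes early are combined by determinism.\<close>

lemma btrace_add_improper:
  assumes q: "btrace f \<Phi> (p @ q) g \<Phi>1" and b: "btrace f \<Phi> (p @ [(c, Rs, [])]) h \<Phi>2"
    and "\<forall>t \<in> ran \<Phi>. valid t" "c \<notin> chan ` set q" "\<forall>b \<in> set q. handles b \<noteq> []"
  shows "\<exists>g'. btrace f \<Phi> (p @ q @ [(c, Rs, [])]) g' \<Phi>1"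
proof -
  from q obtain gp \<Phi>p where gp: "btrace f \<Phi> p gp \<Phi>p" "btrace gp \<Phi>p q g \<Phi>1"
    by (auto simp: btrace_append)
  from b obtain hp \<Psi>p s where hp: "btrace f \<Phi> p hp \<Psi>p" "ccomp IPlus (hp c) \<Psi>p (io c Rs []) s \<Phi>2"
    by (auto simp: btrace_append)
  \<comment> \<open>The two given runs share the prefix \<open>p\<close> but may receive different
    terms in it.\<close>
  have "(\<forall>c. peq (hp c) (gp c)) \<and> feq \<Psi>p \<Phi>p"
    using btrace_determ[OF hp(1) _ feq_refl[OF assms(3)] gp(1)] peq_refl by blast
  then obtain s' \<Phi>3 where s': "ccomp IPlus (gp c) \<Phi>p (io c Rs []) s' \<Phi>3"
    using ccomp_simulate[OF hp(2)] by blast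
  have le: "\<Phi>p \<subseteq>\<^sub>m \<Phi>1" using btrace_frame[OF gp(2)] by blast
  have "\<Phi>1 w = \<Phi>p w" if "R \<in> set Rs" "w \<in> vars R" for R w
  proof -
    have "w \<in> dom \<Phi>p" using ccomp_block(6)[OF s'] that by (auto simp: recipes_def)
    with le show ?thesis by (simp add: map_le_def)
  qed
  then have "ccomp IPlus (gp c) \<Phi>1 (io c Rs []) s' \<Phi>1"
    using ccomp_change_frame[OF s', of \<Phi>1] by simp
  moreover have "g c = gp c"
    using gp(2) assms(4,5) by (rule btrace_other_channel)
  ultimately have "btrace g \<Phi>1 [(c, Rs, [])] (next_state g c s') \<Phi>1" by auto
  with q have "btrace f \<Phi> ((p @ q) @ [(c, Rs, [])]) (next_state g c s') \<Phi>1"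
    unfolding btrace_append[of _ _ "p @ q"] by blast
  then show ?thesis by auto
qed

text \<open>An improper block adds nothing to the frame, so the run without it ends in the same
  \<open>\<Phi>'\<close>. Its recipes avoid the outputs of \<open>q\<close>, and \<open>q\<close>
  leaves its process untouched, so it can also be performed right after \<open>p\<close>.\<close>

lemma btrace_drop_improper:
  assumes "btrace f \<Phi> (p @ q @ [(c, Rs, [])]) f' \<Phi>'"
    and "c \<notin> chan ` set q" "\<forall>b \<in> set q. handles b \<noteq> []" "\<forall>R \<in> set Rs. vars R \<inter> all_handles q = {}"
  shows "\<exists>g. btrace f \<Phi> (p @ q) g \<Phi>'" "\<exists>h \<Phi>2. btrace f \<Phi> (p @ [(c, Rs, [])]) h \<Phi>2"
proof -
  from assms(1) obtain gp \<Phi>p g \<Phi>q r where *: "btrace f \<Phi> p gp \<Phi>p" "btrace gp \<Phi>p q g \<Phi>q"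
    "ccomp IPlus (g c) \<Phi>q (io c Rs []) r \<Phi>'" by (auto simp: btrace_append)
  have "\<Phi>q = \<Phi>'"
    using ccomp_block(3,4)[OF *(3)] by (auto intro!: map_le_antisym simp: map_le_def)
  with * show "\<exists>g. btrace f \<Phi> (p @ q) g \<Phi>'" by (auto simp: btrace_append)
  have "\<Phi>p w = \<Phi>q w" if "R \<in> set Rs" "w \<in> vars R" for R w
  proof -
    have "w \<in> dom \<Phi>q" using ccomp_block(6)[OF *(3)] that by (auto simp: recipes_def)
    moreover have "w \<notin> all_handles q" using that assms(4) by blast
    ultimately show ?thesis using btrace_frame[OF *(2)] by (auto simp: map_le_def)
  qed
  then have "ccomp IPlus (g c) \<Phi>p (io c Rs []) r \<Phi>p"
    using ccomp_change_frame[OF *(3), of \<Phi>p] by simp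
  moreover have "g c = gp c"
    using *(2) assms(2,3) by (rule btrace_other_channel)
  ultimately have "btrace gp \<Phi>p [(c, Rs, [])] (next_state gp c r) \<Phi>p" by auto
  with *(1) show "\<exists>h \<Phi>2. btrace f \<Phi> (p @ [(c, Rs, [])]) h \<Phi>2"
    unfolding btrace_append by blast
qed

text \<open>\<open>lenlex\<close> compares lengths first, so it decreases both when blocks are
  dropped and when a block moves forward, which puts \<open>c\<close> at the position of the larger
  \<open>chan q0\<close>.\<close>

lemma reduced_suffices:
  fixes f g :: "'c::linorder \<Rightarrow> ('f, 'n, 'x, 'c) proc" and \<Phi> \<Psi> :: "('f, 'n, 'x, 'w) frame"
  assumes red: "\<And>bs f' \<Phi>'. btrace f \<Phi> bs f' \<Phi>' \<Longrightarrow> reduced (dom \<Phi>) \<Phi>' bs \<Longrightarrow>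
      \<exists>g' \<Psi>'. btrace g \<Psi> bs g' \<Psi>' \<and> \<Phi>' \<sim>\<^sub>s \<Psi>'"
    and valid: "\<forall>t \<in> ran \<Psi>. valid t" and tr: "btrace f \<Phi> bs f' \<Phi>'"
  shows "\<exists>g' \<Psi>'. btrace g \<Psi> bs g' \<Psi>' \<and> \<Phi>' \<sim>\<^sub>s \<Psi>'"
proof -
  \<comment> \<open>Matching the empty trace already forces equal initial domains, so the recipes
    available at a point of the trace are the same for \<open>A\<close> and
    \<open>B\<close>.\<close>
  have "reduced (dom \<Phi>) \<Phi> []" by (simp add: reduced_def)
  with red[of "[]" f \<Phi>] have dom: "dom \<Psi> = dom \<Phi>" by (auto dest: static_equiv_dom)
  \<comment> \<open>The order on channels need not be well-founded. Restricted to the finitely many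
    channels of the trace it is, and moving or dropping blocks introduces no new ones.\<close>
  define C where "C = chan ` set bs"
  define r where "r = {(x, y). x < y \<and> x \<in> C \<and> y \<in> C}"
  have "wf r"
  proof (rule finite_acyclic_wf)
    show "finite r"
      by (rule finite_subset[of _ "C \<times> C"]) (auto simp: r_def C_def)
    have "(x, y) \<in> r\<^sup>+ \<Longrightarrow> x < y" for x y
      by (induction rule: trancl_induct) (auto simp: r_def)
    then show "acyclic r" by (fastforce simp: acyclic_def)
  qed
  then have "wf (inv_image (lenlex r) (map chan))" by (intro wf_inv_image wf_lenlex)
  moreover have "chan ` set bs \<subseteq> C" by (simp add: C_def)
  ultimately show ?thesis using tr
  proof (induction "bs" arbitrary: f' \<Phi>' rule: wf_induct_rule)
    case (less xs)
    note chans = less.prems(1) and tr = less.prems(2)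
    have IH: "\<exists>g' \<Psi>'. btrace g \<Psi> ys g' \<Psi>' \<and> \<Phi>2 \<sim>\<^sub>s \<Psi>'"
      if "(map chan ys, map chan xs) \<in> lenlex r" "chan ` set ys \<subseteq> C" "btrace f \<Phi> ys f2 \<Phi>2"
      for ys f2 \<Phi>2
      using less.IH[of ys f2 \<Phi>2] that by (simp add: inv_image_def)
    show ?case
    proof (cases "reduced (dom \<Phi>) \<Phi>' xs")
      case True
      from red[OF tr this] show ?thesis .
    next
      case False
      from False[unfolded reduced_def not_all not_imp] obtain as c Rs ws cs
        where xs: "xs = as @ (c, Rs, ws) # cs" and "Dep as c \<noteq> {}"
        and viol: "\<not> (\<exists>R \<in> set Rs. \<forall>R' \<in> recipes ar (dom \<Phi> \<union> all_handles as).
          app_frame \<Phi>' R' =\<^sub>E app_frame \<Phi>' R \<longrightarrow> valid (app_frame \<Phi>' R') \<longrightarrow> vars R' \<inter> Dep as c \<noteq> {})"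
        by (elim exE conjE)
      from \<open>Dep as c \<noteq> {}\<close> obtain p q0 q1 where "as = p @ q0 # q1" and q0: "c < chan q0"
        and q1: "\<forall>b \<in> set q1. chan b < c" and Dep: "all_handles (q0 # q1) \<subseteq> Dep as c"
        by (rule Dep_nonempty)
      define q where "q = q0 # q1"
      have as: "as = p @ q" by (simp add: q_def \<open>as = p @ q0 # q1\<close>)
      have c: "c \<notin> chan ` set q" using q0 q1 by (auto simp: q_def)
      note good = btrace_good[OF tr, unfolded xs]
      have q_out: "\<forall>b \<in> set q. handles b \<noteq> []" using good_handles[OF good] by (auto simp: as)
      \<comment> \<open>A violation gives every input of the block, not just one, an equal valid
        recipe that avoids the dependency set; \<open>ch\<close> selects them.\<close>
      from viol have "\<forall>R \<in> set Rs. \<exists>R'. R' \<in> recipes ar (dom \<Phi> \<union> all_handles as) \<and>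
          app_frame \<Phi>' R' =\<^sub>E app_frame \<Phi>' R \<and> valid (app_frame \<Phi>' R') \<and> vars R' \<inter> Dep as c = {}"
        by blast
      from bchoice[OF this] obtain ch where ch: "\<forall>R \<in> set Rs. ch R \<in> recipes ar (dom \<Phi> \<union> all_handles as) \<and>
          app_frame \<Phi>' (ch R) =\<^sub>E app_frame \<Phi>' R \<and> valid (app_frame \<Phi>' (ch R)) \<and> vars (ch R) \<inter> Dep as c = {}" ..
      define Rs' where "Rs' = map ch Rs"
      have avoid: "\<forall>R \<in> set Rs'. vars R \<inter> all_handles q = {}"
        using ch Dep by (fastforce simp: Rs'_def q_def)
      have tr': "btrace f \<Phi> (as @ (c, Rs', ws) # cs) f' \<Phi>'"
        using tr unfolding xs
        by (rule btrace_change_recipes) (use ch in \<open>auto simp: Rs'_def list.rel_map list_all2_same\<close>)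
      \<comment> \<open>\<open>R\<close> and \<open>ch R\<close> are valid and equal in the final
        frame of \<open>A\<close>, and static equivalence carries this over to
        \<open>B\<close>.\<close>
      have restore: "\<exists>g'. btrace g \<Psi> xs g' \<Psi>'"
        if eq: "\<Phi>' \<sim>\<^sub>s \<Psi>'" and trg: "btrace g \<Psi> (as @ (c, Rs', ws) # cs) g' \<Psi>'" for g' \<Psi>'
      proof -
        have "R \<in> recipes ar (dom \<Phi> \<union> all_handles as) \<and> valid (app_frame \<Psi>' R) \<and>
          app_frame \<Psi>' R =\<^sub>E app_frame \<Psi>' (ch R)" if "R \<in> set Rs" for R
        proof -
          note R = btrace_recipes[OF tr[unfolded xs] that]
          have "dom \<Phi> \<union> all_handles as \<subseteq> dom \<Phi>'" using btrace_frame[OF tr] by (auto simp: xs)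
          from recipes_mono[OF _ this] have "R \<in> recipes ar (dom \<Phi>')" "ch R \<in> recipes ar (dom \<Phi>')"
            using R(1) ch that by blast+
          moreover have "app_frame \<Phi>' R =\<^sub>E app_frame \<Phi>' (ch R)" using ch that by (simp add: eqE_sym)
          ultimately show ?thesis
            using static_equiv_eqD[OF eq, of R "ch R"] R ch that by simp
        qed
        then have "btrace g \<Psi> (as @ (c, Rs, ws) # cs) g' \<Psi>'"
          using trg
          by (intro btrace_change_recipes[OF trg]) (auto simp: dom Rs'_def list.rel_map list_all2_same)
        then show ?thesis unfolding xs by blast
      qed
      show ?thesis
      proof (cases "ws = []")
        case False
        from tr' obtain h \<Theta> where h: "btrace f \<Phi> p h \<Theta>" "btrace h \<Theta> (q @ (c, Rs', ws) # cs) f' \<Phi>'"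
          unfolding as append_assoc btrace_append[of _ _ p] by blast
        have "btrace h \<Theta> ((c, Rs', ws) # q @ cs) f' \<Phi>'"
          using h(2) c False avoid by (rule btrace_move_front)
        with h(1) have moved: "btrace f \<Phi> (p @ (c, Rs', ws) # q @ cs) f' \<Phi>'"
          unfolding btrace_append by blast
        have "c \<in> chan ` set xs" "chan q0 \<in> chan ` set xs"
          by (force simp: xs as q_def)+
        from this[THEN subsetD[OF chans]] q0 have "(c, chan q0) \<in> r" by (simp add: r_def)
        then have "(map chan (p @ (c, Rs', ws) # q @ cs), map chan xs) \<in> lenlex r"
          by (simp add: xs as q_def lenlex_first_diff)
        from IH[OF this _ moved] chans obtain g' \<Psi>' where
          g': "btrace g \<Psi> (p @ (c, Rs', ws) # q @ cs) g' \<Psi>'" "\<Phi>' \<sim>\<^sub>s \<Psi>'"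
          by (auto simp: xs as)
        from g'(1) obtain h' \<Theta>' where h': "btrace g \<Psi> p h' \<Theta>'" "btrace h' \<Theta>' ((c, Rs', ws) # q @ cs) g' \<Psi>'"
          unfolding btrace_append by blast
        \<comment> \<open>In the given run of \<open>A\<close> the blocks of \<open>q\<close>
          precede the output of \<open>ws\<close>, so their recipes cannot use it. The run of
          \<open>B\<close> has the same recipes.\<close>
        have "\<forall>R \<in> set (block_recipes q). vars R \<inter> set ws = {}"
        proof
          fix R assume "R \<in> set (block_recipes q)"
          then obtain d Ss vs where "(d, Ss, vs) \<in> set q" and R: "R \<in> set Ss"
            by (auto simp: block_recipes_def)
          then obtain q2 q3 where q: "q = q2 @ (d, Ss, vs) # q3" by (meson split_list)
          have "R \<in> recipes ar (dom \<Phi> \<union> all_handles (p @ q2))"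
            using btrace_recipes(1)[of f \<Phi> "p @ q2" d Ss vs "q3 @ (c, Rs, ws) # cs"] tr R
            by (simp add: xs as q)
          then have "vars R \<subseteq> dom \<Phi> \<union> all_handles as"
            by (auto simp: recipes_def as q)
          moreover have "(dom \<Phi> \<union> all_handles as) \<inter> set ws = {}"
          proof -
            from tr' obtain k \<Theta> l \<Theta>2 where "btrace f \<Phi> as k \<Theta>" "ccomp IPlus (k c) \<Theta> (io c Rs' ws) l \<Theta>2"
              by (auto simp: btrace_append)
            then show ?thesis using btrace_frame ccomp_block(5) by metis
          qed
          ultimately show "vars R \<inter> set ws = {}" by blast
        qed
        then have "btrace h' \<Theta>' (q @ (c, Rs', ws) # cs) g' \<Psi>'"
          using h'(2) c q_out by (intro btrace_move_back)
        with h'(1) have "btrace g \<Psi> (as @ (c, Rs', ws) # cs) g' \<Psi>'"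
          unfolding as append_assoc btrace_append[of _ _ p] by blast
        from restore[OF g'(2) this] g'(2) show ?thesis by blast
      next
        case True
        then have cs: "cs = []" using good by (intro good_last) simp
        note tr'' = tr'[unfolded True cs as append_assoc]
        from btrace_drop_improper[OF tr'' c q_out avoid] obtain k h \<Phi>2 where
          k: "btrace f \<Phi> (p @ q) k \<Phi>'" and h: "btrace f \<Phi> (p @ [(c, Rs', [])]) h \<Phi>2" by blast
        \<comment> \<open>Both traces used from here on are shorter than \<open>xs\<close>: this one
          yields a frame equivalent to \<open>\<Phi>'\<close>, the next one a run of
          \<open>B\<close> that performs the block early.\<close>
        have "(map chan (p @ q), map chan xs) \<in> lenlex r"
          by (simp add: xs as lenlex_conv)
        from IH[OF this _ k] chans obtain k' \<Psi>' where k': "btrace g \<Psi> (p @ q) k' \<Psi>'" "\<Phi>' \<sim>\<^sub>s \<Psi>'"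
          by (auto simp: xs as)
        have "(map chan (p @ [(c, Rs', [])]), map chan xs) \<in> lenlex r"
          by (simp add: xs as q_def lenlex_conv)
        from IH[OF this _ h] chans obtain h' \<Psi>2 where h': "btrace g \<Psi> (p @ [(c, Rs', [])]) h' \<Psi>2"
          by (auto simp: xs as)
        from btrace_add_improper[OF k'(1) h' valid c q_out] obtain g' where
          "btrace g \<Psi> (as @ (c, Rs', ws) # cs) g' \<Psi>'" by (auto simp: as cs True)
        from restore[OF k'(2) this] k'(2) show ?thesis by blast
      qed
    qed
  qed
qed

end

section \<open>Symbolic traces and reduced inclusion\<close>

definition inst_blocks :: "('y \<Rightarrow> 'r) \<Rightarrow> ('c, 'y, 'w) block list \<Rightarrow> ('c, 'r, 'w) block list" where
  "inst_blocks \<theta> bs = map (\<lambda>(c, Xs, ws). (c, map \<theta> Xs, ws)) bs"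

lemma inst_blocks_simps [simp]:
  "inst_blocks \<theta> [] = []"
  "inst_blocks \<theta> ((c, Xs, ws) # bs) = (c, map \<theta> Xs, ws) # inst_blocks \<theta> bs"
  "inst_blocks \<theta> (as @ bs) = inst_blocks \<theta> as @ inst_blocks \<theta> bs"
  by (simp_all add: inst_blocks_def)

lemma all_handles_inst_blocks [simp]: "all_handles (inst_blocks \<theta> bs) = all_handles bs"
  by (induction bs) (auto simp: inst_blocks_def)

lemma Dep_inst_blocks [simp]: "Dep (inst_blocks \<theta> bs) c = Dep bs c"
proof -
  have nth: "chan (inst_blocks \<theta> bs ! i) = chan (bs ! i)" if "i < length bs" for i
    using that by (simp add: inst_blocks_def case_prod_beta)
  have len: "length (inst_blocks \<theta> bs) = length bs" by (simp add: inst_blocks_def)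
  have ex: "(\<exists>b \<in> set (drop k (inst_blocks \<theta> bs)). w \<in> set (handles b)) \<longleftrightarrow>
      (\<exists>b \<in> set (drop k bs). w \<in> set (handles b))" for k w
    by (force simp: inst_blocks_def drop_map)
  show ?thesis unfolding Dep_def len ex by (auto simp: nth)
qed

lemma inst_blocks_cong:
  "(\<And>X. X \<in> set (block_recipes bs) \<Longrightarrow> \<theta> X = \<theta>' X) \<Longrightarrow> inst_blocks \<theta> bs = inst_blocks \<theta>' bs"
  by (fastforce simp: inst_blocks_def block_recipes_def)

lemma inst_blocks_eq_append:
  assumes "inst_blocks \<theta> bs = as @ (c, Rs, ws) # cs"
  obtains as' Xs cs' where "bs = as' @ (c, Xs, ws) # cs'" "as = inst_blocks \<theta> as'" "Rs = map \<theta> Xs"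
  using assms unfolding inst_blocks_def by (auto simp: map_eq_append_conv)

lemma inst_blocks_exists:
  assumes "infinite (UNIV :: 'y set)"
  obtains \<theta> :: "'y \<Rightarrow> 'r" and sb :: "('c, 'y, 'w) block list"
    where "bs = inst_blocks \<theta> sb" "distinct (block_recipes sb)"
proof -
  have "\<exists>\<theta> (sb :: ('c, 'y, 'w) block list). bs = inst_blocks \<theta> sb \<and> distinct (block_recipes sb)"
  proof (induction bs)
    case Nil
    show ?case by (intro exI[of _ "\<lambda>_. undefined"] exI[of _ "[]"]) simp
  next
    case (Cons b bs)
    then obtain \<theta> and sb :: "('c, 'y, 'w) block list"
      where sb: "bs = inst_blocks \<theta> sb" "distinct (block_recipes sb)" by blast
    obtain c Rs ws where b: "b = (c, Rs, ws)" by (cases b)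
    have "infinite (UNIV - set (block_recipes sb))" using assms by (simp add: Diff_infinite_finite)
    then obtain A where A: "A \<subseteq> UNIV - set (block_recipes sb)" "finite A" "card A = length Rs"
      by (meson infinite_arbitrarily_large)
    then obtain Xs where Xs: "set Xs = A" "distinct Xs"
      using finite_distinct_list by blast
    have len: "length Xs = length Rs" using Xs A(3) distinct_card by metis
    define \<theta>' where "\<theta>' X = (case map_of (zip Xs Rs) X of None \<Rightarrow> \<theta> X | Some R \<Rightarrow> R)" for X
    have "map \<theta>' Xs = Rs"
      using map_of_zip_nth[OF len Xs(2)] len by (auto intro!: nth_equalityI simp: \<theta>'_def)
    moreover have "inst_blocks \<theta>' sb = bs"
      unfolding sb(1)
    proof (rule inst_blocks_cong)
      fix X assume "X \<in> set (block_recipes sb)"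
      then have "X \<notin> set Xs" using A(1) Xs(1) by auto
      then have "map_of (zip Xs Rs) X = None" using map_of_zip_is_None[OF len] by blast
      then show "\<theta>' X = \<theta> X" by (simp add: \<theta>'_def)
    qed
    moreover have "distinct (block_recipes ((c, Xs, ws) # sb))"
      using Xs A(1) sb(2) by auto
    ultimately show ?case by (intro exI[of _ \<theta>'] exI[of _ "(c, Xs, ws) # sb"]) (simp add: b)
  qed
  with that show ?thesis by blast
qed

text \<open>Turns the recursion from the end of the trace into a quantification over its splittings,
  the form in which \<open>reduced\<close> is stated.\<close>

lemma AllDep_iff:
  "(Xs, W) \<in> AllDep bs \<longleftrightarrow> (\<exists>as c ws cs. bs = as @ (c, Xs, ws) # cs \<and> W = Dep as c \<and> W \<noteq> {})"
proof (induction bs rule: rev_induct)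
  case Nil
  then show ?case by (simp add: AllDep_Nil)
next
  case (snoc b bs)
  obtain d Ys vs where b: "b = (d, Ys, vs)" by (cases b)
  have "(\<exists>as c ws cs. bs @ [b] = as @ (c, Xs, ws) # cs \<and> W = Dep as c \<and> W \<noteq> {}) \<longleftrightarrow>
    Ys = Xs \<and> W = Dep bs d \<and> W \<noteq> {} \<or> (\<exists>as c ws cs. bs = as @ (c, Xs, ws) # cs \<and> W = Dep as c \<and> W \<noteq> {})"
    (is "?L \<longleftrightarrow> ?R")
  proof
    assume ?L
    then obtain as c ws cs where *: "bs @ [b] = as @ (c, Xs, ws) # cs" "W = Dep as c" "W \<noteq> {}" by blast
    show ?R
    proof (cases cs rule: rev_cases)
      case Nil
      with * b show ?thesis by simp
    next
      case (snoc cs' b')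
      with *(1) have "bs = as @ (c, Xs, ws) # cs'" by simp
      with * show ?thesis by blast
    qed
  next
    assume ?R
    then show ?L
    proof (elim disjE exE conjE)
      assume "Ys = Xs" "W = Dep bs d" "W \<noteq> {}"
      with b show ?L by (intro exI[of _ bs] exI[of _ d] exI[of _ vs] exI[of _ "[]"]) simp
    next
      fix as c ws cs assume "bs = as @ (c, Xs, ws) # cs" "W = Dep as c" "W \<noteq> {}"
      then show ?L by (intro exI[of _ as] exI[of _ c] exI[of _ ws] exI[of _ "cs @ [b]"]) simp
    qed
  qed
  with snoc show ?case by (auto simp: b AllDep_snoc)
qed

text \<open>The deduction domains produced by any symbolic run along the trace from an initial
  domain \<open>D\<close>. They are common to \<open>A\<close> and \<open>B\<close> when the initial
  frames have the same domain.\<close>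

fun block_deds :: "'w set \<Rightarrow> ('c, 'y, 'w) block list \<Rightarrow> ('y \<times> 'w set) set" where
  "block_deds D [] = {}"
| "block_deds D ((c, Xs, ws) # bs) = set Xs \<times> {D} \<union> block_deds (D \<union> set ws) bs"

lemma block_deds_append: "block_deds D (as @ bs) = block_deds D as \<union> block_deds (D \<union> all_handles as) bs"
  by (induction D as rule: block_deds.induct) (auto simp: Un_assoc)

lemma fst_block_deds: "fst ` block_deds D bs = set (block_recipes bs)"
  by (induction D bs rule: block_deds.induct) (auto simp: image_Un)

lemma block_deds_unique:
  "distinct (block_recipes bs) \<Longrightarrow> (X, D1) \<in> block_deds D bs \<Longrightarrow> (X, D2) \<in> block_deds D bs \<Longrightarrow> D1 = D2"
proof (induction D bs rule: block_deds.induct)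
  case (2 D c Xs ws bs)
  have "X \<in> set (block_recipes bs)" if "(X, D') \<in> block_deds (D \<union> set ws) bs" for D'
    using that fst_block_deds[of "D \<union> set ws" bs] by force
  with 2 show ?case by auto
qed simp

text \<open>Distinctness of the variables makes the definite description in \<open>ded_dom\<close>
  well-defined.\<close>

lemma ded_dom_block:
  assumes "deds S = block_deds D (as @ (c, Xs, ws) # cs)" "distinct (block_recipes (as @ (c, Xs, ws) # cs))"
    and "X \<in> set Xs"
  shows "ded_dom S X = D \<union> all_handles as"
  unfolding ded_dom_deds assms(1)
proof (rule the_equality)
  show in_ded: "(X, D \<union> all_handles as) \<in> block_deds D (as @ (c, Xs, ws) # cs)"
    using assms(3) by (simp add: block_deds_append)
  show "D' = D \<union> all_handles as" if "(X, D') \<in> block_deds D (as @ (c, Xs, ws) # cs)" for D'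
    using block_deds_unique[OF assms(2) that in_ded] .
qed

context term_model
begin

section \<open>Symbolic runs of several blocks\<close>

lemma strace_invars_step:
  assumes "scomp V l Q \<Phi> S (io c Xs ws) r \<Phi>' S'"
    and "\<Phi>' \<subseteq>\<^sub>m \<Phi>'' \<and> S' \<subseteq> S'' \<and> deds S'' = deds S' \<union> block_deds (dom \<Phi>') bs \<and>
      distinct (block_recipes bs) \<and> set (block_recipes bs) \<inter> fst ` deds S' = {}"
  shows "\<Phi> \<subseteq>\<^sub>m \<Phi>'' \<and> S \<subseteq> S'' \<and> deds S'' = deds S \<union> block_deds (dom \<Phi>) ((c, Xs, ws) # bs) \<and>
    distinct (block_recipes ((c, Xs, ws) # bs)) \<and> set (block_recipes ((c, Xs, ws) # bs)) \<inter> fst ` deds S = {}"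
proof -
  from scomp_invars[OF assms(1)] have b: "\<Phi> \<subseteq>\<^sub>m \<Phi>'" "S \<subseteq> S'" "dom \<Phi>' = dom \<Phi> \<union> set ws"
    "deds S' = deds S \<union> set Xs \<times> {dom \<Phi>}" "distinct Xs" "set Xs \<inter> fst ` deds S = {}"
    by simp_all
  have "fst ` deds S' = fst ` deds S \<union> set Xs"
    unfolding b(4) image_Un by simp
  then have "distinct (Xs @ block_recipes bs)" "set (Xs @ block_recipes bs) \<inter> fst ` deds S = {}"
    using b(5,6) assms(2) by auto
  moreover have "\<Phi> \<subseteq>\<^sub>m \<Phi>''" using b(1) assms(2) by (blast intro: map_le_trans)
  moreover have "S \<subseteq> S''" using b(2) assms(2) by blast
  moreover have "deds S'' = deds S \<union> (set Xs \<times> {dom \<Phi>} \<union> block_deds (dom \<Phi> \<union> set ws) bs)"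
    using assms(2) by (simp only: b(3,4) Un_assoc)
  ultimately show ?thesis by simp
qed

lemma strace_invars:
  "strace \<P> \<Phi> S bs \<P>' \<Phi>' S' \<Longrightarrow>
    \<Phi> \<subseteq>\<^sub>m \<Phi>' \<and> S \<subseteq> S' \<and> deds S' = deds S \<union> block_deds (dom \<Phi>) bs \<and>
    distinct (block_recipes bs) \<and> set (block_recipes bs) \<inter> fst ` deds S = {}"
proof (induction rule: strace.induct)
  case (Proper \<P> Q \<Phi> S c Xs ws Q' \<Phi>' S' bs \<P>'' \<Phi>'' S'')
  from Proper.hyps(1) Proper.IH show ?case by (rule strace_invars_step)
next
  case (Improper \<P> Q \<Phi> S c Xs ws \<Phi>' S' bs \<P>'' \<Phi>'' S'')
  from Improper.hyps(1) Improper.IH show ?case by (rule strace_invars_step)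
qed simp

lemma strace_sound:
  assumes "solves \<Phi>f Sf \<theta> \<rho>" "\<And>D X x. Deduce D X x \<in> Sf \<Longrightarrow> \<theta> X \<in> recipes ar D"
  shows "strace \<P> \<Phi> S bs \<P>' \<Phi>' S' \<Longrightarrow> rep \<P> f \<Longrightarrow> \<Phi>' \<subseteq>\<^sub>m \<Phi>f \<Longrightarrow> S' \<subseteq> Sf \<Longrightarrow>
    \<exists>f'. btrace (\<lambda>c. inst_proc \<rho> (f c)) (inst_frame \<rho> \<Phi>) (inst_blocks \<theta> bs) f' (inst_frame \<rho> \<Phi>')"
proof (induction arbitrary: f rule: strace.induct)
  case (Empty \<P> \<Phi> S)
  show ?case by simp
next
  case (Proper \<P> Q \<Phi> S c Xs ws Q' \<Phi>' S' bs \<P>'' \<Phi>'' S'')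
  note inv = strace_invars[OF Proper.hyps(2)]
  have "ccomp IPlus (inst_proc \<rho> Q) (inst_frame \<rho> \<Phi>) (inst_acts \<theta> (io c Xs ws))
      (map_option (inst_proc \<rho>) (Some Q')) (inst_frame \<rho> \<Phi>')"
    by (rule scomp_sound[OF assms Proper.hyps(1)])
      (use inv Proper.prems in \<open>auto intro: map_le_trans\<close>)
  then have cc: "ccomp IPlus (inst_proc \<rho> Q) (inst_frame \<rho> \<Phi>) (io c (map \<theta> Xs) ws)
      (Some (inst_proc \<rho> Q')) (inst_frame \<rho> \<Phi>')"
    by (simp add: inst_acts_io)
  from Proper.prems(1) obtain d where d: "f d = Q"
    "\<And>Q'. on_channel d Q' \<Longrightarrow> rep (add_proc Q' \<P>) (f(d := Q'))" by (rule rep_pick) blast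
  have "on_channel d (inst_proc \<rho> Q)" using rep_on_channel[OF Proper.prems(1), of d] d(1) by simp
  \<comment> \<open>\<open>d\<close> is the channel where the process is stored and \<open>c\<close>
    the one named by the block; they agree because the block starts with an input.\<close>
  note ch = ccomp_block_channel[OF cc this]
  have "on_channel d Q'" using ch(2) by simp
  from Proper.IH[OF d(2)[OF this] Proper.prems(2,3)] obtain f' where
    "btrace (\<lambda>c. inst_proc \<rho> ((f(d := Q')) c)) (inst_frame \<rho> \<Phi>') (inst_blocks \<theta> bs) f' (inst_frame \<rho> \<Phi>'')"
    by blast
  moreover have "(\<lambda>c. inst_proc \<rho> ((f(d := Q')) c)) =
      next_state (\<lambda>c. inst_proc \<rho> (f c)) c (Some (inst_proc \<rho> Q'))"
    using ch(1) by auto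
  ultimately have "btrace (next_state (\<lambda>c. inst_proc \<rho> (f c)) c (Some (inst_proc \<rho> Q')))
      (inst_frame \<rho> \<Phi>') (inst_blocks \<theta> bs) f' (inst_frame \<rho> \<Phi>'')" by (simp only:)
  moreover have "ccomp IPlus (inst_proc \<rho> (f c)) (inst_frame \<rho> \<Phi>) (io c (map \<theta> Xs) ws)
      (Some (inst_proc \<rho> Q')) (inst_frame \<rho> \<Phi>')"
    using cc d(1) ch(1) by simp
  ultimately show ?case unfolding inst_blocks_simps btrace.simps by blast
next
  case (Improper \<P> Q \<Phi> S c Xs ws \<Phi>' S' bs \<P>'' \<Phi>'' S'')
  note inv = strace_invars[OF Improper.hyps(2)]
  have "ccomp IPlus (inst_proc \<rho> Q) (inst_frame \<rho> \<Phi>) (inst_acts \<theta> (io c Xs ws))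
      (map_option (inst_proc \<rho>) None) (inst_frame \<rho> \<Phi>')"
    by (rule scomp_sound[OF assms Improper.hyps(1)])
      (use inv Improper.prems in \<open>auto intro: map_le_trans\<close>)
  then have cc: "ccomp IPlus (inst_proc \<rho> Q) (inst_frame \<rho> \<Phi>) (io c (map \<theta> Xs) ws)
      None (inst_frame \<rho> \<Phi>')"
    by (simp add: inst_acts_io)
  from Improper.prems(1) obtain d where d: "f d = Q" by (rule rep_pick) blast
  have "on_channel d (inst_proc \<rho> Q)" using rep_on_channel[OF Improper.prems(1), of d] d(1) by simp
  note ch = ccomp_block_channel(1)[OF cc this]
  from Improper.IH[OF rep_empty Improper.prems(2,3)] obtain f' where
    "btrace (\<lambda>c. Null) (inst_frame \<rho> \<Phi>') (inst_blocks \<theta> bs) f' (inst_frame \<rho> \<Phi>'')" by auto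
  then show ?case using cc d(1) ch by (auto intro!: exI[of _ f'] exI[of _ None])
qed

lemma strace_complete:
  assumes "infinite (UNIV :: 'x set)"
  shows "btrace (\<lambda>c. inst_proc \<rho> (f c)) (inst_frame \<rho> \<Phi>) (inst_blocks \<theta> bs) g \<Psi> \<Longrightarrow> rep \<P> f \<Longrightarrow>
    sol_on \<Phi> S \<theta> \<rho> \<Longrightarrow> finite (dom \<Phi>) \<Longrightarrow> finite S \<Longrightarrow> distinct (block_recipes bs) \<Longrightarrow>
    set (block_recipes bs) \<inter> fst ` deds S = {} \<Longrightarrow>
    \<exists>\<P>' \<Phi>' S' \<rho>'. strace \<P> \<Phi> S bs \<P>' \<Phi>' S' \<and> sol_on \<Phi>' S' \<theta> \<rho>' \<and> \<Psi> = inst_frame \<rho>' \<Phi>'"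
proof (induction bs arbitrary: \<rho> f \<Phi> \<P> S)
  case Nil
  then show ?case by (auto intro!: exI[of _ \<P>] exI[of _ \<Phi>] exI[of _ S] exI[of _ \<rho>] strace.Empty)
next
  case (Cons b bs)
  obtain c Xs ws where b: "b = (c, Xs, ws)" by (cases b)
  from Cons.prems(1) obtain r \<Psi>1 where
    cc: "ccomp IPlus (inst_proc \<rho> (f c)) (inst_frame \<rho> \<Phi>) (inst_acts \<theta> (io c Xs ws)) r \<Psi>1"
    and bt: "btrace (next_state (\<lambda>c. inst_proc \<rho> (f c)) c r) \<Psi>1 (inst_blocks \<theta> bs) g \<Psi>"
    by (auto simp: b inst_acts_io)
  then have "f c \<noteq> Null" using not_ccomp_IPlus_Null by (metis inst_proc_eq_Null)
  with Cons.prems(2) obtain \<P>0 where P: "\<P> = add_mset (f c) \<P>0"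
    "set_mset \<P>0 = f ` ({d. f d \<noteq> Null} - {c})"
    "\<And>Q. on_channel c Q \<Longrightarrow> rep (add_proc Q \<P>0) (f(c := Q))" by (rule rep_upd) blast
  let ?V = "\<Union> (all_vars ` set_mset \<P>0)"
  have "finite ?V" by (simp add: finite_all_vars)
  note compl = scomp_complete[OF assms this cc Cons.prems(3-5)]
  have fresh: "distinct (inl (io c Xs ws))" "set (inl (io c Xs ws)) \<inter> fst ` deds S = {}"
    using Cons.prems(6,7) by (auto simp: b)
  from compl[OF fresh] obtain r' \<Phi>1 S1 \<rho>1 where
    sc: "scomp ?V IPlus (f c) \<Phi> S (io c Xs ws) r' \<Phi>1 S1" and sol: "sol_on \<Phi>1 S1 \<theta> \<rho>1"
    and r: "r = map_option (inst_proc \<rho>1) r'" and \<Psi>1: "\<Psi>1 = inst_frame \<rho>1 \<Phi>1"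
    and fin: "finite (dom \<Phi>1)" "finite S1" and V: "\<forall>x \<in> ?V. \<rho>1 x = \<rho> x" by blast
  have "deds S1 = deds S \<union> set Xs \<times> {dom \<Phi>}"
    using scomp_invars[OF sc] by simp
  then have dist: "distinct (block_recipes bs)" "set (block_recipes bs) \<inter> fst ` deds S1 = {}"
    using Cons.prems(6,7) by (auto simp: b image_Un)
  show ?case
  proof (cases r')
    case None
    have "btrace (\<lambda>c. inst_proc \<rho>1 Null) (inst_frame \<rho>1 \<Phi>1) (inst_blocks \<theta> bs) g \<Psi>"
      using bt by (simp add: r None \<Psi>1)
    from Cons.IH[OF this rep_empty sol fin dist] sc None show ?thesis
      unfolding b P(1) by (blast intro: strace.Improper)
  next
    case (Some Q)
    have "on_channel c (inst_proc \<rho> (f c))" using rep_on_channel[OF Cons.prems(2)] by simp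
    from ccomp_channel[OF cc this] have "on_channel c Q" by (simp add: r Some)
    \<comment> \<open>The free variables of the other processes lie in \<open>?V\<close>, where
      \<open>\<rho>1\<close> agrees with \<open>\<rho>\<close>: the block took its new variables
      from elsewhere.\<close>
    have others: "inst_proc \<rho> (f d) = inst_proc \<rho>1 (f d)" if "d \<noteq> c" for d
    proof (cases "f d = Null")
      case False
      with that have "f d \<in># \<P>0" unfolding P(2) by blast
      then have "free_vars (f d) \<subseteq> ?V" using free_vars_subset_all_vars[of "f d"] by blast
      with V show ?thesis by (intro inst_proc_cong) auto
    qed simp
    have "next_state (\<lambda>c. inst_proc \<rho> (f c)) c r = (\<lambda>d. inst_proc \<rho>1 ((f(c := Q)) d))"
      using others by (auto simp: r Some)
    with bt have "btrace (\<lambda>d. inst_proc \<rho>1 ((f(c := Q)) d)) (inst_frame \<rho>1 \<Phi>1) (inst_blocks \<theta> bs) g \<Psi>"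
      by (simp add: \<Psi>1)
    from Cons.IH[OF this P(3)[OF \<open>on_channel c Q\<close>] sol fin dist] sc Some show ?thesis
      unfolding b P(1) by (blast intro: strace.Proper)
  qed
qed

text \<open>\<open>solves\<close> asks for a ground term at every variable, constrained or not; the
  public constant supplies one.\<close>

lemma solves_initial: "\<forall>t \<in> ran \<Phi>. valid t \<Longrightarrow> \<exists>\<rho>. sol_on \<Phi> {} \<theta> \<rho>"
proof -
  assume valid: "\<forall>t \<in> ran \<Phi>. valid t"
  obtain k where "ar k = 0" using public_constant by blast
  then have "\<forall>x :: 'x. ground ar ((\<lambda>_. App k []) x)" by (simp add: ground_def)
  moreover have "inst_frame (\<lambda>_. App k []) \<Phi> = \<Phi>"
    by (rule inst_frame_ground) (use valid valid_no_vars in blast)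
  ultimately show ?thesis
    using valid by (intro exI[of _ "\<lambda>_. App k []"]) (simp add: sol_on_def solves_def)
qed

lemma Sol_assoc_subst: "\<theta> \<in> Sol \<Phi> S \<Longrightarrow> solves \<Phi> S \<theta> (assoc_subst \<Phi> S \<theta>)"
  unfolding Sol_def assoc_subst_def by (simp add: someI_ex[of "solves \<Phi> S \<theta>"])

text \<open>The hypotheses let the domain of each variable be read off from the trace:
  \<open>ded_dom S X\<close> is \<open>D\<close> extended by the handles of the preceding
  blocks.\<close>

lemma sat_deps_iff_reduced:
  assumes "deds S = block_deds D bs" "distinct (block_recipes bs)"
  shows "sat_deps \<Phi> S \<theta> (AllDep bs) \<longleftrightarrow> reduced D (sol_frame \<Phi> S \<theta>) (inst_blocks \<theta> bs)"
proof
  assume sat: "sat_deps \<Phi> S \<theta> (AllDep bs)"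
  show "reduced D (sol_frame \<Phi> S \<theta>) (inst_blocks \<theta> bs)"
    unfolding reduced_def
  proof (intro allI impI)
    fix as c Rs ws cs
    assume "inst_blocks \<theta> bs = as @ (c, Rs, ws) # cs" and ne: "Dep as c \<noteq> {}"
    then obtain as' Xs cs' where bs: "bs = as' @ (c, Xs, ws) # cs'" and as: "as = inst_blocks \<theta> as'"
      and Rs: "Rs = map \<theta> Xs" by (elim inst_blocks_eq_append)
    have "(Xs, Dep as' c) \<in> AllDep bs"
      unfolding AllDep_iff using bs ne as by auto
    with sat obtain X where X: "X \<in> set Xs" "\<forall>R \<in> recipes ar (ded_dom S X).
        app_frame (sol_frame \<Phi> S \<theta>) R =\<^sub>E app_frame (sol_frame \<Phi> S \<theta>) (\<theta> X) \<longrightarrow>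
        valid (app_frame (sol_frame \<Phi> S \<theta>) R) \<longrightarrow> vars R \<inter> Dep as' c \<noteq> {}"
      unfolding sat_deps_def by fast
    have "ded_dom S X = D \<union> all_handles as"
      using ded_dom_block[OF assms[unfolded bs] X(1)] as by simp
    with X show "\<exists>R \<in> set Rs. \<forall>R' \<in> recipes ar (D \<union> all_handles as).
      app_frame (sol_frame \<Phi> S \<theta>) R' =\<^sub>E app_frame (sol_frame \<Phi> S \<theta>) R \<longrightarrow>
      valid (app_frame (sol_frame \<Phi> S \<theta>) R') \<longrightarrow> vars R' \<inter> Dep as c \<noteq> {}"
      by (auto simp: Rs as)
  qed
next
  assume red: "reduced D (sol_frame \<Phi> S \<theta>) (inst_blocks \<theta> bs)"
  have "\<exists>X \<in> set Xs. \<forall>R \<in> recipes ar (ded_dom S X).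
      app_frame (sol_frame \<Phi> S \<theta>) R =\<^sub>E app_frame (sol_frame \<Phi> S \<theta>) (\<theta> X) \<longrightarrow>
      valid (app_frame (sol_frame \<Phi> S \<theta>) R) \<longrightarrow> vars R \<inter> W \<noteq> {}" if "(Xs, W) \<in> AllDep bs" for Xs W
  proof -
    from that[unfolded AllDep_iff] obtain as c ws cs where bs: "bs = as @ (c, Xs, ws) # cs"
      and W: "W = Dep as c" "W \<noteq> {}" by blast
    have "inst_blocks \<theta> bs = inst_blocks \<theta> as @ (c, map \<theta> Xs, ws) # inst_blocks \<theta> cs"
      by (simp add: bs)
    from red[unfolded reduced_def, rule_format, OF this] W
    obtain X where X: "X \<in> set Xs" "\<forall>R' \<in> recipes ar (D \<union> all_handles as).
      app_frame (sol_frame \<Phi> S \<theta>) R' =\<^sub>E app_frame (sol_frame \<Phi> S \<theta>) (\<theta> X) \<longrightarrow>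
      valid (app_frame (sol_frame \<Phi> S \<theta>) R') \<longrightarrow> vars R' \<inter> W \<noteq> {}" by auto
    from X(2) show ?thesis
      unfolding ded_dom_block[OF assms[unfolded bs] X(1), symmetric] using X(1) by (intro bexI)
  qed
  then show "sat_deps \<Phi> S \<theta> (AllDep bs)" unfolding sat_deps_def by fast
qed

lemma strace_to_btrace:
  assumes "strace \<P> \<Phi> {} bs \<P>' \<Phi>' S'" "rep \<P> f" "\<And>c. free_vars (f c) = {}"
    and valid: "\<forall>t \<in> ran \<Phi>. valid t" and "\<theta> \<in> Sol \<Phi>' S'" "solves \<Phi>' S' \<theta> \<rho>"
  shows "\<exists>f'. btrace f \<Phi> (inst_blocks \<theta> bs) f' (inst_frame \<rho> \<Phi>')"
proof -
  have "inst_frame \<rho> \<Phi> = \<Phi>"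
    by (rule inst_frame_ground) (use valid valid_no_vars in blast)
  moreover have "(\<lambda>c. inst_proc \<rho> (f c)) = f"
    using assms(3) by (simp add: inst_proc_closed)
  ultimately show ?thesis
    using strace_sound[OF assms(6) _ assms(1,2)] assms(5) by (auto simp: Sol_def)
qed

text \<open>The substitution built along the run and the representative chosen by
  \<open>assoc_subst\<close> may differ. Uniqueness modulo \<open>=\<^sub>E\<close> is obtained on
  frames: by soundness the chosen one yields a run of the same concrete trace, and determinism
  relates the two final frames.\<close>

lemma btrace_to_strace:
  assumes "infinite (UNIV :: 'x set)" and bt: "btrace f \<Phi> (inst_blocks \<theta> bs) g \<Psi>"
    and rep: "rep \<P> f" and closed: "\<And>c. free_vars (f c) = {}"
    and valid: "\<forall>t \<in> ran \<Phi>. valid t" and "finite (dom \<Phi>)" "distinct (block_recipes bs)"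
  shows "\<exists>\<P>' \<Phi>' S'. strace \<P> \<Phi> {} bs \<P>' \<Phi>' S' \<and> \<theta> \<in> Sol \<Phi>' S' \<and> sol_frame \<Phi>' S' \<theta> \<sim>\<^sub>s \<Psi>"
proof -
  obtain \<rho> where \<rho>: "sol_on \<Phi> {} \<theta> \<rho>" using solves_initial[OF valid] by blast
  have "inst_frame \<rho> \<Phi> = \<Phi>"
    by (rule inst_frame_ground) (use valid valid_no_vars in blast)
  moreover have "(\<lambda>c. inst_proc \<rho> (f c)) = f"
    using closed by (simp add: inst_proc_closed)
  ultimately have "btrace (\<lambda>c. inst_proc \<rho> (f c)) (inst_frame \<rho> \<Phi>) (inst_blocks \<theta> bs) g \<Psi>"
    using bt by simp
  from strace_complete[OF assms(1) this rep \<rho>] assms(6,7) obtain \<P>' \<Phi>' S' \<rho>' where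
    st: "strace \<P> \<Phi> {} bs \<P>' \<Phi>' S'" and sol: "sol_on \<Phi>' S' \<theta> \<rho>'" by auto
  from sol have Sol: "\<theta> \<in> Sol \<Phi>' S'"
    unfolding Sol_def sol_on_def deds_def by fast
  from strace_to_btrace[OF st rep closed valid Sol Sol_assoc_subst[OF Sol]]
  obtain f' where "btrace f \<Phi> (inst_blocks \<theta> bs) f' (sol_frame \<Phi>' S' \<theta>)"
    by (auto simp: sol_frame_def)
  from btrace_determ[OF this _ feq_refl[OF valid] bt] have "feq (sol_frame \<Phi>' S' \<theta>) \<Psi>"
    using peq_refl by blast
  with st Sol show ?thesis using feq_static_equiv by blast
qed

text \<open>\<open>incl_c\<close> matches sequences of actions, which \<open>B\<close> might a
  priori cut into blocks differently; \<open>flat_inject\<close> excludes this.\<close>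

lemma incl_c_iff_btrace:
  assumes "rep \<P> f" "rep \<Q> g"
  shows "incl_c (\<P>, \<Phi>) (\<Q>, \<Psi>) \<longleftrightarrow>
    (\<forall>bs f' \<Phi>'. btrace f \<Phi> bs f' \<Phi>' \<longrightarrow> (\<exists>g' \<Psi>'. btrace g \<Psi> bs g' \<Psi>' \<and> \<Phi>' \<sim>\<^sub>s \<Psi>'))"
proof
  assume incl: "incl_c (\<P>, \<Phi>) (\<Q>, \<Psi>)"
  show "\<forall>bs f' \<Phi>'. btrace f \<Phi> bs f' \<Phi>' \<longrightarrow> (\<exists>g' \<Psi>'. btrace g \<Psi> bs g' \<Psi>' \<and> \<Phi>' \<sim>\<^sub>s \<Psi>')"
  proof (intro allI impI)
    fix bs f' \<Phi>' assume bt: "btrace f \<Phi> bs f' \<Phi>'"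
    from btrace_ctrace[OF this assms(1)] obtain \<P>' where "ctrace \<P> \<Phi> (flat bs) \<P>' \<Phi>'" by blast
    from incl[unfolded incl_c_def fst_conv snd_conv, rule_format, OF this]
    obtain \<Q>' \<Psi>' where ct: "ctrace \<Q> \<Psi> (flat bs) \<Q>' \<Psi>'" and eq: "\<Phi>' \<sim>\<^sub>s \<Psi>'" by blast
    from ctrace_btrace[OF ct assms(2)] obtain bs' g' where
      bt': "btrace g \<Psi> bs' g' \<Psi>'" and flat: "flat bs = flat bs'" by blast
    have "bs = bs'" using btrace_good[OF bt] btrace_good[OF bt'] flat by (rule flat_inject)
    with bt' eq show "\<exists>g' \<Psi>'. btrace g \<Psi> bs g' \<Psi>' \<and> \<Phi>' \<sim>\<^sub>s \<Psi>'" by blast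
  qed
next
  assume R: "\<forall>bs f' \<Phi>'. btrace f \<Phi> bs f' \<Phi>' \<longrightarrow> (\<exists>g' \<Psi>'. btrace g \<Psi> bs g' \<Psi>' \<and> \<Phi>' \<sim>\<^sub>s \<Psi>')"
  show "incl_c (\<P>, \<Phi>) (\<Q>, \<Psi>)"
    unfolding incl_c_def fst_conv snd_conv
  proof (intro allI impI)
    fix tr \<P>' \<Phi>' assume "ctrace \<P> \<Phi> tr \<P>' \<Phi>'"
    from ctrace_btrace[OF this assms(1)] obtain bs f' where
      "btrace f \<Phi> bs f' \<Phi>'" and tr: "tr = flat bs" by blast
    with R obtain g' \<Psi>' where "btrace g \<Psi> bs g' \<Psi>'" and eq: "\<Phi>' \<sim>\<^sub>s \<Psi>'" by blast
    from btrace_ctrace[OF this(1) assms(2)] eq tr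
    show "\<exists>\<Q>' \<Psi>'. ctrace \<Q> \<Psi> tr \<Q>' \<Psi>' \<and> \<Phi>' \<sim>\<^sub>s \<Psi>'" by blast
  qed
qed

lemma incl_c_iff_incl_rs:
  fixes \<P> \<Q> :: "('f, 'n, 'x, 'c::linorder) proc multiset" and \<Phi> \<Psi> :: "('f, 'n, 'x, 'w) frame"
  assumes inf: "infinite (UNIV :: 'x set)" "infinite (UNIV :: 'y set)"
    and A: "ext_simple \<P> \<Phi>" and B: "ext_simple \<Q> \<Psi>"
  shows "incl_c (\<P>, \<Phi>) (\<Q>, \<Psi>) \<longleftrightarrow> incl_rs TYPE('y) (\<P>, \<Phi>) (\<Q>, \<Psi>)"
proof -
  from A have \<Phi>: "\<forall>t \<in> ran \<Phi>. valid t" "finite (dom \<Phi>)" and simple_P: "simple_proc ar \<P>"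
    by (auto simp: ext_simple_def)
  obtain f where f: "rep \<P> f" "\<And>c. free_vars (f c) = {}"
    using rep_exists[OF simple_P] by blast
  from B have \<Psi>: "\<forall>t \<in> ran \<Psi>. valid t" "finite (dom \<Psi>)" and simple_Q: "simple_proc ar \<Q>"
    by (auto simp: ext_simple_def)
  obtain g where g: "rep \<Q> g" "\<And>c. free_vars (g c) = {}"
    using rep_exists[OF simple_Q] by blast
  note iff = incl_c_iff_btrace[OF f(1) g(1), of \<Phi> \<Psi>]
  show ?thesis
  proof
    assume "incl_c (\<P>, \<Phi>) (\<Q>, \<Psi>)"
    note incl = this[unfolded iff, rule_format]
    have "btrace f \<Phi> [] f \<Phi>" by simp
    from incl[OF this] have "\<Phi> \<sim>\<^sub>s \<Psi>" by simp
    then have dom: "dom \<Phi> = dom \<Psi>" by (rule static_equiv_dom)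
    show "incl_rs TYPE('y) (\<P>, \<Phi>) (\<Q>, \<Psi>)"
      unfolding incl_rs_def fst_conv snd_conv
    proof (intro allI impI)
      fix bs :: "('c, 'y, 'w) block list" and \<P>' \<Phi>' SA \<theta>
      assume st: "strace \<P> \<Phi> {} bs \<P>' \<Phi>' SA" and Sol: "\<theta> \<in> Sol \<Phi>' SA"
        and sat: "sat_deps \<Phi>' SA \<theta> (AllDep bs)"
      let ?A = "sol_frame \<Phi>' SA \<theta>"
      from strace_invars[OF st] have dA: "deds SA = block_deds (dom \<Phi>) bs" "distinct (block_recipes bs)"
        by simp_all
      from strace_to_btrace[OF st f \<Phi>(1) Sol Sol_assoc_subst[OF Sol]] obtain f' where
        btA: "btrace f \<Phi> (inst_blocks \<theta> bs) f' ?A" by (auto simp: sol_frame_def)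
      from incl[OF this] obtain g' \<Psi>' where btB: "btrace g \<Psi> (inst_blocks \<theta> bs) g' \<Psi>'"
        and eq: "?A \<sim>\<^sub>s \<Psi>'" by blast
      from btrace_to_strace[OF inf(1) btB g \<Psi> dA(2)] obtain \<Q>' \<Psi>'' SB where
        stB: "strace \<Q> \<Psi> {} bs \<Q>' \<Psi>'' SB" and SolB: "\<theta> \<in> Sol \<Psi>'' SB"
        and "sol_frame \<Psi>'' SB \<theta> \<sim>\<^sub>s \<Psi>'" by blast
      with eq have eqB: "?A \<sim>\<^sub>s sol_frame \<Psi>'' SB \<theta>"
        by (blast intro: static_equiv_trans static_equiv_sym)
      from strace_invars[OF stB] have dB: "deds SB = block_deds (dom \<Phi>) bs" by (simp add: dom)
      \<comment> \<open>\<open>B\<close> inherits the dependency constraints: the domains of the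
        variables coincide with those in \<open>A\<close>, and the final frames are statically
        equivalent.\<close>
      have "sat_deps \<Psi>'' SB \<theta> (AllDep bs)"
        using sat unfolding sat_deps_iff_reduced[OF dA] sat_deps_iff_reduced[OF dB dA(2)]
        by (rule reduced_static_equiv[OF _ btA refl eqB])
      with stB SolB eqB show "\<exists>\<Q>' \<Psi>' SB. strace \<Q> \<Psi> {} bs \<Q>' \<Psi>' SB \<and> \<theta> \<in> Sol \<Psi>' SB \<and>
          sat_deps \<Psi>' SB \<theta> (AllDep bs) \<and> ?A \<sim>\<^sub>s sol_frame \<Psi>' SB \<theta>" by blast
    qed
  next
    assume incl: "incl_rs TYPE('y) (\<P>, \<Phi>) (\<Q>, \<Psi>)"
    \<comment> \<open>\<open>\<Phi>'\<close> comes from a concrete run, while \<open>incl_rs\<close>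
      speaks of \<open>sol_frame\<close>. The two frames are statically equivalent, which suffices
      to transfer both \<open>reduced\<close> and the conclusion.\<close>
    have match: "\<exists>g' \<Psi>'. btrace g \<Psi> bs g' \<Psi>' \<and> \<Phi>' \<sim>\<^sub>s \<Psi>'"
      if bt: "btrace f \<Phi> bs f' \<Phi>'" and red: "reduced (dom \<Phi>) \<Phi>' bs" for bs f' \<Phi>'
    proof -
      obtain \<theta> :: "'y \<Rightarrow> ('f, 'n, 'w) trm" and sb :: "('c, 'y, 'w) block list"
        where bs: "bs = inst_blocks \<theta> sb" and dist: "distinct (block_recipes sb)"
        by (rule inst_blocks_exists[OF inf(2)])
      from btrace_to_strace[OF inf(1) bt[unfolded bs] f \<Phi> dist] obtain \<P>' \<Phi>'' SA where
        st: "strace \<P> \<Phi> {} sb \<P>' \<Phi>'' SA" and Sol: "\<theta> \<in> Sol \<Phi>'' SA"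
        and eqA: "sol_frame \<Phi>'' SA \<theta> \<sim>\<^sub>s \<Phi>'" by blast
      from strace_invars[OF st] have dA: "deds SA = block_deds (dom \<Phi>) sb" by simp
      have "reduced (dom \<Phi>) (sol_frame \<Phi>'' SA \<theta>) bs"
        using red bt refl static_equiv_sym[OF eqA] by (rule reduced_static_equiv)
      then have "sat_deps \<Phi>'' SA \<theta> (AllDep sb)"
        unfolding sat_deps_iff_reduced[OF dA dist] bs .
      with incl st Sol obtain \<Q>' \<Psi>' SB where stB: "strace \<Q> \<Psi> {} sb \<Q>' \<Psi>' SB"
        and SolB: "\<theta> \<in> Sol \<Psi>' SB" and eq: "sol_frame \<Phi>'' SA \<theta> \<sim>\<^sub>s sol_frame \<Psi>' SB \<theta>"
        unfolding incl_rs_def fst_conv snd_conv by blast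
      from strace_to_btrace[OF stB g \<Psi>(1) SolB Sol_assoc_subst[OF SolB]] obtain g' where
        "btrace g \<Psi> bs g' (sol_frame \<Psi>' SB \<theta>)" by (auto simp: sol_frame_def bs)
      moreover have "\<Phi>' \<sim>\<^sub>s sol_frame \<Psi>' SB \<theta>"
        using static_equiv_sym[OF eqA] eq by (rule static_equiv_trans)
      ultimately show ?thesis by blast
    qed
    show "incl_c (\<P>, \<Phi>) (\<Q>, \<Psi>)"
      unfolding iff
    proof (intro allI impI)
      fix bs f' \<Phi>' assume "btrace f \<Phi> bs f' \<Phi>'"
      from reduced_suffices[OF _ \<Psi>(1) this] match
      show "\<exists>g' \<Psi>'. btrace g \<Psi> bs g' \<Psi>' \<and> \<Phi>' \<sim>\<^sub>s \<Psi>'" .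
    qed
  qed
qed

end

theorem theorem3:
  fixes ar :: "'f \<Rightarrow> nat"
    and E :: "(('f, 'n, 'x) trm \<times> ('f, 'n, 'x) trm) set"
    and Msg :: "('f, 'n, 'x) trm set"
    and \<P> \<Q> :: "('f, 'n, 'x, 'c::linorder) proc multiset"
    and \<Phi> \<Psi> :: "('f, 'n, 'x, 'w) frame"
  assumes "term_model ar E Msg"
    and "infinite (UNIV :: 'x set)"
    and "infinite (UNIV :: 'w set)"
    and "infinite (UNIV :: 'y set)"
    and "term_model.ext_simple ar E Msg \<P> \<Phi>"
    and "term_model.ext_simple ar E Msg \<Q> \<Psi>"
  shows "term_model.incl_c ar E Msg (\<P>, \<Phi>) (\<Q>, \<Psi>) \<longleftrightarrow>
         term_model.incl_rs ar E Msg TYPE('y) (\<P>, \<Phi>) (\<Q>, \<Psi>)"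
  using assms(1,2,4,5,6) by (rule term_model.incl_c_iff_incl_rs)

end
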